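(* For every $\varepsilon>0$ there is a constant $K(\varepsilon)>0$ such that, for every prime $p$, every non-principal multiplicative character $\chi$ modulo $p$, and every integer $N$ with $p>N\ge p^{1/8+\varepsilon}$, one has $$T_\chi(N)\le K(\varepsilon)\,N^4\,\frac{\log\log p}{\log p},$$ where $$T_\chi(N)=\sum_{1\le a\le N}\ \sum_{1\le b\le N}\ \sum_{1\le c\le N}\left|\sum_{1\le d\le N}\chi(ab-cd)\right|.$$
   Context: A multiplicative character $\chi$ modulo $p$ is viewed as a function on $\mathbb Z$ (Dirichlet character), with $\chi(n)=0$ when $p\mid n$. (There is no non-principal character modulo $2$, so $p\ge 3$ and $\log\log p>0$.) *)

theory Defs
  imports Complex_Main "HOL-Computational_Algebra.Primes"
begin

text \<open>
  A character of the unit group of the integers modulo \<open>m\<close>, viewed as a function on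
  the integers by periodicity and extended by 0 to arguments not coprime to \<open>m\<close>.
  The value at 1 is a nonzero idempotent, hence it is automatically 1.
\<close>

definition dirichlet_character :: "nat \<Rightarrow> (int \<Rightarrow> complex) \<Rightarrow> bool" where
  "dirichlet_character m \<chi> \<longleftrightarrow>
     (\<forall>a b. \<chi> (a * b) = \<chi> a * \<chi> b) \<and>
     (\<forall>a. \<chi> (a + int m) = \<chi> a) \<and>
     (\<forall>a. \<chi> a = 0 \<longleftrightarrow> \<not> coprime a (int m))"

definition principal_character :: "nat \<Rightarrow> int \<Rightarrow> complex" where
  "principal_character m a = (if coprime a (int m) then 1 else 0)"

definition T_sum :: "(int \<Rightarrow> complex) \<Rightarrow> int \<Rightarrow> real" where
  "T_sum \<chi> N =
     (\<Sum>a = 1..N. \<Sum>b = 1..N. \<Sum>c = 1..N. cmod (\<Sum>d = 1..N. \<chi> (a * b - c * d)))"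

end

theory Submission
  imports "HOL-Algebra.Algebraic_Closure_Type" "Berlekamp_Zassenhaus.Finite_Field" "HOL-Library.FuncSet"
    "HOL-Computational_Algebra.Fundamental_Theorem_Algebra" Defs
begin

text \<open>
  Up to a factor of modulus at most one, the sum of \<open>\<chi>(ab - cd)\<close> over \<open>d\<close> is a sum of \<open>\<chi>\<close> over an
  interval whose position is the residue \<open>ab/c\<close>, and averaging over \<open>a, b, c\<close> makes up for the
  shortness of that interval. As in Burgess's method, \<open>d\<close> is first replaced by \<open>d + ut\<close> with
  \<open>u \<le> U\<close> and \<open>t \<le> V\<close>, where \<open>V\<close> is a small power of \<open>p\<close> and \<open>UV\<close> is slightly smaller than \<open>N\<close>
  (\<open>average_shift\<close>). The innermost sum then becomes \<open>W(\<lambda>) = \<bar>\<Sum>\<^sub>t \<chi>(t - \<lambda>)\<bar>\<close>, where \<open>\<lambda>\<close> is the residue of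
  \<open>(ab - cd)/(cu)\<close>. There are about \<open>N\<^sup>4U\<close> quintuples \<open>(a, b, c, d, u)\<close>. Two of them with the same
  \<open>\<lambda>\<close> give a factorisation of a nonzero integer
  \<open>(ab - cd)c'u' = (a'b' - c'd')cu + kp\<close>, so that the divisor bound shows that the values \<open>\<lambda>\<close> are
  spread almost evenly: coincidences number at most \<open>p\<^bsup>o(1)\<^esup> N\<^sup>5U(1 + N\<^sup>3U/p)\<close>
  (\<open>energy_bound\<close>). By Hoelder's inequality (\<open>holder_energy\<close>) it remains to bound the complete
  moment \<open>\<Sum>\<^sub>\<lambda> W(\<lambda>)\<^bsup>2r\<^esup>\<close> by \<open>V\<^bsup>2r\<^esup> \<surd>p\<close> up to a constant (\<open>moment_bound\<close>). The condition
  \<open>N \<ge> p\<^bsup>1/8 + \<epsilon>\<^esup>\<close> says that \<open>N\<^sup>4\<close> exceeds \<open>\<surd>p\<close> by a power of \<open>p\<close>, and the outcome is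
  \<open>T \<le> C N\<^sup>4 p\<^bsup>-\<delta>\<^esup>\<close> with some \<open>\<delta> > 0\<close> (\<open>power_saving\<close>), which is stronger than the stated bound.

  The moment bound needs Weil's estimate \<open>\<bar>\<Sum>\<^sub>x \<chi>(f(x))\<bar> \<le> m \<surd>p\<close> for products \<open>f\<close> of linear
  factors with \<open>m\<close> distinct roots, one of them simple, uniformly in the order of \<open>\<chi>\<close>; it is proved
  here. The sum is the coefficient of \<open>z\<close> in the L-function, the generating
  function of the values \<open>\<chi>(\<Prod> g(a)\<^bsup>e(a)\<^esup>)\<close> over monic polynomials \<open>g\<close> with coefficients in the field
  of \<open>p\<close> elements. The L-function is a polynomial (\<open>L_coeff_vanish\<close>), and its
  logarithmic derivative generates the analogous sums \<open>S\<^sub>n\<close> over the fields of \<open>p\<^sup>n\<close> elements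
  (\<open>newton\<close>). Stepanov's auxiliary polynomials (\<open>stepanov\<close>) show that \<open>\<bar>S\<^sub>n\<bar> \<le> C p\<^bsup>n/2\<^esup>\<close>. The constant
  \<open>C\<close> depends badly on \<open>p\<close>, but not on \<open>n\<close>, and this suffices: letting \<open>n\<close> grow, the power series of the
  \<open>S\<^sub>n\<close> converges for \<open>\<bar>z\<bar> < p\<^bsup>-1/2\<^esup>\<close>, so that the L-function has no zeros there, and its coefficient
  of \<open>z\<close> is at most its degree times \<open>\<surd>p\<close> (\<open>power_sum_bound\<close>).
\<close>

hide_const (open) Divisibility.prime

section \<open>Linear algebra, roots of polynomials, and finite fields inside an algebraic closure\<close>

lemma nontrivial_solution:
  fixes m :: "'j \<Rightarrow> 'i \<Rightarrow> 'f::field"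
  assumes "finite J" "finite I" "card J < card I"
  shows "\<exists>c. (\<exists>i\<in>I. c i \<noteq> 0) \<and> (\<forall>j\<in>J. (\<Sum>i\<in>I. m j i * c i) = 0)"
  using assms
proof (induction J arbitrary: I m rule: finite_induct)
  case empty
  then obtain i where "i \<in> I" by (metis card.empty ex_in_conv less_irrefl)
  then show ?case by (intro exI[of _ "\<lambda>_. 1"]) auto
next
  case (insert j J)
  show ?case
  proof (cases "\<forall>i\<in>I. m j i = 0")
    case True
    from insert.IH[of I m] insert.prems insert.hyps obtain c where
      c: "\<exists>i\<in>I. c i \<noteq> 0" "\<forall>j\<in>J. (\<Sum>i\<in>I. m j i * c i) = 0" by auto
    then show ?thesis using True by (intro exI[of _ c]) auto
  next
    case False
    then obtain i0 where i0: "i0 \<in> I" "m j i0 \<noteq> 0" by blast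
    define I' where "I' = I - {i0}"
    have I': "finite I'" "i0 \<notin> I'" "I = insert i0 I'" using i0 insert.prems by (auto simp: I'_def)
    then have "card J < card I'" using insert.prems insert.hyps by auto
    with insert.IH[of I' "\<lambda>j' i. m j' i - m j' i0 * m j i / m j i0"] I' obtain c where
      c: "\<exists>i\<in>I'. c i \<noteq> 0"
         "\<forall>j'\<in>J. (\<Sum>i\<in>I'. (m j' i - m j' i0 * m j i / m j i0) * c i) = 0" by blast
    define s where "s = - (\<Sum>i\<in>I'. m j i * c i) / m j i0"
    define c' where "c' = c(i0 := s)"
    have eq: "(\<Sum>i\<in>I. m j' i * c' i) = m j' i0 * s + (\<Sum>i\<in>I'. m j' i * c i)" for j'
    proof -
      have "(\<Sum>i\<in>I'. m j' i * c' i) = (\<Sum>i\<in>I'. m j' i * c i)"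
        using I' by (intro sum.cong) (auto simp: c'_def)
      then show ?thesis using I' by (simp add: c'_def)
    qed
    have "(\<Sum>i\<in>I. m j' i * c' i) = 0" if "j' \<in> J" for j'
    proof -
      have "0 = (\<Sum>i\<in>I'. m j' i * c i - m j' i0 / m j i0 * (m j i * c i))"
        using c(2) that by (simp add: algebra_simps)
      also have "\<dots> = (\<Sum>i\<in>I'. m j' i * c i) + m j' i0 * s"
        by (simp only: sum_subtractf s_def sum_distrib_left[symmetric]) simp
      finally show ?thesis by (simp add: eq add.commute)
    qed
    moreover have "(\<Sum>i\<in>I. m j i * c' i) = 0" using i0 by (simp add: eq s_def)
    moreover have "\<exists>i\<in>I. c' i \<noteq> 0" using c(1) I' by (auto simp: c'_def)
    ultimately show ?thesis by blast
  qed
qed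

lemma proots_prod_linear:
  "proots (\<Prod>x\<in>#A. [:- x, 1:]) = (A :: 'a::idom multiset)"
proof (induction A)
  case (add x A)
  have "(\<Prod>x\<in>#A. [:- x, 1:]) \<noteq> 0" by auto
  then have "proots ([:-x, 1:] * (\<Prod>x\<in>#A. [:- x, 1:])) = add_mset x A"
    using add by (subst proots_mult) auto
  then show ?case by simp
qed simp

lemma size_proots_alg_closed:
  "size (proots p) = degree (p :: 'a::alg_closed_field poly)"
proof (cases "p = 0")
  case False
  then obtain A where A: "size A = degree p" "p = smult (lead_coeff p) (\<Prod>x\<in>#A. [:-x, 1:])"
    using alg_closed_imp_factorization by blast
  have "proots p = A" using A(2) False proots_prod_linear
    by (metis leading_coeff_0_iff proots_smult)
  then show ?thesis using A by simp
qed simp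

lemma dvd_if_order_le:
  fixes p g :: "'a::alg_closed_field poly"
  assumes "p \<noteq> 0" "g \<noteq> 0" "\<And>x. order x p \<le> order x g"
  shows "p dvd g"
proof -
  have fac: "\<exists>c. c \<noteq> 0 \<and> f = smult c (\<Prod>x\<in>#proots f. [:-x, 1:])"
    if "f \<noteq> 0" for f :: "'a poly"
    using alg_closed_imp_factorization[OF that] proots_prod_linear that
    by (metis leading_coeff_0_iff proots_smult)
  have "proots p \<subseteq># proots g" using assms by (simp add: subseteq_mset_def)
  then have "(\<Prod>x\<in>#proots p. [:-x, 1:]) dvd (\<Prod>x\<in>#proots g. [:-x, 1:])"
    by (intro prod_mset_subset_imp_dvd image_mset_subseteq_mono)
  moreover obtain c d where "c \<noteq> 0" "p = smult c (\<Prod>x\<in>#proots p. [:-x, 1:])"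
    "d \<noteq> 0" "g = smult d (\<Prod>x\<in>#proots g. [:-x, 1:])" using fac assms by meson
  ultimately show ?thesis by (metis dvd_smult smult_dvd)
qed

text \<open>
  In an algebraically closed field of prime characteristic \<open>q\<close> the fixed points of the \<open>n\<close>-th power
  of Frobenius form the field of \<open>q\<^sup>n\<close> elements. Taking this as the definition puts all finite fields
  of characteristic \<open>q\<close> into one type, with the inclusions between them being subset relations.
\<close>

definition GF :: "nat \<Rightarrow> 'a::field set" where
  "GF n = {x. x ^ (CHAR('a) ^ n) = x}"

locale prime_char_closed =
  fixes K :: "'a::alg_closed_field itself" and q :: nat
  assumes prime_q: "prime q" and CHAR_eq_q: "CHAR('a) = q"
begin

lemma prime_CHAR: "prime CHAR('a)" using prime_q CHAR_eq_q by simp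

lemma q_gt_1: "q > 1" using prime_q prime_gt_1_nat by blast
lemma q_pos: "q > 0" using q_gt_1 by simp
lemma prime_CHAR_poly: "prime CHAR('a poly)" using prime_CHAR by simp

lemma GF_iff: "x \<in> GF n \<longleftrightarrow> x ^ (q ^ n) = (x::'a)" by (simp add: GF_def CHAR_eq_q)

lemma frob_add: "(x + y :: 'a) ^ (q ^ n) = x ^ (q ^ n) + y ^ (q ^ n)"
  using freshmans_dream'[OF prime_CHAR refl, of x y n] by (simp add: CHAR_eq_q)

lemma frob_minus: "(- x :: 'a) ^ (q ^ n) = - (x ^ (q ^ n))"
  using frob_add[of x "-x" n] q_pos by (simp add: eq_neg_iff_add_eq_0 add.commute power_0_left)

lemma frob_diff: "(x - y :: 'a) ^ (q ^ n) = x ^ (q ^ n) - y ^ (q ^ n)"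
  using frob_add[of x "-y" n] by (simp add: frob_minus)

lemma frob_add_poly: "(x + y :: 'a poly) ^ (q ^ n) = x ^ (q ^ n) + y ^ (q ^ n)"
  using freshmans_dream'[OF prime_CHAR_poly refl, of x y n] by (simp add: CHAR_eq_q)

lemma frob_minus_poly: "(- x :: 'a poly) ^ (q ^ n) = - (x ^ (q ^ n))"
  using frob_add_poly[of x "-x" n] q_pos by (simp add: eq_neg_iff_add_eq_0 add.commute power_0_left)

lemma frob_diff_poly: "(x - y :: 'a poly) ^ (q ^ n) = x ^ (q ^ n) - y ^ (q ^ n)"
  using frob_add_poly[of x "-y" n] by (simp add: frob_minus_poly)

lemma frob_inj: "(x::'a) ^ (q ^ n) = y ^ (q ^ n) \<Longrightarrow> x = y"
  using frob_diff[of x y n] q_pos by simp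

lemma GF_0 [simp]: "(0::'a) \<in> GF n" using q_pos by (simp add: GF_iff)
lemma GF_1 [simp]: "(1::'a) \<in> GF n" by (simp add: GF_iff)
lemma GF_add: "x \<in> GF n \<Longrightarrow> y \<in> GF n \<Longrightarrow> (x + y :: 'a) \<in> GF n" by (simp add: GF_iff frob_add)
lemma GF_diff: "x \<in> GF n \<Longrightarrow> y \<in> GF n \<Longrightarrow> (x - y :: 'a) \<in> GF n" by (simp add: GF_iff frob_diff)
lemma GF_mult: "x \<in> GF n \<Longrightarrow> y \<in> GF n \<Longrightarrow> (x * y :: 'a) \<in> GF n" by (simp add: GF_iff power_mult_distrib)
lemma GF_divide: "x \<in> GF n \<Longrightarrow> y \<in> GF n \<Longrightarrow> (x / y :: 'a) \<in> GF n" by (simp add: GF_iff power_divide)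
lemma GF_power: "x \<in> GF n \<Longrightarrow> (x ^ k :: 'a) \<in> GF n"
  by (metis GF_iff mult.commute power_mult)
lemma GF_prod: "(\<And>i. i \<in> I \<Longrightarrow> f i \<in> GF n) \<Longrightarrow> (\<Prod>i\<in>I. f i :: 'a) \<in> GF n"
  by (induction I rule: infinite_finite_induct) (auto intro: GF_mult)

lemma GF_frob_iterate: "x \<in> GF n \<Longrightarrow> (x::'a) ^ (q ^ (n * k)) = x"
proof (induction k)
  case (Suc k)
  have "x ^ (q ^ (n * Suc k)) = (x ^ (q ^ n)) ^ (q ^ (n * k))"
    by (simp add: power_add power_mult)
  then show ?case using Suc by (simp add: GF_iff)
qed simp

lemma GF_1_subset: "GF 1 \<subseteq> (GF n :: 'a set)"
  using GF_frob_iterate[of _ 1 n] by (auto simp: GF_iff)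

text \<open>
  At a fixed point \<open>x\<close> the polynomial \<open>P = Y\<^sup>Q - Y\<close> equals \<open>(Y - x)\<^sup>Q - (Y - x)\<close> by the
  additivity of Frobenius, so \<open>x\<close> is a simple root; as the field is algebraically closed, \<open>P\<close> has
  \<open>Q\<close> roots.
\<close>

lemma card_GF:
  assumes "n \<ge> 1"
  shows "card (GF n :: 'a set) = q ^ n" and "finite (GF n :: 'a set)"
proof -
  define Q where "Q = q ^ n"
  have Q: "Q > 1" using one_less_power[OF q_gt_1, of n] assms by (simp add: Q_def)
  define P :: "'a poly" where "P = monom 1 Q - [:0, 1:]"
  have deg: "degree P = Q" unfolding P_def diff_conv_add_uminus using Q
    by (subst degree_add_eq_left) (auto simp: degree_monom_eq)
  then have P0: "P \<noteq> 0" using Q by auto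
  have roots: "{x. poly P x = 0} = GF n" by (auto simp: P_def GF_iff poly_monom Q_def)
  have ord: "order x P = 1" if "x \<in> GF n" for x
  proof -
    have x: "x ^ Q = x" using that by (simp add: GF_iff Q_def)
    have "P = [:- x, 1:] ^ Q - [:-x, 1:]"
    proof -
      have "[:-x, 1:] = monom 1 1 - [:x:]" by (simp add: monom_altdef)
      then have "[:-x, 1:] ^ Q = monom 1 1 ^ Q - [:x:] ^ Q" using frob_diff_poly[of "monom 1 1" "[:x:]" n] by (simp add: Q_def)
      also have "\<dots> = monom 1 Q - [:x:]" using x by (simp add: monom_power poly_const_pow)
      finally show ?thesis by (simp add: P_def)
    qed
    also have "\<dots> = [:-x, 1:] * ([:-x, 1:] ^ (Q - 1) - 1)"
      using Q by (simp add: algebra_simps flip: power_Suc)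
    finally have eq: "P = [:-x, 1:] * ([:-x, 1:] ^ (Q - 1) - 1)" .
    have "poly ([:-x, 1:] ^ (Q - 1) - 1) x \<noteq> 0" using Q by (simp add: poly_power power_0_left)
    then have "order x ([:-x, 1:] ^ (Q - 1) - 1) = 0" by (rule order_0I)
    moreover have "order x [:-x, 1:] = 1" using order_power_n_n[of x 1] by simp
    ultimately show ?thesis using P0 eq by (metis order_mult add.right_neutral)
  qed
  show fin: "finite (GF n :: 'a set)" using P0 poly_roots_finite roots by fastforce
  have "Q = size (proots P)" by (simp add: deg size_proots_alg_closed)
  also have "\<dots> = (\<Sum>x\<in>GF n. order x P)"
    using P0 roots by (simp add: size_multiset_overloaded_eq)
  also have "\<dots> = card (GF n :: 'a set)" using ord by simp
  finally show "card (GF n :: 'a set) = q ^ n" by (simp add: Q_def)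
qed

lemma GF_1_eq: "(GF 1 :: 'a set) = of_nat ` {..<q}"
proof (rule card_subset_eq[symmetric])
  have "(of_nat k :: 'a) \<in> GF 1" for k by (induction k) (auto intro: GF_add)
  then show "of_nat ` {..<q} \<subseteq> (GF 1 :: 'a set)" by auto
  have "inj_on (of_nat :: nat \<Rightarrow> 'a) {..<q}"
    by (intro inj_onI) (auto simp: of_nat_eq_iff_cong_CHAR CHAR_eq_q cong_less_modulus_unique_nat)
  then show "card (of_nat ` {..<q} :: 'a set) = card (GF 1 :: 'a set)"
    using card_GF(1)[of 1] by (simp add: card_image)
qed (use card_GF in simp)

end

section \<open>Auxiliary polynomials of Stepanov type\<close>

lemma pcompose_power: "pcompose (p ^ n) r = pcompose (p :: 'a::comm_ring_1 poly) r ^ n"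
  by (induction n) (simp_all only: power_0 power_Suc pcompose_1 pcompose_mult)

text \<open>
  The coefficient of \<open>z\<^sup>l\<close> in \<open>p(\<alpha> + z)\<close>, as a function of \<open>\<alpha>\<close>, is the \<open>l\<close>-th Hasse derivative of
  \<open>p\<close>. Hasse derivatives detect the multiplicity of a root in every characteristic, unlike iterated
  derivatives, which vanish identically from order \<open>q\<close> on.
\<close>

lemma coeff_shift_poly:
  fixes p :: "'a::comm_ring_1 poly"
  shows "\<exists>P. degree P \<le> degree p \<and> (\<forall>\<alpha>. coeff (pcompose p [:\<alpha>, 1:]) l = poly P \<alpha>)"
proof (induction p arbitrary: l)
  case 0
  then show ?case by (intro exI[of _ 0]) auto
next
  case (pCons a p)
  show ?case
  proof (cases "p = 0")
    case True
    then show ?thesis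
      by (intro exI[of _ "[:if l = 0 then a else 0:]"]) (auto simp: coeff_pCons split: nat.splits)
  next
    case False
    obtain P where P: "degree P \<le> degree p" "\<And>\<alpha>. coeff (pcompose p [:\<alpha>, 1:]) l = poly P \<alpha>"
      using pCons.IH[of l] by auto
    obtain P' where P': "degree P' \<le> degree p" "\<And>\<alpha>. coeff (pcompose p [:\<alpha>, 1:]) (l - 1) = poly P' \<alpha>"
      using pCons.IH[of "l - 1"] by auto
    define R where "R = (if l = 0 then [:a:] else 0) + pCons 0 P + (if l = 0 then 0 else P')"
    have "degree R \<le> degree (pCons a p)"
      using P P' False unfolding R_def by (auto intro!: degree_add_le degree_pCons_le[THEN order_trans])
    moreover have "coeff (pcompose (pCons a p) [:\<alpha>, 1:]) l = poly R \<alpha>" for \<alpha>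
      by (cases l) (auto simp: pcompose_pCons R_def P(2)[symmetric] P'(2)[symmetric] coeff_pCons)
    ultimately show ?thesis by blast
  qed
qed

text \<open>
  Among the \<open>n\<close> factors \<open>f(\<alpha> + z)\<close>, at most \<open>l\<close> contribute a positive power of \<open>z\<close> to the term
  \<open>z\<^sup>l\<close>, and each of the others contributes \<open>f(\<alpha>)\<close>. The degree of the remaining polynomial factor
  does not grow with \<open>n\<close>; this is what makes high powers of \<open>f\<close> cheap in Stepanov's method.
\<close>

lemma coeff_shift_mult_power:
  fixes f r :: "'a::comm_ring_1 poly"
  shows "\<exists>P. degree P \<le> degree r + l * degree f \<and>
    (\<forall>\<alpha>. poly f \<alpha> ^ l * coeff (pcompose (r * f ^ n) [:\<alpha>, 1:]) l = poly f \<alpha> ^ n * poly P \<alpha>)"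
proof (induction n arbitrary: l)
  case 0
  obtain H where H: "degree H \<le> degree r" "\<And>\<alpha>. coeff (pcompose r [:\<alpha>, 1:]) l = poly H \<alpha>"
    using coeff_shift_poly by blast
  have "degree (H * f ^ l) \<le> degree r + l * degree f"
    using H(1) degree_power_le[of f l]
    by (intro order_trans[OF degree_mult_le] add_mono) (auto simp: mult.commute)
  then show ?case using H(2) by (intro exI[of _ "H * f ^ l"]) (auto simp: poly_power)
next
  case (Suc n)
  have "\<forall>l. \<exists>P. degree P \<le> degree r + l * degree f \<and>
    (\<forall>\<alpha>. poly f \<alpha> ^ l * coeff (pcompose (r * f ^ n) [:\<alpha>, 1:]) l = poly f \<alpha> ^ n * poly P \<alpha>)"
    using Suc.IH by blast
  then obtain P where P: "\<And>l. degree (P l) \<le> degree r + l * degree f"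
    "\<And>l \<alpha>. poly f \<alpha> ^ l * coeff (pcompose (r * f ^ n) [:\<alpha>, 1:]) l = poly f \<alpha> ^ n * poly (P l) \<alpha>"
    by metis
  have "\<forall>i. \<exists>P. degree P \<le> degree f \<and> (\<forall>\<alpha>. coeff (pcompose f [:\<alpha>, 1:]) i = poly P \<alpha>)"
    using coeff_shift_poly by blast
  then obtain H where H: "\<And>i. degree (H i) \<le> degree f"
    "\<And>i \<alpha>. coeff (pcompose f [:\<alpha>, 1:]) i = poly (H i) \<alpha>" by metis
  have H0: "poly (H 0) \<alpha> = poly f \<alpha>" for \<alpha>
    using H(2)[of \<alpha> 0] by (simp add: pcompose_coeff_0)
  define R where "R = P l + (\<Sum>i=1..l. H i * f ^ (i - 1) * P (l - i))"
  have "degree (H i * f ^ (i - 1) * P (l - i)) \<le> degree r + l * degree f" if "i \<in> {1..l}" for i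
  proof -
    have "degree (H i * f ^ (i - 1) * P (l - i)) \<le> degree f + (i - 1) * degree f + (degree r + (l - i) * degree f)"
      using H(1)[of i] P(1)[of "l - i"] degree_power_le[of f "i - 1"]
      by (intro order_trans[OF degree_mult_le] add_mono) (auto simp: mult.commute)
    also have "\<dots> = degree r + (1 + (i - 1) + (l - i)) * degree f" by (simp add: algebra_simps)
    also have "1 + (i - 1) + (l - i) = l" using that by auto
    finally show ?thesis .
  qed
  then have "degree R \<le> degree r + l * degree f"
    unfolding R_def using P(1) by (intro degree_add_le degree_sum_le) auto
  moreover have "poly f \<alpha> ^ l * coeff (pcompose (r * f ^ Suc n) [:\<alpha>, 1:]) l = poly f \<alpha> ^ Suc n * poly R \<alpha>" for \<alpha>
  proof -
    define F where "F = pcompose f [:\<alpha>, 1:]"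
    define G where "G = pcompose (r * f ^ n) [:\<alpha>, 1:]"
    define v where "v = poly f \<alpha>"
    have FG: "pcompose (r * f ^ Suc n) [:\<alpha>, 1:] = F * G"
      by (simp add: F_def G_def pcompose_mult mult_ac)
    have "v ^ l * coeff (F * G) l = (\<Sum>i\<le>l. v ^ l * (coeff F i * coeff G (l - i)))"
      by (simp add: coeff_mult sum_distrib_left)
    also have "\<dots> = (\<Sum>i\<le>l. poly (H i) \<alpha> * v ^ i * (v ^ n * poly (P (l - i)) \<alpha>))"
    proof (intro sum.cong refl)
      fix i assume i: "i \<in> {..l}"
      have "v ^ l * (coeff F i * coeff G (l - i))
        = coeff F i * v ^ i * (v ^ (l - i) * coeff G (l - i))"
        using i power_add[of v i "l - i"] by (simp add: ac_simps)
      then show "v ^ l * (coeff F i * coeff G (l - i)) = poly (H i) \<alpha> * v ^ i * (v ^ n * poly (P (l - i)) \<alpha>)"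
        using H(2)[of \<alpha> i] P(2)[of \<alpha> "l - i"] by (simp add: F_def G_def v_def)
    qed
    also have "{..l} = insert 0 {1..l}" by auto
    also have "(\<Sum>i\<in>insert 0 {1..l}. poly (H i) \<alpha> * v ^ i * (v ^ n * poly (P (l - i)) \<alpha>))
      = v * (v ^ n * poly (P l) \<alpha>) + (\<Sum>i=1..l. poly (H i) \<alpha> * v ^ i * (v ^ n * poly (P (l - i)) \<alpha>))"
      by (simp add: H0 v_def)
    also have "(\<Sum>i=1..l. poly (H i) \<alpha> * v ^ i * (v ^ n * poly (P (l - i)) \<alpha>))
      = (\<Sum>i=1..l. v ^ Suc n * (poly (H i) \<alpha> * v ^ (i - 1) * poly (P (l - i)) \<alpha>))"
    proof (intro sum.cong refl)
      fix i assume "i \<in> {1..l}"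
      then obtain i' where "i = Suc i'" by (cases i) auto
      then show "poly (H i) \<alpha> * v ^ i * (v ^ n * poly (P (l - i)) \<alpha>)
        = v ^ Suc n * (poly (H i) \<alpha> * v ^ (i - 1) * poly (P (l - i)) \<alpha>)" by (simp add: algebra_simps)
    qed
    also have "v * (v ^ n * poly (P l) \<alpha>) + \<dots> = v ^ Suc n * poly R \<alpha>"
      by (simp add: R_def poly_sum v_def poly_power sum_distrib_left algebra_simps)
    finally show ?thesis by (simp only: FG v_def)
  qed
  ultimately show ?case by blast
qed

text \<open>
  This serves for \<open>(\<alpha> - a + z)\<^bsup>kQ\<^esup> = ((\<alpha> - a)\<^sup>Q + z\<^sup>Q)\<^sup>k\<close>, a factor that is
  constant modulo \<open>z\<^sup>Q\<close>.
\<close>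

lemma coeff_mult_binomial_low:
  fixes W :: "'a::comm_ring_1 poly"
  assumes "l < Q"
  shows "coeff (W * ([:b:] + monom 1 Q) ^ k) l = b ^ k * coeff W l"
proof (induction k)
  case (Suc k)
  have "W * ([:b:] + monom 1 Q) ^ Suc k
    = smult b (W * ([:b:] + monom 1 Q) ^ k) + monom 1 Q * (W * ([:b:] + monom 1 Q) ^ k)"
    by (simp add: algebra_simps)
  then show ?case using Suc assms by (simp add: coeff_monom_mult)
qed simp

text \<open>
  Nothing cancels the term of least order.
\<close>

lemma sum_distinct_orders_nonzero:
  fixes u :: "'i \<Rightarrow> 'a::idom poly"
  assumes "finite I" "\<And>i. i \<in> I \<Longrightarrow> u i \<noteq> 0" "inj_on (\<lambda>i. order a (u i)) I" "\<exists>i\<in>I. c i \<noteq> 0"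
  shows "(\<Sum>i\<in>I. smult (c i) (u i)) \<noteq> 0"
proof
  assume zero: "(\<Sum>i\<in>I. smult (c i) (u i)) = 0"
  define I' where "I' = {i\<in>I. c i \<noteq> 0}"
  have I': "finite I'" "I' \<noteq> {}" using assms by (auto simp: I'_def)
  define i0 where "i0 = arg_min_on (\<lambda>i. order a (u i)) I'"
  have i0: "i0 \<in> I'" and min: "\<And>i. i \<in> I' \<Longrightarrow> order a (u i0) \<le> order a (u i)"
    unfolding i0_def using I' by (auto intro: arg_min_if_finite arg_min_least)
  define m where "m = order a (u i0)"
  have "[:-a, 1:] ^ Suc m dvd smult (c i) (u i)" if "i \<in> I - {i0}" for i
  proof (cases "c i = 0")
    case False
    then have "i \<in> I'" using that by (auto simp: I'_def)
    moreover have "order a (u i) \<noteq> m"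
      using inj_onD[OF assms(3), of i i0] that i0 by (auto simp: m_def I'_def)
    ultimately have "Suc m \<le> order a (u i)" using min[of i] by (simp add: m_def)
    then show ?thesis by (intro dvd_smult) (simp only: order_divides, simp)
  qed simp
  then have "[:-a, 1:] ^ Suc m dvd (\<Sum>i\<in>I - {i0}. smult (c i) (u i))" by (rule dvd_sum)
  moreover have "smult (c i0) (u i0) = - (\<Sum>i\<in>I - {i0}. smult (c i) (u i))"
    using zero i0 assms(1) by (subst (asm) sum.remove[of _ i0]) (auto simp: I'_def eq_neg_iff_add_eq_0)
  ultimately have "[:-a, 1:] ^ Suc m dvd smult (c i0) (u i0)" by simp
  moreover have nz: "c i0 \<noteq> 0" "u i0 \<noteq> 0" using i0 assms by (auto simp: I'_def)
  ultimately have "Suc m \<le> order a (smult (c i0) (u i0))" by (simp only: order_divides) auto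
  then show False using nz by (simp add: order_smult m_def)
qed

lemma power_dvd_if_shift_coeffs_0:
  fixes A :: "'a::idom poly"
  assumes "\<And>l. l < M \<Longrightarrow> coeff (pcompose A [:\<alpha>, 1:]) l = 0"
  shows "[:-\<alpha>, 1:] ^ M dvd A"
proof -
  have "monom 1 M dvd pcompose A [:\<alpha>, 1:]" using assms by (simp add: monom_1_dvd_iff')
  then obtain h where h: "pcompose A [:\<alpha>, 1:] = monom 1 M * h" by (elim dvdE)
  have "A = pcompose (pcompose A [:\<alpha>, 1:]) [:-\<alpha>, 1:]"
    by (simp add: pcompose_pCons flip: pcompose_assoc)
  also have "\<dots> = [:-\<alpha>, 1:] ^ M * pcompose h [:-\<alpha>, 1:]"
  proof -
    have "pcompose (monom 1 M) [:-\<alpha>, 1:] = [:-\<alpha>, 1:] ^ M"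
      by (induction M) (auto simp: monom_Suc pcompose_pCons monom_0)
    then show ?thesis by (simp only: h pcompose_mult)
  qed
  finally show ?thesis by (metis dvd_triv_left)
qed

context prime_char_closed begin

text \<open>
  A nonzero polynomial \<open>A\<close> is constructed that vanishes to order at least \<open>M\<close> at each point counted,
  and whose degree is small. It is a linear combination of the polynomials
  \<open>(Y - a)\<^sup>i f\<^bsup>gj\<^esup> (Y - a)\<^bsup>kQ\<^esup>\<close> with \<open>i < g\<close>, \<open>j < d\<close>, \<open>k < B\<close>. As \<open>a\<close> is a simple root of \<open>f\<close>, these have the
  distinct orders \<open>i + gj + kQ\<close> at \<open>a\<close>, so they are linearly independent. At a point \<open>\<alpha>\<close> with
  \<open>\<alpha>\<^sup>Q = \<alpha>\<close> and \<open>f(\<alpha>)\<^sup>g = \<zeta>\<close> the huge powers collapse: after multiplication by \<open>f(\<alpha>)\<^sup>l\<close>, the coefficient of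
  \<open>z\<^sup>l\<close> in \<open>A(\<alpha> + z)\<close> is the value at \<open>\<alpha>\<close> of a polynomial of degree less than \<open>g + M deg f + B\<close>. Requiring
  these \<open>M\<close> polynomials to vanish identically is a homogeneous linear system, and the last assumption says
  that it has fewer equations than unknowns.
\<close>

lemma stepanov:
  fixes f :: "'a poly" and a \<zeta> :: 'a
  assumes n: "n \<ge> 1" and dg: "q ^ n - 1 = d * g" and g: "g \<ge> 1"
    and f: "f \<noteq> 0" "order a f = 1" and a: "a \<in> GF n" and \<zeta>: "\<zeta> \<noteq> 0"
    and M: "M \<le> q ^ n" and MB: "M * (g + M * degree f + B) < d * B * g"
  shows "M * card {\<alpha>\<in>GF n. poly f \<alpha> ^ g = \<zeta>} \<le> q ^ n * (degree f + B)"
proof -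
  define Q where "Q = q ^ n"
  define D where "D = degree f"
  define S where "S = {\<alpha>\<in>GF n. poly f \<alpha> ^ g = \<zeta>}"
  define L where "L = g + M * D + B"
  define I where "I = {..<d} \<times> {..<B} \<times> {..<g}"
  define J where "J = {..<M} \<times> {..<L}"
  define u where "u = (\<lambda>(j, k, i). [:-a, 1:] ^ i * f ^ (g * j) * [:-a, 1:] ^ (k * Q))"
  have Q0: "Q > 0" using q_pos by (simp add: Q_def)
  have fS: "poly f \<alpha> \<noteq> 0" if "\<alpha> \<in> S" for \<alpha>
    using that g \<zeta> by (auto simp: S_def power_0_left)
  have ex: "\<exists>G. degree G < L \<and> (\<forall>\<alpha>\<in>S. poly f \<alpha> ^ l * coeff (pcompose (u x) [:\<alpha>, 1:]) l = poly G \<alpha>)"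
    if x: "x \<in> I" and l: "l < M" for x l
  proof -
    obtain j k i where xeq: "x = (j, k, i)" by (cases x)
    have bd: "j < d" "k < B" "i < g" using x by (auto simp: I_def xeq)
    obtain P where P: "degree P \<le> degree ([:-a, 1:] ^ i) + l * degree f"
      "\<And>\<alpha>. poly f \<alpha> ^ l * coeff (pcompose ([:-a, 1:] ^ i * f ^ (g * j)) [:\<alpha>, 1:]) l = poly f \<alpha> ^ (g * j) * poly P \<alpha>"
      using coeff_shift_mult_power by blast
    define G where "G = smult (\<zeta> ^ j) (P * [:-a, 1:] ^ k)"
    have "degree G \<le> degree (P * [:-a, 1:] ^ k)" unfolding G_def by (rule degree_smult_le)
    also have "\<dots> \<le> (i + l * degree f) + k"
      using P(1) by (intro order_trans[OF degree_mult_le] add_mono) (auto simp: degree_linear_power)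
    also have "\<dots> < L" 
    proof -
      have "l * degree f \<le> M * D" using l by (simp add: D_def)
      then show ?thesis using bd by (simp add: L_def)
    qed
    finally have "degree G < L" .
    moreover have "poly f \<alpha> ^ l * coeff (pcompose (u x) [:\<alpha>, 1:]) l = poly G \<alpha>" if \<alpha>: "\<alpha> \<in> S" for \<alpha>
    proof -
      define W where "W = pcompose ([:-a, 1:] ^ i * f ^ (g * j)) [:\<alpha>, 1:]"
      have "pcompose ([:-a, 1:] ^ (k * Q)) [:\<alpha>, 1:] = (pcompose [:-a, 1:] [:\<alpha>, 1:]) ^ (k * Q)"
        by (rule pcompose_power)
      also have "pcompose [:-a, 1:] [:\<alpha>, 1:] = [:\<alpha> - a:] + monom 1 1"
        by (simp add: pcompose_pCons monom_altdef)
      also have "(\<dots>) ^ (k * Q) = ((\<dots>) ^ Q) ^ k" by (simp add: power_mult mult.commute)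
      also have "([:\<alpha> - a:] + monom 1 1) ^ Q = [:\<alpha> - a:] + monom 1 Q"
      proof -
        have "\<alpha> - a \<in> GF n" using \<alpha> a by (intro GF_diff) (auto simp: S_def)
        then show ?thesis
          using frob_add_poly[of "[:\<alpha> - a:]" "monom 1 1" n]
          by (simp add: Q_def monom_power poly_const_pow GF_iff)
      qed
      finally have "pcompose (u x) [:\<alpha>, 1:] = W * ([:\<alpha> - a:] + monom 1 Q) ^ k"
        by (simp add: u_def xeq W_def pcompose_mult)
      then have "coeff (pcompose (u x) [:\<alpha>, 1:]) l = (\<alpha> - a) ^ k * coeff W l"
        using l M coeff_mult_binomial_low[of l Q] by (simp add: Q_def)
      then have "poly f \<alpha> ^ l * coeff (pcompose (u x) [:\<alpha>, 1:]) l = (\<alpha> - a) ^ k * (poly f \<alpha> ^ (g * j) * poly P \<alpha>)"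
        using P(2)[of \<alpha>] by (simp add: W_def algebra_simps)
      also have "poly f \<alpha> ^ (g * j) = \<zeta> ^ j" using \<alpha> by (simp add: S_def power_mult)
      finally show ?thesis by (simp add: G_def poly_power algebra_simps)
    qed
    ultimately show ?thesis by blast
  qed
  then have "\<forall>l x. \<exists>G. x \<in> I \<and> l < M \<longrightarrow> degree G < L \<and>
      (\<forall>\<alpha>\<in>S. poly f \<alpha> ^ l * coeff (pcompose (u x) [:\<alpha>, 1:]) l = poly G \<alpha>)" by blast
  then obtain G where G: "\<And>l x. x \<in> I \<Longrightarrow> l < M \<Longrightarrow> degree (G l x) < L"
    "\<And>l x \<alpha>. x \<in> I \<Longrightarrow> l < M \<Longrightarrow> \<alpha> \<in> S \<Longrightarrow>
       poly f \<alpha> ^ l * coeff (pcompose (u x) [:\<alpha>, 1:]) l = poly (G l x) \<alpha>" by metis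
  \<comment> \<open>\<open>I\<close> indexes the unknown coefficients of \<open>A\<close>, and \<open>J\<close> the linear equations that they must satisfy.\<close>
  have "card J < card I" using MB by (simp add: I_def J_def L_def D_def mult.assoc)
  then obtain c where c: "\<exists>x\<in>I. c x \<noteq> 0"
    "\<And>l s. l < M \<Longrightarrow> s < L \<Longrightarrow> (\<Sum>x\<in>I. coeff (G l x) s * c x) = 0"
    using nontrivial_solution[of J I "\<lambda>(l, s) x. coeff (G l x) s"] by (auto simp: I_def J_def)
  define A where "A = (\<Sum>x\<in>I. smult (c x) (u x))"
  have u0: "u x \<noteq> 0" for x using f by (auto simp: u_def split: prod.splits)
  have ordu: "order a (u (j, k, i)) = i + g * j + k * Q" for i j k
  proof -
    have pow: "order a (f ^ m) = m" for m
      using f by (induction m) (auto simp: order_mult)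
    show ?thesis using f by (simp add: u_def order_mult pow order_power_n_n)
  qed
  have A0: "A \<noteq> 0" unfolding A_def
  proof (rule sum_distinct_orders_nonzero[where a = a])
    show "inj_on (\<lambda>x. order a (u x)) I"
    proof (rule inj_onI, clarsimp simp: I_def ordu)
      fix j k i j' k' i'
      assume b: "j < d" "k < B" "i < g" "j' < d" "k' < B" "i' < g"
        and eq: "i + g * j + k * Q = i' + g * j' + k' * Q"
      have small: "i + g * j < Q" if "i < g" "j < d" for i j
      proof -
        have "g * Suc j \<le> g * d" using that by (intro mult_le_mono) auto
        then show ?thesis using that dg Q0 by (simp add: Q_def mult.commute)
      qed
      \<comment> \<open>The order \<open>i + gj + kQ\<close> is a number written in mixed radix with digits \<open>i < g\<close>, \<open>j < d\<close> and \<open>k\<close>.\<close>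
      have "k = k'" using arg_cong[OF eq, of "\<lambda>t. t div Q"] small b Q0 by simp
      moreover from this have e2: "i + g * j = i' + g * j'" using eq by simp
      have "j = j'" using arg_cong[OF e2, of "\<lambda>t. t div g"] b by simp
      ultimately show "j = j' \<and> k = k' \<and> i = i'" using e2 by simp
    qed
  qed (use u0 c in \<open>auto simp: I_def\<close>)
  have "degree A \<le> Q * (D + B)" unfolding A_def
  proof (intro degree_sum_le)
    fix x assume x: "x \<in> I"
    obtain j k i where xeq: "x = (j, k, i)" by (cases x)
    have bd: "j < d" "k < B" "i < g" using x by (auto simp: I_def xeq)
    have "degree (smult (c x) (u x)) \<le> degree (u x)" by (rule degree_smult_le)
    also have "\<dots> = i + g * j * D + k * Q"
      using f by (simp add: u_def xeq degree_mult_eq degree_power_eq degree_linear_power D_def)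
    also have "\<dots> \<le> Q + Q * D + (B - 1) * Q"
    proof (intro add_mono mult_le_mono)
      have "g * j \<le> g * d" using bd by (intro mult_le_mono) auto
      also have "\<dots> \<le> Q" using dg by (simp add: Q_def mult.commute[of g] flip: dg)
      finally show "g * j \<le> Q" .
      have "g * 1 \<le> g * d" using bd by (intro mult_le_mono) auto
      also have "\<dots> \<le> Q" using dg by (simp add: Q_def mult.commute[of g] flip: dg)
      finally show "i \<le> Q" using bd by simp
    qed (use bd in auto)
    also have "\<dots> = Q * (D + (1 + (B - 1)))" by (simp add: algebra_simps)
    also have "1 + (B - 1) = B" using bd by simp
    finally show "degree (smult (c x) (u x)) \<le> Q * (D + B)" .
  qed (auto simp: I_def)
  have ordM: "M \<le> order \<alpha> A" if \<alpha>: "\<alpha> \<in> S" for \<alpha>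
  proof -
    have "coeff (pcompose A [:\<alpha>, 1:]) l = 0" if l: "l < M" for l
    proof -
      have "poly f \<alpha> ^ l * coeff (pcompose A [:\<alpha>, 1:]) l
        = (\<Sum>x\<in>I. c x * (poly f \<alpha> ^ l * coeff (pcompose (u x) [:\<alpha>, 1:]) l))"
        by (simp add: A_def pcompose_sum pcompose_smult coeff_sum sum_distrib_left algebra_simps)
      also have "\<dots> = poly (\<Sum>x\<in>I. smult (c x) (G l x)) \<alpha>"
        using G(2)[OF _ l \<alpha>] by (simp add: poly_sum)
      also have "(\<Sum>x\<in>I. smult (c x) (G l x)) = 0"
      proof (rule poly_eqI)
        fix s
        show "coeff (\<Sum>x\<in>I. smult (c x) (G l x)) s = coeff 0 s"
        proof (cases "s < L")
          case True
          then show ?thesis using c(2)[OF l True] by (simp add: coeff_sum mult.commute)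
        next
          case False
          then have "coeff (G l x) s = 0" if "x \<in> I" for x
            using G(1)[OF that l] by (intro coeff_eq_0) simp
          then show ?thesis by (simp add: coeff_sum)
        qed
      qed
      finally show ?thesis using fS[OF \<alpha>] by simp
    qed
    then have "[:-\<alpha>, 1:] ^ M dvd A" by (rule power_dvd_if_shift_coeffs_0)
    then show ?thesis using A0 by (simp only: order_divides) simp
  qed
  have finS: "finite S" using card_GF[OF n] by (simp add: S_def)
  have "M * card S = (\<Sum>\<alpha>\<in>S. M)" by simp
  also have "\<dots> \<le> (\<Sum>\<alpha>\<in>S. order \<alpha> A)" by (intro sum_mono ordM)
  also have "\<dots> = (\<Sum>\<alpha>\<in>{\<alpha>\<in>S. poly A \<alpha> = 0}. order \<alpha> A)"
    using finS by (intro sum.mono_neutral_right) (auto simp: order_0I)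
  also have "\<dots> \<le> (\<Sum>\<alpha>\<in>{\<alpha>. poly A \<alpha> = 0}. order \<alpha> A)"
    using A0 by (intro sum_mono2 poly_roots_finite) auto
  also have "\<dots> \<le> degree A" using A0 by (rule sum_order_le_degree)
  also have "\<dots> \<le> Q * (D + B)" by fact
  finally show ?thesis by (simp add: S_def Q_def D_def)
qed

end

section \<open>Square-root cancellation over large extension fields\<close>

text \<open>
  A nontrivial multiplicative function \<open>\<psi>\<close> on the prime field, and the points \<open>a \<in> A\<close> of the prime field
  with exponents \<open>e a\<close>. The point \<open>a0\<close> of exponent one is a simple root of the polynomial \<open>\<Prod> (a - Y)\<^bsup>e a\<^esup>\<close>, which
  is therefore not a proper power.
\<close>

locale kummer_sum = prime_char_closed K q for K :: "'a::alg_closed_field itself" and q :: nat +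
  fixes \<psi> :: "'a \<Rightarrow> complex" and A :: "'a set" and e :: "'a \<Rightarrow> nat" and a0 :: 'a
  assumes psi_mult: "x \<in> GF 1 \<Longrightarrow> y \<in> GF 1 \<Longrightarrow> \<psi> (x * y) = \<psi> x * \<psi> y"
    and psi_0: "\<psi> 0 = 0" and psi_1: "\<psi> 1 = 1"
    and psi_nontriv: "\<exists>x\<in>GF 1. x \<noteq> 0 \<and> \<psi> x \<noteq> 1"
    and finite_A: "finite A" and A_sub: "A \<subseteq> GF 1" and a0: "a0 \<in> A" and e_a0: "e a0 = 1"
    and e_pos: "a \<in> A \<Longrightarrow> e a \<ge> 1"
begin

definition F :: "'a \<Rightarrow> 'a" where "F x = (\<Prod>a\<in>A. (a - x) ^ e a)"

definition Fpoly :: "'a poly" where "Fpoly = (\<Prod>a\<in>A. [:a, -1:] ^ e a)"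

text \<open>
  The norm from the field of \<open>q\<^sup>n\<close> elements to the prime field is \<open>y \<mapsto> y\<^bsup>1 + q + \<dots> + q^(n-1)\<^esup>\<close>.
\<close>

definition norm_exp :: "nat \<Rightarrow> nat" where "norm_exp n = (\<Sum>j<n. q ^ j)"

text \<open>
  The sums \<open>S\<^sub>n\<close> of the introduction: \<open>\<psi>\<close> is extended to the field of \<open>q\<^sup>n\<close> elements by composing it with
  the norm.
\<close>

definition char_sum :: "nat \<Rightarrow> complex" where "char_sum n = (\<Sum>\<alpha>\<in>GF n. \<psi> (F \<alpha> ^ norm_exp n))"

lemma norm_exp: "(q - 1) * norm_exp n = q ^ n - 1"
proof -
  have "(q - 1) * norm_exp n + 1 = q ^ n"
  proof (induction n)
    case (Suc n)
    have "(q - 1) * norm_exp (Suc n) + 1 = (q - 1) * norm_exp n + 1 + (q - 1) * q ^ n"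
      by (simp add: norm_exp_def distrib_left)
    also have "\<dots> = (1 + (q - 1)) * q ^ n" by (simp only: Suc distrib_right mult_1)
    finally show ?case using q_pos by simp
  qed (simp add: norm_exp_def)
  then show ?thesis by simp
qed

lemma poly_Fpoly: "poly Fpoly x = F x"
  by (simp add: Fpoly_def F_def poly_prod poly_power)

lemma Fpoly_nz: "Fpoly \<noteq> 0" using finite_A by (simp add: Fpoly_def)

lemma F_eq_0_iff: "F x = 0 \<longleftrightarrow> x \<in> A"
  using finite_A e_pos by (fastforce simp: F_def)

lemma order_Fpoly: "order a0 Fpoly = 1"
proof -
  define R where "R = (\<Prod>a\<in>A-{a0}. [:a, -1:] ^ e a)"
  have eq: "Fpoly = [:a0, -1:] * R"
    unfolding Fpoly_def R_def using finite_A a0 by (subst prod.remove[of _ a0]) (auto simp: e_a0)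
  have "poly R a0 \<noteq> 0" using finite_A by (auto simp: R_def poly_prod poly_power)
  then have "order a0 R = 0" by (rule order_0I)
  moreover have "order a0 [:a0, -1:] = 1"
  proof -
    have "[:a0, -1:] = - [:-a0, 1:]" by simp
    then show ?thesis using order_power_n_n[of a0 1] by (metis order_uminus power_one_right)
  qed
  ultimately show ?thesis using Fpoly_nz eq by (metis order_mult add.right_neutral)
qed

lemma GF_mono_A: "a \<in> A \<Longrightarrow> a \<in> GF n" using A_sub GF_1_subset by auto

lemma F_GF: "x \<in> GF n \<Longrightarrow> F x \<in> GF n"
  unfolding F_def using GF_mono_A by (auto intro!: GF_prod GF_power GF_diff)

lemma norm_GF: 
  assumes "y \<in> GF n" shows "y ^ norm_exp n \<in> (GF 1 :: 'a set)"
proof (cases "y = 0")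
  case True
  then show ?thesis by (cases "norm_exp n = 0") (auto simp: power_0_left)
next
  case False
  have "y ^ (q ^ n - 1) = 1"
    using assms False power_add[of y "q ^ n - 1" 1] q_pos by (simp add: GF_iff)
  then have "y ^ (norm_exp n * (q - 1)) = 1" using norm_exp[of n] by (simp add: mult.commute)
  moreover have "norm_exp n * q = norm_exp n * (q - 1) + norm_exp n" using q_pos by (cases q) auto
  ultimately show ?thesis by (simp add: GF_iff power_add flip: power_mult)
qed

lemma psi_power: "x \<in> GF 1 \<Longrightarrow> \<psi> (x ^ k) = \<psi> x ^ k"
  by (induction k) (auto simp: psi_1 psi_mult GF_power)

lemma psi_norm:
  assumes "x \<in> GF 1" "x \<noteq> 0" shows "cmod (\<psi> x) = 1"
proof -
  have "x ^ (q - 1) = 1"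
    using assms power_add[of x "q - 1" 1] q_pos by (simp add: GF_iff)
  then have "\<psi> x ^ (q - 1) = 1" using psi_power[OF assms(1)] psi_1 by metis
  then have "cmod (\<psi> x) ^ (q - 1) = 1" by (metis norm_one norm_power)
  then show ?thesis using q_gt_1 power_eq_iff_eq_base[of "q - 1" "cmod (\<psi> x)" 1] by simp
qed

lemma psi_le_1: "x \<in> GF 1 \<Longrightarrow> cmod (\<psi> x) \<le> 1"
  using psi_norm[of x] psi_0 by (cases "x = 0") auto

lemma sum_psi: "(\<Sum>x\<in>GF 1. \<psi> x) = 0"
proof -
  obtain x0 where x0: "x0 \<in> GF 1" "x0 \<noteq> 0" "\<psi> x0 \<noteq> 1" using psi_nontriv by blast
  have "(\<Sum>x\<in>GF 1. \<psi> x) = (\<Sum>x\<in>GF 1. \<psi> (x0 * x))"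
    by (rule sum.reindex_bij_witness[of _ "\<lambda>x. x0 * x" "\<lambda>x. x / x0"])
       (use x0 in \<open>auto intro: GF_mult GF_divide\<close>)
  also have "\<dots> = \<psi> x0 * (\<Sum>x\<in>GF 1. \<psi> x)"
    using x0 by (simp add: psi_mult sum_distrib_left)
  finally show ?thesis using x0 by (metis mult_cancel_right1)
qed

lemma sum_psi_nz: "(\<Sum>x\<in>GF 1 - {0}. \<psi> x) = 0"
  using sum_psi psi_0 card_GF[of 1] by (subst (asm) sum.remove[of _ 0]) auto

text \<open>
  The bound of \<open>stepanov\<close> with \<open>d = q - 1\<close>, which makes \<open>f\<^sup>g\<close> the norm of \<open>f\<close>. The
  multiplicity \<open>M\<close> is about \<open>\<surd>Q\<close>, and \<open>B\<close> exceeds \<open>M/d\<close> by a bounded amount, just enough for the linear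
  system to have more unknowns than equations; the quotient of the degree bound \<open>Q(deg f + B)\<close> by \<open>M\<close>
  is then \<open>Q/d + O(\<surd>Q)\<close>.
\<close>

lemma fibre_bound:
  assumes n: "n \<ge> 1" and big: "(degree Fpoly + 7) ^ 2 \<le> q ^ n" and \<zeta>: "\<zeta> \<noteq> 0"
  shows "real (card {\<alpha>\<in>GF n. F \<alpha> ^ norm_exp n = \<zeta>})
    \<le> real (q ^ n) / real (q - 1) + 2 * (2 * real (degree Fpoly) + 3) * sqrt (real (q ^ n))"
proof -
  define Q where "Q = q ^ n"
  define D where "D = degree Fpoly"
  define d where "d = q - 1"
  define g where "g = norm_exp n"
  define M where "M = nat \<lfloor>sqrt (real Q)\<rfloor>"
  define m where "m = M div d"
  define B where "B = m + D + 3"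
  define N where "N = card {\<alpha>\<in>GF n. F \<alpha> ^ norm_exp n = \<zeta>}"
  have d: "d \<ge> 1" using q_gt_1 by (simp add: d_def)
  have Q1: "Q \<ge> 1" using q_pos by (simp add: Q_def Suc_leI)
  have dg: "Q - 1 = d * g" using norm_exp[of n] by (simp add: Q_def d_def g_def)
  have M1: "real M \<le> sqrt (real Q)" by (simp add: M_def)
  have M2: "sqrt (real Q) < real M + 1" by (simp add: M_def)
  have "real (D + 7) \<le> sqrt (real Q)"
    using big by (intro real_le_rsqrt) (metis D_def Q_def of_nat_le_iff of_nat_power)
  then have MD: "M \<ge> D + 6" using M2 by linarith
  have "real M ^ 2 \<le> real Q" using M1 by (metis of_nat_0_le_iff power_mono real_sqrt_pow2)
  then have MM: "M * M \<le> Q" by (metis of_nat_le_iff of_nat_power power2_eq_square)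
  obtain Q' where Q': "Q = Suc Q'" using Q1 by (cases Q) auto
  have Q'dg: "Q' = d * g" using dg unfolding Q' by simp
  have "M \<le> d * (m + 1)"
    using d dividend_less_times_div[of d M] by (simp add: m_def)
  then have "M * g \<le> d * (m + 1) * g" by (rule mult_le_mono1)
  also have "\<dots> = Q' * (m + 1)" unfolding Q'dg by (simp only: ac_simps)
  finally have h1: "M * g \<le> Q' * m + Q'" by (simp only: distrib_left mult_1_right)
  have h2: "M * M * D \<le> Q' * D + D" using mult_le_mono1[OF MM, of D] by (simp add: Q' add.commute)
  have h3: "M * m \<le> M * M" by (simp add: m_def)
  have h4: "M * D + M * 6 \<le> M * M" using mult_le_mono2[OF MD, of M] by (simp add: algebra_simps)
  have "M * (g + M * D + B) = M * g + M * M * D + M * m + M * D + M * 3"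
    by (simp add: B_def algebra_simps)
  also have "\<dots> < Q' * m + Q' * D + Q' * 3"
    using h1 h2 h3 h4 MM MD unfolding Q' by linarith
  also have "\<dots> = d * B * g" unfolding Q'dg B_def by (simp only: algebra_simps)
  finally have cond: "M * (g + M * D + B) < d * B * g" .
  have "g \<ge> 1" using cond by (cases g) auto
  moreover have "M \<le> M * M" by simp
  then have "M \<le> Q" using MM by linarith
  ultimately have "M * N \<le> Q * (D + B)"
    unfolding N_def Q_def D_def g_def
    using stepanov[of n d "norm_exp n" Fpoly a0 \<zeta> M B] n dg Fpoly_nz order_Fpoly \<zeta> cond GF_mono_A[OF a0]
    by (simp add: poly_Fpoly Q_def D_def g_def)
  then have "real M * real N \<le> real Q * real (D + B)"
    by (metis of_nat_le_iff of_nat_mult)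
  moreover have Mpos: "real M > 0" using MD by linarith
  ultimately have "real N \<le> real Q * real (D + B) / real M" by (simp add: field_simps)
  also have "\<dots> = real Q * real m / real M + real Q / real M * (2 * real D + 3)"
    using Mpos by (simp add: B_def field_simps)
  also have "\<dots> \<le> real Q / real d + 2 * sqrt (real Q) * (2 * real D + 3)"
  proof (rule add_mono)
    have "real m \<le> real M / real d" unfolding m_def by (rule of_nat_div_le_of_nat)
    then have "real Q * real m \<le> real Q * (real M / real d)" by (intro mult_left_mono) auto
    then show "real Q * real m / real M \<le> real Q / real d" using Mpos d by (simp add: field_simps)
    have "sqrt (real Q) \<le> 2 * real M" using M2 MD by linarith
    then have "sqrt (real Q) * sqrt (real Q) \<le> 2 * real M * sqrt (real Q)" by (intro mult_right_mono) auto
    then have "real Q \<le> 2 * real M * sqrt (real Q)" by simp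
    then have "real Q / real M \<le> 2 * sqrt (real Q)" using Mpos by (simp add: field_simps)
    then show "real Q / real M * (2 * real D + 3) \<le> 2 * sqrt (real Q) * (2 * real D + 3)"
      by (intro mult_right_mono) auto
  qed
  also have "\<dots> = real Q / real d + 2 * (2 * real D + 3) * sqrt (real Q)" by simp
  finally show ?thesis by (simp only: N_def Q_def d_def D_def)
qed

text \<open>
  An upper bound for every fibre of the norm map suffices, because the sizes \<open>N\<^sub>\<zeta>\<close> of all fibres add
  up to \<open>Q\<close>: as \<open>\<psi>\<close> sums to zero, \<open>\<Sum> \<psi>(\<zeta>) N\<^sub>\<zeta> = \<Sum> \<psi>(\<zeta>) (N\<^sub>\<zeta> - T)\<close> for every constant \<open>T\<close>, and when
  \<open>T\<close> bounds all \<open>N\<^sub>\<zeta>\<close>, the absolute values on the right can be summed exactly.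
\<close>

lemma char_sum_bound_large:
  assumes n: "n \<ge> 1" and big: "(degree Fpoly + 7) ^ 2 \<le> q ^ n"
  shows "cmod (char_sum n) \<le> (real (card A) + real (q - 1) * (2 * (2 * real (degree Fpoly) + 3))) * sqrt (real (q ^ n))"
proof -
  define Q where "Q = real (q ^ n)"
  define E where "E = 2 * (2 * real (degree Fpoly) + 3) * sqrt Q"
  define d where "d = real (q - 1)"
  define T where "T = Q / d + E"
  define N where "N = (\<lambda>\<zeta>. real (card {\<alpha>\<in>GF n. F \<alpha> ^ norm_exp n = \<zeta>}))"
  have fin: "finite (GF n :: 'a set)" "finite (GF 1 :: 'a set)" using card_GF n by auto
  have d: "d > 0" using q_gt_1 by (simp add: d_def)
  have NT: "N \<zeta> \<le> T" if "\<zeta> \<noteq> 0" for \<zeta>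
    using fibre_bound[OF n big that] by (simp add: N_def T_def Q_def d_def E_def)
  have "char_sum n = (\<Sum>\<zeta>\<in>GF 1. \<Sum>\<alpha>\<in>{\<alpha>\<in>GF n. F \<alpha> ^ norm_exp n = \<zeta>}. \<psi> (F \<alpha> ^ norm_exp n))"
    unfolding char_sum_def using fin norm_GF F_GF by (intro sum.group[symmetric]) auto
  also have "\<dots> = (\<Sum>\<zeta>\<in>GF 1. \<psi> \<zeta> * of_real (N \<zeta>))" by (simp add: N_def mult.commute)
  also have "\<dots> = (\<Sum>\<zeta>\<in>GF 1 - {0}. \<psi> \<zeta> * of_real (N \<zeta>))"
    using fin by (intro sum.mono_neutral_right) (auto simp: psi_0)
  also have "\<dots> = (\<Sum>\<zeta>\<in>GF 1 - {0}. \<psi> \<zeta> * of_real (N \<zeta>)) - of_real T * (\<Sum>\<zeta>\<in>GF 1 - {0}. \<psi> \<zeta>)"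
    using sum_psi_nz by simp
  also have "\<dots> = (\<Sum>\<zeta>\<in>GF 1 - {0}. \<psi> \<zeta> * of_real (N \<zeta> - T))"
    by (simp add: sum_distrib_left right_diff_distrib sum_subtractf mult.commute)
  finally have "cmod (char_sum n) \<le> (\<Sum>\<zeta>\<in>GF 1 - {0}. cmod (\<psi> \<zeta> * of_real (N \<zeta> - T)))"
    by (simp only: norm_sum)
  also have "\<dots> \<le> (\<Sum>\<zeta>\<in>GF 1 - {0}. T - N \<zeta>)"
  proof (rule sum_mono)
    fix \<zeta> :: 'a assume \<zeta>: "\<zeta> \<in> GF 1 - {0}"
    then show "cmod (\<psi> \<zeta> * of_real (N \<zeta> - T)) \<le> T - N \<zeta>"
      using psi_norm[of \<zeta>] NT[of \<zeta>] by (simp only: norm_mult norm_of_real) auto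
  qed
  also have "\<dots> = d * T - (\<Sum>\<zeta>\<in>GF 1 - {0}. N \<zeta>)"
    using fin card_GF(1)[of 1] q_pos by (simp add: sum_subtractf d_def)
  finally have le: "cmod (char_sum n) \<le> d * T - (\<Sum>\<zeta>\<in>GF 1 - {0}. N \<zeta>)" .
  have "card (GF n :: 'a set) = (\<Sum>\<zeta>\<in>GF 1. card {\<alpha>\<in>GF n. F \<alpha> ^ norm_exp n = \<zeta>})"
    using fin norm_GF F_GF sum.group[of "GF n" "GF 1" "\<lambda>\<alpha>. F \<alpha> ^ norm_exp n" "\<lambda>_. 1::nat"]
    by (simp add: image_subset_iff)
  then have "(\<Sum>\<zeta>\<in>GF 1. N \<zeta>) = Q" using card_GF(1)[OF n] by (simp add: N_def Q_def flip: of_nat_sum)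
  then have sumN: "(\<Sum>\<zeta>\<in>GF 1 - {0}. N \<zeta>) = Q - N 0"
    using fin by (subst (asm) sum.remove[of _ 0]) auto
  have "{\<alpha>\<in>GF n. F \<alpha> ^ norm_exp n = 0} \<subseteq> A" using F_eq_0_iff by auto
  then have N0: "N 0 \<le> real (card A)" unfolding N_def using finite_A card_mono by fastforce
  have dT: "d * T = Q + d * E" using d by (simp add: T_def distrib_left)
  have "Q \<ge> 1" using q_pos by (simp add: Q_def Suc_leI)
  then have "real (card A) * 1 \<le> real (card A) * sqrt Q" by (intro mult_left_mono) auto
  then have "cmod (char_sum n) \<le> real (card A) * sqrt Q + d * E" using le sumN N0 dT by linarith
  also have "\<dots> = (real (card A) + d * (2 * (2 * real (degree Fpoly) + 3))) * sqrt Q"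
    by (simp only: E_def distrib_right mult.assoc)
  finally show ?thesis by (simp only: Q_def d_def)
qed

lemma char_sum_bound: "\<exists>C. \<forall>n\<ge>1. cmod (char_sum n) \<le> C * sqrt (real q) ^ n"
proof -
  define c where "c = (degree Fpoly + 7) ^ 2"
  define C1 where "C1 = real (card A) + real (q - 1) * (2 * (2 * real (degree Fpoly) + 3))"
  show ?thesis
  proof (intro exI[of _ "max C1 c"] allI impI)
    fix n :: nat assume n: "n \<ge> 1"
    have sq: "sqrt (real (q ^ n)) = sqrt (real q) ^ n" by (simp add: real_sqrt_power)
    have ge1: "sqrt (real q) ^ n \<ge> 1" using q_pos by (intro one_le_power) (auto simp: Suc_leI)
    show "cmod (char_sum n) \<le> max C1 c * sqrt (real q) ^ n"
    proof (cases "c \<le> q ^ n")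
      case True
      then have "cmod (char_sum n) \<le> C1 * sqrt (real q) ^ n"
        using char_sum_bound_large[OF n] unfolding c_def C1_def sq by blast
      also have "\<dots> \<le> max C1 c * sqrt (real q) ^ n" using ge1 by (intro mult_right_mono) auto
      finally show ?thesis .
    next
      case False
      have "cmod (char_sum n) \<le> (\<Sum>\<alpha>\<in>(GF n::'a set). 1)" unfolding char_sum_def
        using norm_GF F_GF psi_le_1 by (intro sum_norm_le) auto
      also have "\<dots> = real (q ^ n)" using card_GF[OF n] by simp
      also have "\<dots> \<le> real c" using False by simp
      also have "\<dots> \<le> max C1 c * 1" by simp
      also have "\<dots> \<le> max C1 c * sqrt (real q) ^ n" using ge1 by (intro mult_left_mono) auto
      finally show ?thesis .
    qed
  qed
qed

end

section \<open>The L-function as a sum over monic polynomials\<close>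

lemma order_power_eq:
  "(p :: 'a::idom poly) \<noteq> 0 \<Longrightarrow> order a (p ^ n) = n * order a p"
  by (induction n) (auto simp: order_mult)

lemma order_prod_linear:
  "order x (\<Prod>j<(k::nat). [:- \<beta> j, 1:]) = card {j. j < k \<and> \<beta> j = (x::'a::idom)}"
proof (induction k)
  case (Suc k)
  have nz: "(\<Prod>j<k. [:- \<beta> j, 1:]) \<noteq> 0" by simp
  have ord: "order x [:- \<beta> k, 1:] = (if \<beta> k = x then 1 else 0)"
    using order_power_n_n[of x 1] by (auto intro: order_0I)
  have "{j. j < Suc k \<and> \<beta> j = x} = (if \<beta> k = x then insert k {j. j < k \<and> \<beta> j = x} else {j. j < k \<and> \<beta> j = x})"
    by (auto simp: less_Suc_eq)
  moreover have "order x (\<Prod>j<Suc k. [:- \<beta> j, 1:]) = order x (\<Prod>j<k. [:- \<beta> j, 1:]) + order x [:- \<beta> k, 1:]"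
    unfolding prod.lessThan_Suc using nz by (intro order_mult) (simp only: mult_eq_0_iff, simp)
  ultimately show ?case using Suc ord by (auto split: if_splits)
qed simp

lemma pcompose_monom: "pcompose (monom c i) (r :: 'a::comm_ring_1 poly) = smult c (r ^ i)"
  by (simp add: monom_altdef pcompose_smult pcompose_power pcompose_pCons)

context prime_char_closed begin

text \<open>
  For polynomials over the algebraic closure this says that all coefficients lie in the prime field
  (\<open>rational_coeff\<close>). In this form, stability under products and exact quotients is immediate.
\<close>

definition rational :: "'a poly \<Rightarrow> bool" where
  "rational p \<longleftrightarrow> p ^ q = pcompose p (monom 1 q)"

lemma rational_mult: "rational p \<Longrightarrow> rational r \<Longrightarrow> rational (p * r)"
  by (simp add: rational_def power_mult_distrib pcompose_mult)

lemma rational_add: "rational p \<Longrightarrow> rational r \<Longrightarrow> rational (p + r)"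
  using frob_add_poly[of p r 1] by (simp add: rational_def pcompose_add)

lemma rational_const: "c \<in> GF 1 \<Longrightarrow> rational [:c:]"
  by (simp add: rational_def poly_const_pow GF_iff)

lemma frob_linear: "[:- a, 1:] ^ (q ^ n) = [:- (a ^ (q ^ n)):] + monom 1 (q ^ n)" for a :: 'a
  using frob_add_poly[of "[:- a:]" "monom 1 1" n]
  by (simp add: monom_altdef poly_const_pow monom_power frob_minus) 

lemma rational_linear: "a \<in> GF 1 \<Longrightarrow> rational [:- a, 1:]"
  using frob_linear[of a 1] by (simp add: rational_def pcompose_pCons GF_iff)

lemma rational_prod: "(\<And>i. i \<in> I \<Longrightarrow> rational (f i)) \<Longrightarrow> rational (\<Prod>i\<in>I. f i)"
  using rational_const[of 1] by (induction I rule: infinite_finite_induct) (auto intro: rational_mult simp: one_pCons)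

lemma rational_cancel:
  assumes "rational C" "rational (C * h)" "C \<noteq> 0" shows "rational h"
proof -
  have "pcompose C (monom 1 q) \<noteq> 0" using assms by (metis rational_def power_not_zero)
  then show ?thesis using assms
    by (simp add: rational_def power_mult_distrib pcompose_mult)
qed

lemma rational_coeff:
  assumes "rational p" shows "coeff p i \<in> GF 1"
proof -
  have eq: "p = (\<Sum>i\<le>degree p. monom (coeff p i) i)" by (rule poly_as_sum_of_monoms[symmetric])
  have "p ^ q = (\<Sum>i\<le>degree p. monom (coeff p i) i ^ q)"
    using freshmans_dream_sum[OF prime_CHAR_poly refl, of "\<lambda>i. monom (coeff p i) i" "{..degree p}"] eq CHAR_eq_q
    by simp
  also have "\<dots> = (\<Sum>i\<le>degree p. monom (coeff p i ^ q) (i * q))" by (simp add: monom_power)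
  finally have c1: "p ^ q = (\<Sum>i\<le>degree p. monom (coeff p i ^ q) (i * q))" .
  have "pcompose p (monom 1 q) = (\<Sum>i\<le>degree p. pcompose (monom (coeff p i) i) (monom 1 q))"
    by (subst eq) (rule pcompose_sum)
  also have "\<dots> = (\<Sum>i\<le>degree p. monom (coeff p i) (i * q))"
    by (simp add: pcompose_monom monom_power smult_monom mult.commute)
  finally have c2: "pcompose p (monom 1 q) = (\<Sum>i\<le>degree p. monom (coeff p i) (i * q))" .
  show ?thesis
  proof (cases "i \<le> degree p")
    case True
    have "coeff (\<Sum>i\<le>degree p. monom (v i) (i * q)) (i * q) = v i" for v :: "nat \<Rightarrow> 'a"
      using True q_pos by (simp add: coeff_sum)
    from this[of "\<lambda>i. coeff p i ^ q"] this[of "coeff p"] show ?thesis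
      using assms c1 c2 by (simp add: rational_def GF_iff)
  qed (simp add: coeff_eq_0)
qed

lemma rational_eval:
  assumes "rational p" "a \<in> GF 1" shows "poly p a \<in> GF 1"
proof -
  have "poly (p ^ q) a = poly (pcompose p (monom 1 q)) a" using assms by (simp add: rational_def)
  then show ?thesis using assms by (simp add: GF_iff poly_pcompose poly_power poly_monom)
qed

text \<open>
  Since \<open>g\<^sup>q = g(Y\<^sup>q)\<close>, the order of \<open>g(Y\<^sup>q)\<close> at \<open>\<alpha>\<close> can be computed twice: it is \<open>q\<close> times the order of \<open>g\<close> at \<open>\<alpha>\<close>,
  and, because \<open>Y\<^sup>q - \<alpha>\<^sup>q = (Y - \<alpha>)\<^sup>q\<close>, also \<open>q\<close> times the order of \<open>g\<close> at \<open>\<alpha>\<^sup>q\<close>.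
\<close>

lemma order_frob:
  assumes "rational g" "g \<noteq> 0" shows "order (\<alpha> ^ q) g = order \<alpha> g"
proof -
  define m where "m = order (\<alpha> ^ q) g"
  obtain h where h: "g = [:- (\<alpha> ^ q), 1:] ^ m * h" "\<not> [:- (\<alpha> ^ q), 1:] dvd h"
    using order_decomp[OF assms(2), of "\<alpha> ^ q"] by (auto simp: m_def)
  then have h0: "poly h (\<alpha> ^ q) \<noteq> 0" by (simp add: poly_eq_0_iff_dvd)
  have lin: "pcompose [:- (\<alpha> ^ q), 1:] (monom 1 q) = [:- \<alpha>, 1:] ^ q"
    using frob_linear[of \<alpha> 1] by (simp add: pcompose_pCons)
  have "g ^ q = pcompose g (monom 1 q)" using assms by (simp add: rational_def)
  also have "\<dots> = [:- \<alpha>, 1:] ^ (q * m) * pcompose h (monom 1 q)"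
    by (simp add: h(1) pcompose_mult pcompose_power lin power_mult del: pcompose_pCons)
  finally have eq: "g ^ q = [:- \<alpha>, 1:] ^ (q * m) * pcompose h (monom 1 q)" .
  have "poly (pcompose h (monom 1 q)) \<alpha> \<noteq> 0" using h0 by (simp add: poly_pcompose poly_monom)
  then have "order \<alpha> (pcompose h (monom 1 q)) = 0" by (rule order_0I)
  moreover have "g ^ q \<noteq> 0" using assms by simp
  ultimately have "order \<alpha> (g ^ q) = q * m"
    using eq by (metis order_mult order_power_n_n add.right_neutral)
  then show ?thesis using assms q_pos by (simp add: order_power_eq m_def)
qed

lemma order_frob_iterate:
  assumes "rational g" "g \<noteq> 0" shows "order (\<alpha> ^ (q ^ j)) g = order \<alpha> g"
proof (induction j)
  case (Suc j)
  have "\<alpha> ^ (q ^ Suc j) = (\<alpha> ^ (q ^ j)) ^ q" by (simp only: power_Suc2 power_mult)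
  then show ?case using order_frob[OF assms, of "\<alpha> ^ (q ^ j)"] Suc by simp
qed simp

text \<open>
  For \<open>\<alpha>\<close> in the field of \<open>q\<^sup>k\<close> elements this is the characteristic polynomial of \<open>\<alpha>\<close>, a power of the
  minimal polynomial.
\<close>

definition conj_poly :: "nat \<Rightarrow> 'a \<Rightarrow> 'a poly" where
  "conj_poly k \<alpha> = (\<Prod>j<k. [:- (\<alpha> ^ (q ^ j)), 1:])"

lemma conj_poly_nz: "conj_poly k \<alpha> \<noteq> 0" by (simp add: conj_poly_def)

lemma degree_conj_poly: "degree (conj_poly k \<alpha>) = k"
  by (simp add: conj_poly_def degree_prod_eq_sum_degree)

lemma lead_coeff_conj_poly: "lead_coeff (conj_poly k \<alpha>) = 1"
  by (simp add: conj_poly_def lead_coeff_prod)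

lemma rational_conj_poly:
  assumes "k \<ge> 1" "\<alpha> \<in> GF k" shows "rational (conj_poly k \<alpha>)"
proof -
  obtain k' where k': "k = Suc k'" using assms by (cases k) auto
  define f where "f = (\<lambda>j. [:- (\<alpha> ^ (q ^ j)):] + monom 1 q)"
  have fk: "f k = f 0" using assms by (simp add: f_def GF_iff)
  have "conj_poly k \<alpha> ^ q = (\<Prod>j<k. [:- (\<alpha> ^ (q ^ j)), 1:] ^ q)"
    by (simp add: conj_poly_def prod_power_distrib)
  also have "\<dots> = (\<Prod>j<k. f (Suc j))"
    using frob_linear[of _ 1] by (simp add: f_def power_mult mult.commute[of q] del: power_Suc add: power_Suc2)
  also have "\<dots> = (\<Prod>j<k'. f (Suc j)) * f k" by (simp add: k')
  also have "\<dots> = f 0 * (\<Prod>j<k'. f (Suc j))" by (simp add: fk)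
  also have "\<dots> = (\<Prod>j<k. f j)" unfolding k' by (simp only: prod.lessThan_Suc_shift)
  also have "\<dots> = pcompose (conj_poly k \<alpha>) (monom 1 q)"
    by (simp add: conj_poly_def pcompose_prod pcompose_pCons f_def)
  finally show ?thesis by (simp add: rational_def)
qed

lemma conj_poly_mult:
  assumes "\<alpha> \<in> GF D" shows "conj_poly (D * t) \<alpha> = conj_poly D \<alpha> ^ t"
proof (induction t)
  case (Suc t)
  have split: "(\<Prod>j<a + b. f j) = (\<Prod>j<a. f j) * (\<Prod>j<b. f (a + j))" for a b and f :: "nat \<Rightarrow> 'a poly"
    by (induction b) (auto simp: mult.assoc)
  have "\<alpha> ^ (q ^ (D * t + j)) = \<alpha> ^ (q ^ j)" for j
    using GF_frob_iterate[OF assms, of t] by (simp add: power_add power_mult)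
  then have "conj_poly (D * t + D) \<alpha> = conj_poly (D * t) \<alpha> * conj_poly D \<alpha>"
    unfolding conj_poly_def by (subst split) simp
  then show ?case using Suc by (simp add: add.commute mult.commute)
qed (simp add: conj_poly_def)

text \<open>
  Frobenius permutes the finitely many roots of \<open>g\<close>, so two of its iterates agree at \<open>\<alpha>\<close>.
\<close>

lemma root_in_GF:
  assumes "rational g" "g \<noteq> 0" "poly g \<alpha> = 0"
  shows "\<exists>k\<ge>1. \<alpha> \<in> GF k"
proof -
  have "poly g (\<alpha> ^ (q ^ i)) = 0" for i
    using order_frob_iterate[OF assms(1,2), of \<alpha> i] assms by (simp add: order_root)
  then have "range (\<lambda>i. \<alpha> ^ (q ^ i)) \<subseteq> {x. poly g x = 0}" by auto
  then have "finite (range (\<lambda>i. \<alpha> ^ (q ^ i)))" using assms poly_roots_finite finite_subset by blast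
  then have "\<not> inj (\<lambda>i. \<alpha> ^ (q ^ i))" using finite_imageD infinite_UNIV_nat by blast
  then obtain i j where "i < j" "\<alpha> ^ (q ^ i) = \<alpha> ^ (q ^ j)"
    unfolding inj_on_def by (metis nat_neq_iff)
  moreover have "\<alpha> ^ (q ^ j) = (\<alpha> ^ (q ^ (j - i))) ^ (q ^ i)"
    using \<open>i < j\<close> by (simp flip: power_mult power_add)
  ultimately have "\<alpha> = \<alpha> ^ (q ^ (j - i))"
        using frob_inj[of \<alpha> i "\<alpha> ^ (q ^ (j - i))"] by simp
  then show ?thesis using \<open>i < j\<close> by (intro exI[of _ "j - i"]) (auto simp: GF_iff)
qed

text \<open>
  Let \<open>D\<close> be the degree of \<open>\<alpha>\<close>. The admissible \<open>k\<close> are multiples \<open>Dt\<close>, for which the characteristic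
  polynomial is the \<open>t\<close>-th power of the minimal polynomial. All conjugates of \<open>\<alpha>\<close> being roots of \<open>g\<close> of the
  same order, this power divides \<open>g\<close> exactly when \<open>t\<close> is at most that order.
\<close>

lemma card_conj_poly_dvd:
  assumes g: "rational g" "degree g = n" and \<alpha>: "poly g \<alpha> = 0" and g0: "g \<noteq> 0"
  shows "card {k\<in>{1..n}. \<alpha> \<in> GF k \<and> conj_poly k \<alpha> dvd g} = order \<alpha> g"
proof -
  define D where "D = (LEAST k. k \<ge> 1 \<and> \<alpha> \<in> GF k)"
  have D: "D \<ge> 1" "\<alpha> \<in> GF D"
    using LeastI_ex[of "\<lambda>k. k \<ge> 1 \<and> \<alpha> \<in> GF k"] root_in_GF[OF g(1) g0 \<alpha>] by (auto simp: D_def)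
  have least: "D \<le> k" if "k \<ge> 1" "\<alpha> \<in> GF k" for k
    unfolding D_def using that by (intro Least_le) auto
  have dvd: "D dvd k" if "\<alpha> \<in> GF k" for k
  proof (rule ccontr)
    assume "\<not> D dvd k"
    then have r: "k mod D \<ge> 1" by (simp add: mod_greater_zero_iff_not_dvd Suc_leI)
    have "\<alpha> ^ (q ^ k) = (\<alpha> ^ (q ^ (D * (k div D)))) ^ (q ^ (k mod D))"
      by (simp flip: power_mult power_add)
    then have "\<alpha> \<in> GF (k mod D)" using GF_frob_iterate[OF D(2)] that by (simp add: GF_iff)
    then show False using least[OF r] mod_less_divisor[of D k] D(1) by linarith
  qed
  have inj: "inj_on (\<lambda>j. \<alpha> ^ (q ^ j)) {..<D}"
  proof -
    have ne: "\<alpha> ^ (q ^ i) \<noteq> \<alpha> ^ (q ^ j)" if "i < j" "j < D" for i j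
    proof
      assume "\<alpha> ^ (q ^ i) = \<alpha> ^ (q ^ j)"
      moreover have "\<alpha> ^ (q ^ j) = (\<alpha> ^ (q ^ (j - i))) ^ (q ^ i)"
        using \<open>i < j\<close> by (simp flip: power_mult power_add)
      ultimately have "\<alpha> = \<alpha> ^ (q ^ (j - i))"
        using frob_inj[of \<alpha> i "\<alpha> ^ (q ^ (j - i))"] by simp
      then have "\<alpha> \<in> GF (j - i)" by (simp add: GF_iff)
      then show False using least[of "j - i"] that by linarith
    qed
    show ?thesis
    proof (rule inj_onI)
      fix i j assume "i \<in> {..<D}" "j \<in> {..<D}" "\<alpha> ^ (q ^ i) = \<alpha> ^ (q ^ j)"
      then show "i = j" using ne[of i j] ne[of j i] by (cases i j rule: linorder_cases) auto
    qed
  qed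
  have dvd_iff: "conj_poly (D * t) \<alpha> dvd g \<longleftrightarrow> t \<le> order \<alpha> g" for t
  proof
    assume "conj_poly (D * t) \<alpha> dvd g"
    then have "order \<alpha> (conj_poly D \<alpha> ^ t) \<le> order \<alpha> g"
      using dvd_imp_order_le[OF g0] conj_poly_mult[OF D(2)] by simp
    moreover have "order \<alpha> (conj_poly D \<alpha>) \<ge> 1"
    proof -
      have "0 \<in> {j. j < D \<and> \<alpha> ^ (q ^ j) = \<alpha>}" using D by simp
      then have "card {j. j < D \<and> \<alpha> ^ (q ^ j) = \<alpha>} > 0" by (subst card_gt_0_iff) auto
      then show ?thesis by (simp add: conj_poly_def order_prod_linear)
    qed
    then have "t * 1 \<le> t * order \<alpha> (conj_poly D \<alpha>)" by (rule mult_le_mono2)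
    ultimately show "t \<le> order \<alpha> g"
      unfolding order_power_eq[OF conj_poly_nz] by linarith
  next
    assume t: "t \<le> order \<alpha> g"
    have "order x (conj_poly D \<alpha> ^ t) \<le> order x g" for x
    proof (cases "\<exists>j<D. \<alpha> ^ (q ^ j) = x")
      case True
      then obtain j where j: "j < D" "\<alpha> ^ (q ^ j) = x" by blast
      have "{j'. j' < D \<and> \<alpha> ^ (q ^ j') = x} = {j}" using inj_onD[OF inj] j by auto
      then have "order x (conj_poly D \<alpha>) = 1" by (simp add: conj_poly_def order_prod_linear)
      moreover have "order x g = order \<alpha> g" using order_frob_iterate[OF g(1) g0] j by metis
      ultimately show ?thesis using t conj_poly_nz by (simp add: order_power_eq)
    next
      case False
      then have "{j'. j' < D \<and> \<alpha> ^ (q ^ j') = x} = {}" by auto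
      then have "order x (conj_poly D \<alpha>) = 0" by (simp only: conj_poly_def order_prod_linear) simp
      then show ?thesis using conj_poly_nz by (simp add: order_power_eq)
    qed
    then have "conj_poly D \<alpha> ^ t dvd g" using conj_poly_nz g0 by (intro dvd_if_order_le) auto
    then show "conj_poly (D * t) \<alpha> dvd g" by (simp add: conj_poly_mult[OF D(2)])
  qed
  have "{k\<in>{1..n}. \<alpha> \<in> GF k \<and> conj_poly k \<alpha> dvd g} = (\<lambda>t. D * t) ` {1..order \<alpha> g}"
  proof (intro equalityI subsetI)
    fix k assume "k \<in> {k\<in>{1..n}. \<alpha> \<in> GF k \<and> conj_poly k \<alpha> dvd g}"
    then have k: "k \<ge> 1" "\<alpha> \<in> GF k" "conj_poly k \<alpha> dvd g" by auto
    then obtain t where t: "k = D * t" using dvd by blast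
    then show "k \<in> (\<lambda>t. D * t) ` {1..order \<alpha> g}" using k dvd_iff[of t] by (intro image_eqI[of _ _ t]) (auto simp: Suc_le_eq)
  next
    fix k assume "k \<in> (\<lambda>t. D * t) ` {1..order \<alpha> g}"
    then obtain t where "k = D * t" "t \<in> {1..order \<alpha> g}" by blast
    then have t: "k = D * t" "t \<ge> 1" "t \<le> order \<alpha> g" by auto
    have d: "conj_poly k \<alpha> dvd g" using t dvd_iff by simp
    then have "k \<le> n" using dvd_imp_degree_le[OF d g0] by (simp add: degree_conj_poly g(2))
    moreover have "\<alpha> \<in> GF k" using GF_frob_iterate[OF D(2), of t] t by (simp add: GF_iff)
    ultimately show "k \<in> {k\<in>{1..n}. \<alpha> \<in> GF k \<and> conj_poly k \<alpha> dvd g}"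
      using d t D(1) by (auto simp: Suc_le_eq)
  qed
  moreover have "inj_on (\<lambda>t. D * t) {1..order \<alpha> g}" using D by (intro inj_onI) auto
  ultimately show ?thesis by (simp add: card_image)
qed

text \<open>
  This identity replaces unique factorisation into irreducible polynomials in the treatment of the Euler
  product: both sides count the roots of \<open>g\<close> with multiplicity.
\<close>

lemma count_conj_poly_dvd:
  assumes g: "rational g" "degree g = n" "g \<noteq> 0"
  shows "(\<Sum>k=1..n. card {\<alpha>\<in>GF k. conj_poly k \<alpha> dvd g}) = n"
proof -
  define R where "R = {\<alpha>. poly g \<alpha> = 0}"
  have finR: "finite R" using g poly_roots_finite by (simp add: R_def)
  have root: "poly g \<alpha> = 0" if "conj_poly k \<alpha> dvd g" "k \<ge> 1" for k \<alpha>
  proof -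
    have "[:- (\<alpha> ^ (q ^ 0)), 1:] dvd conj_poly k \<alpha>"
      unfolding conj_poly_def using that by (intro dvd_prodI) auto
    then show ?thesis using that by (simp add: poly_eq_0_iff_dvd dvd_trans)
  qed
  have "(\<Sum>k=1..n. card {\<alpha>\<in>GF k. conj_poly k \<alpha> dvd g})
    = (\<Sum>k=1..n. \<Sum>\<alpha>\<in>R. if \<alpha> \<in> GF k \<and> conj_poly k \<alpha> dvd g then 1 else 0)"
  proof (intro sum.cong refl)
    fix k assume "k \<in> {1..n}"
    then have "{\<alpha>\<in>GF k. conj_poly k \<alpha> dvd g} = {\<alpha>\<in>R. \<alpha> \<in> GF k \<and> conj_poly k \<alpha> dvd g}"
      using root by (auto simp: R_def)
    then show "card {\<alpha>\<in>GF k. conj_poly k \<alpha> dvd g}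
      = (\<Sum>\<alpha>\<in>R. if \<alpha> \<in> GF k \<and> conj_poly k \<alpha> dvd g then 1 else 0)"
      using finR by (simp flip: sum.inter_filter)
  qed
  also have "\<dots> = (\<Sum>\<alpha>\<in>R. card {k\<in>{1..n}. \<alpha> \<in> GF k \<and> conj_poly k \<alpha> dvd g})"
    by (subst sum.swap) (simp flip: sum.inter_filter)
  also have "\<dots> = (\<Sum>\<alpha>\<in>R. order \<alpha> g)"
    using card_conj_poly_dvd[OF g(1,2) _ g(3)] by (intro sum.cong) (auto simp: R_def)
  also have "\<dots> = size (proots g)"
    using g by (simp add: size_multiset_overloaded_eq R_def)
  finally show ?thesis using size_proots_alg_closed[of g] g by simp
qed

text \<open>
  The second and third condition together say that \<open>g\<close> is monic of degree \<open>n\<close>; this form is convenient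
  when polynomials of smaller degree are added to \<open>g\<close>.
\<close>

definition monic_rational :: "nat \<Rightarrow> 'a poly set" where
  "monic_rational n = {g. rational g \<and> degree g \<le> n \<and> coeff g n = 1}"

lemma monic_rationalD:
  assumes "g \<in> monic_rational n" shows "rational g" "degree g = n" "lead_coeff g = 1" "g \<noteq> 0"
proof -
  have "degree g \<ge> n" using assms by (intro le_degree) (auto simp: monic_rational_def)
  then show "degree g = n" using assms by (auto simp: monic_rational_def)
  then show "rational g" "lead_coeff g = 1" "g \<noteq> 0" using assms by (auto simp: monic_rational_def)
qed

lemma finite_monic_rational: "finite (monic_rational n)"
proof -
  have "monic_rational n \<subseteq> Poly ` {xs. set xs \<subseteq> GF 1 \<and> length xs = Suc n}"
  proof
    fix g assume g: "g \<in> monic_rational n"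
    have "set (coeffs g) \<subseteq> GF 1"
    proof
      fix x assume "x \<in> set (coeffs g)"
      then obtain i where "i < length (coeffs g)" "x = coeffs g ! i" by (metis in_set_conv_nth)
      then show "x \<in> GF 1" using rational_coeff[OF monic_rationalD(1)[OF g], of i]
        monic_rationalD(4)[OF g] by (simp add: nth_coeffs_coeff)
    qed
    moreover have "length (coeffs g) = Suc n" using monic_rationalD[OF g] by (simp add: length_coeffs_degree)
    ultimately show "g \<in> Poly ` {xs. set xs \<subseteq> GF 1 \<and> length xs = Suc n}"
      by (intro image_eqI[of _ _ "coeffs g"]) auto
  qed
  moreover have "finite {xs. set xs \<subseteq> (GF 1 :: 'a set) \<and> length xs = Suc n}"
    by (rule finite_lists_length_eq) (use card_GF in simp)
  ultimately show ?thesis by (blast intro: finite_subset)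
qed

lemma monic_rational_0: "monic_rational 0 = {1}"
proof -
  have "g = 1" if g: "g \<in> monic_rational 0" for g
  proof -
    obtain a where "g = [:a:]" using monic_rationalD(2)[OF g] degree_eq_zeroE by blast
    then show ?thesis using monic_rationalD(3)[OF g] by (simp add: one_pCons)
  qed
  moreover have "1 \<in> monic_rational 0" using rational_const[of 1] by (simp add: monic_rational_def one_pCons)
  ultimately show ?thesis by auto
qed

lemma sum_monic_rational_multiples:
  fixes h :: "'a poly \<Rightarrow> complex"
  assumes C: "rational C" "degree C = k" "lead_coeff C = 1" and k: "k \<le> n"
  shows "(\<Sum>x\<in>monic_rational (n - k). h (C * x)) = (\<Sum>g\<in>{g\<in>monic_rational n. C dvd g}. h g)"
proof (rule sum.reindex_bij_witness[of _ "\<lambda>g. g div C" "\<lambda>x. C * x"])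
  have C0: "C \<noteq> 0" using C by auto
  show "C * x div C = x" if "x \<in> monic_rational (n - k)" for x using C0 by simp
  show "C * x \<in> {g\<in>monic_rational n. C dvd g}" if "x \<in> monic_rational (n - k)" for x
  proof -
    have "degree (C * x) = n" using monic_rationalD[OF that] C C0 k by (simp add: degree_mult_eq)
    moreover have "lead_coeff (C * x) = 1" using monic_rationalD[OF that] C by (simp add: lead_coeff_mult)
    ultimately show ?thesis using monic_rationalD[OF that] C by (auto simp: monic_rational_def rational_mult)
  qed
  show "C * (g div C) = g" if "g \<in> {g\<in>monic_rational n. C dvd g}" for g using that by auto
  show "g div C \<in> monic_rational (n - k)" if gC: "g \<in> {g\<in>monic_rational n. C dvd g}" for g
  proof -
    have g: "g \<in> monic_rational n" using gC by auto
    obtain x where x: "g = C * x" using gC by blast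
    have x0: "x \<noteq> 0" using monic_rationalD[OF g] x by auto
    have "degree x = n - k" using monic_rationalD[OF g] C C0 x0 by (simp add: x degree_mult_eq)
    moreover have "lead_coeff C * lead_coeff x = 1" using monic_rationalD(3)[OF g] by (simp only: x lead_coeff_mult)
    then have "lead_coeff x = 1" by (simp only: C(3) mult_1)
    moreover have "rational x" using rational_cancel[OF C(1) _ C0] monic_rationalD(1)[OF g] unfolding x by blast
    ultimately show ?thesis using C0 by (simp add: monic_rational_def x)
  qed
qed (rule refl)

end

context kummer_sum begin

definition val :: "'a poly \<Rightarrow> 'a" where "val g = (\<Prod>a\<in>A. poly g a ^ e a)"

text \<open>
  The coefficients of the L-function.
\<close>

definition L_coeff :: "nat \<Rightarrow> complex" where "L_coeff n = (\<Sum>g\<in>monic_rational n. \<psi> (val g))"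

lemma A_GF_1: "a \<in> A \<Longrightarrow> a \<in> GF 1" using A_sub by blast

lemma val_GF: "rational g \<Longrightarrow> val g \<in> GF 1"
  unfolding val_def by (intro GF_prod GF_power rational_eval) (use A_GF_1 in auto)

lemma val_mult: "val (g * h) = val g * val h"
  by (simp add: val_def power_mult_distrib prod.distrib)

lemma L_coeff_0: "L_coeff 0 = 1"
  by (simp add: L_coeff_def monic_rational_0 val_def psi_1)

text \<open>
  The polynomial \<open>h = \<Prod> (Y - a)\<close> over the points of \<open>A\<close> other than \<open>a0\<close> has degree less than \<open>n\<close>. Adding
  multiples \<open>t h\<close> to \<open>g\<close> permutes the monic polynomials of degree \<open>n\<close> and changes only the value at \<open>a0\<close>,
  which runs through the whole prime field together with \<open>t\<close>; and \<open>\<psi>\<close> sums to zero over it.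
\<close>

lemma L_coeff_vanish:
  assumes n: "n \<ge> card A" shows "L_coeff n = 0"
proof -
  define h where "h = (\<Prod>a\<in>A-{a0}. [:- a, 1:])"
  have "degree h = card A - 1"
    using finite_A a0 by (simp add: h_def degree_prod_eq_sum_degree)
  moreover have "card A > 0" using finite_A a0 card_gt_0_iff by blast
  ultimately have deg: "degree h < n" using n by linarith
  have rat: "rational h" unfolding h_def by (intro rational_prod rational_linear) (use A_GF_1 in auto)
  have h0: "poly h a0 \<noteq> 0" using finite_A by (auto simp: h_def poly_prod)
  have ha: "poly h a = 0" if "a \<in> A - {a0}" for a
    using that finite_A by (auto simp: h_def poly_prod intro: bexI[of _ a])
  have shift: "g + smult t h \<in> monic_rational n" if "g \<in> monic_rational n" "t \<in> GF 1" for g t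
  proof -
    have "rational (smult t h)" using rational_mult[OF rational_const[OF that(2)] rat] by simp
    moreover have "degree (g + smult t h) \<le> n"
      using that deg by (intro degree_add_le) (auto simp: monic_rational_def intro: degree_smult_le[THEN order_trans])
    ultimately show ?thesis using that deg by (auto simp: monic_rational_def coeff_eq_0 intro: rational_add)
  qed
  have minus: "- t \<in> GF 1" if "t \<in> (GF 1 :: 'a set)" for t
    using GF_diff[of 0 1 t] that by simp
  have L_coeff_shift: "L_coeff n = (\<Sum>g\<in>monic_rational n. \<psi> (val (g + smult t h)))" if t: "t \<in> GF 1" for t
    unfolding L_coeff_def
    by (rule sum.reindex_bij_witness[of _ "\<lambda>g. g + smult t h" "\<lambda>g. g + smult (- t) h"])
       (use shift[OF _ t] shift[OF _ minus[OF t]] in auto)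
  define R where "R = (\<lambda>g. \<Prod>a\<in>A-{a0}. poly g a ^ e a)"
  have val_eq: "val (g + smult t h) = R g * (poly g a0 + t * poly h a0)" for g t
  proof -
    have "val (g + smult t h) = poly (g + smult t h) a0 * (\<Prod>a\<in>A-{a0}. poly (g + smult t h) a ^ e a)"
      unfolding val_def using finite_A a0 by (subst prod.remove[of _ a0]) (auto simp: e_a0)
    also have "(\<Prod>a\<in>A-{a0}. poly (g + smult t h) a ^ e a) = R g"
      unfolding R_def using ha by (intro prod.cong) auto
    finally show ?thesis by simp
  qed
  have inner: "(\<Sum>t\<in>GF 1. \<psi> (val (g + smult t h))) = 0" if g: "g \<in> monic_rational n" for g
  proof -
    have fr: "poly g a0 \<in> GF 1" "poly h a0 \<in> GF 1" "R g \<in> GF 1"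
      unfolding R_def using rational_eval[OF monic_rationalD(1)[OF g]] rational_eval[OF rat] a0 A_GF_1
      by (blast intro: GF_prod GF_power)+
    have "(\<Sum>t\<in>GF 1. \<psi> (val (g + smult t h))) = (\<Sum>t\<in>GF 1. \<psi> (R g) * \<psi> (poly g a0 + t * poly h a0))"
      using fr by (intro sum.cong refl) (simp add: val_eq psi_mult GF_add GF_mult)
    also have "\<dots> = \<psi> (R g) * (\<Sum>t\<in>GF 1. \<psi> (poly g a0 + t * poly h a0))" by (simp add: sum_distrib_left)
    also have "(\<Sum>t\<in>GF 1. \<psi> (poly g a0 + t * poly h a0)) = (\<Sum>s\<in>GF 1. \<psi> s)"
      by (rule sum.reindex_bij_witness[of _ "\<lambda>s. (s - poly g a0) / poly h a0" "\<lambda>t. poly g a0 + t * poly h a0"])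
         (use fr h0 in \<open>auto intro: GF_add GF_mult GF_diff GF_divide\<close>)
    finally show ?thesis by (simp add: sum_psi[simplified])
  qed
  have "of_nat q * L_coeff n = (\<Sum>t\<in>(GF 1::'a set). L_coeff n)" using card_GF(1)[of 1] by simp
  also have "\<dots> = (\<Sum>t\<in>GF 1. \<Sum>g\<in>monic_rational n. \<psi> (val (g + smult t h)))"
    by (intro sum.cong refl L_coeff_shift)
  also have "\<dots> = (\<Sum>g\<in>monic_rational n. \<Sum>t\<in>GF 1. \<psi> (val (g + smult t h)))" by (rule sum.swap)
  also have "\<dots> = 0" by (intro sum.neutral ballI inner)
  finally show ?thesis using q_pos by simp
qed

lemma val_conj_poly: "val (conj_poly k \<alpha>) = F \<alpha> ^ norm_exp k"
proof -
  have "poly (conj_poly k \<alpha>) a = (a - \<alpha>) ^ norm_exp k" if "a \<in> A" for a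
  proof -
    have "poly (conj_poly k \<alpha>) a = (\<Prod>j<k. (a - \<alpha>) ^ (q ^ j))"
      unfolding conj_poly_def poly_prod using GF_mono_A[OF that]
      by (intro prod.cong refl) (simp add: frob_diff GF_iff)
    then show ?thesis by (simp add: norm_exp_def power_sum)
  qed
  then have "val (conj_poly k \<alpha>) = (\<Prod>a\<in>A. ((a - \<alpha>) ^ norm_exp k) ^ e a)" by (simp add: val_def)
  also have "\<dots> = (\<Prod>a\<in>A. ((a - \<alpha>) ^ e a) ^ norm_exp k)" by (simp add: mult.commute flip: power_mult)
  finally show ?thesis by (simp add: F_def prod_power_distrib)
qed

text \<open>
  The product \<open>S\<^sub>k c\<^bsub>n-k\<^esub>\<close> is a sum over pairs of an element \<open>\<alpha>\<close> and a monic polynomial \<open>h\<close> of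
  degree \<open>n - k\<close>, and the summand depends only on \<open>g = conj_poly k \<alpha> * h\<close>. By \<open>count_conj_poly_dvd\<close> every
  \<open>g\<close> arises exactly \<open>n\<close> times.
\<close>

lemma newton: "of_nat n * L_coeff n = (\<Sum>k=1..n. char_sum k * L_coeff (n - k))"
proof -
  have fin: "finite (GF k :: 'a set)" if "k \<in> {1..n}" for k using card_GF(2)[of k] that by simp
  have "(\<Sum>k=1..n. char_sum k * L_coeff (n - k))
    = (\<Sum>k=1..n. \<Sum>\<alpha>\<in>GF k. \<Sum>g\<in>monic_rational n. if conj_poly k \<alpha> dvd g then \<psi> (val g) else 0)"
  proof (intro sum.cong refl)
    fix k assume k: "k \<in> {1..n}"
    have "\<psi> (F \<alpha> ^ norm_exp k) * L_coeff (n - k) = (\<Sum>g\<in>monic_rational n. if conj_poly k \<alpha> dvd g then \<psi> (val g) else 0)"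
      if \<alpha>: "\<alpha> \<in> GF k" for \<alpha>
    proof -
      have rat: "rational (conj_poly k \<alpha>)" using k \<alpha> rational_conj_poly by auto
      have "\<psi> (F \<alpha> ^ norm_exp k) * L_coeff (n - k) = (\<Sum>x\<in>monic_rational (n - k). \<psi> (val (conj_poly k \<alpha> * x)))"
        unfolding L_coeff_def sum_distrib_left
        by (intro sum.cong refl) (metis monic_rationalD(1) psi_mult rat val_GF val_conj_poly val_mult)
      also have "\<dots> = (\<Sum>g\<in>{g\<in>monic_rational n. conj_poly k \<alpha> dvd g}. \<psi> (val g))"
        using k by (intro sum_monic_rational_multiples rat degree_conj_poly lead_coeff_conj_poly) auto
      finally show ?thesis using finite_monic_rational by (simp flip: sum.inter_filter)
    qed
    then show "char_sum k * L_coeff (n - k) = (\<Sum>\<alpha>\<in>GF k. \<Sum>g\<in>monic_rational n. if conj_poly k \<alpha> dvd g then \<psi> (val g) else 0)"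
      by (simp add: char_sum_def sum_distrib_right)
  qed
  also have "\<dots> = (\<Sum>k=1..n. \<Sum>g\<in>monic_rational n. \<Sum>\<alpha>\<in>GF k. if conj_poly k \<alpha> dvd g then \<psi> (val g) else 0)"
    by (intro sum.cong refl sum.swap)
  also have "\<dots> = (\<Sum>g\<in>monic_rational n. \<Sum>k=1..n. \<Sum>\<alpha>\<in>GF k. if conj_poly k \<alpha> dvd g then \<psi> (val g) else 0)"
    by (rule sum.swap)
  also have "\<dots> = (\<Sum>g\<in>monic_rational n. of_nat n * \<psi> (val g))"
  proof (intro sum.cong refl)
    fix g assume g: "g \<in> monic_rational n"
    have "(\<Sum>k=1..n. \<Sum>\<alpha>\<in>GF k. if conj_poly k \<alpha> dvd g then \<psi> (val g) else 0)
      = (\<Sum>k=1..n. of_nat (card {\<alpha>\<in>GF k. conj_poly k \<alpha> dvd g}) * \<psi> (val g))"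
      using fin by (intro sum.cong refl) (simp flip: sum.inter_filter)
    also have "\<dots> = of_nat (\<Sum>k=1..n. card {\<alpha>\<in>GF k. conj_poly k \<alpha> dvd g}) * \<psi> (val g)"
      by (simp add: sum_distrib_right)
    also have "(\<Sum>k=1..n. card {\<alpha>\<in>GF k. conj_poly k \<alpha> dvd g}) = n"
      using monic_rationalD[OF g] by (intro count_conj_poly_dvd)
    finally show "(\<Sum>k=1..n. \<Sum>\<alpha>\<in>GF k. if conj_poly k \<alpha> dvd g then \<psi> (val g) else 0) = of_nat n * \<psi> (val g)" .
  qed
  finally show ?thesis by (simp add: L_coeff_def sum_distrib_left)
qed

end

section \<open>The Riemann hypothesis for the L-function, and the Weil bound\<close>

text \<open>
  The quotient of the coefficients of \<open>z\<close> and \<open>1\<close> is minus the sum of the reciprocals of the roots.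
\<close>

lemma coeff_1_le_if_roots_large:
  fixes p :: "complex poly" and R :: real
  assumes R: "R > 0" and "coeff p 0 \<noteq> 0" and "\<And>z. poly p z = 0 \<Longrightarrow> cmod z * R \<ge> 1"
  shows "cmod (coeff p 1) \<le> degree p * R * cmod (coeff p 0)"
  using assms(2,3)
proof (induction "degree p" arbitrary: p)
  case 0
  then show ?case by (simp add: coeff_eq_0)
next
  case (Suc n)
  have "\<not> constant (poly p)" using Suc.hyps(2) by (simp add: constant_degree)
  then obtain z where z: "poly p z = 0" using fundamental_theorem_of_algebra by blast
  then obtain h where h: "p = [:-z, 1:] * h" by (metis poly_eq_0_iff_dvd dvdE)
  have h0: "h \<noteq> 0" using Suc.prems h by auto
  have deg: "degree p = Suc (degree h)" unfolding h using h0 by (subst degree_mult_eq) auto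
  have c0: "coeff p 0 = - z * coeff h 0" and c1: "coeff p 1 = coeff h 0 - z * coeff h 1"
    by (simp_all add: h)
  have zR: "cmod z * R \<ge> 1" using Suc.prems z by blast
  have "cmod (coeff h 1) \<le> degree h * R * cmod (coeff h 0)"
  proof (rule Suc.hyps(1))
    show "coeff h 0 \<noteq> 0" using Suc.prems c0 by auto
    show "1 \<le> cmod z' * R" if "poly h z' = 0" for z' using Suc.prems(2)[of z'] that by (simp add: h)
  qed (use deg Suc.hyps(2) in simp)
  then have "cmod z * cmod (coeff h 1) \<le> cmod z * (degree h * R * cmod (coeff h 0))"
    by (intro mult_left_mono) auto
  moreover have "1 * cmod (coeff h 0) \<le> cmod z * R * cmod (coeff h 0)" using zR by (intro mult_right_mono) auto
  moreover have "cmod (coeff p 1) \<le> cmod (coeff h 0) + cmod z * cmod (coeff h 1)"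
    unfolding c1 by (metis norm_mult norm_triangle_ineq4)
  ultimately show ?case
    by (simp add: deg c0 norm_mult algebra_simps)
qed

text \<open>
  Let \<open>L(z) = \<Sum> c\<^sub>n z\<^sup>n\<close>, a polynomial, and \<open>G(z) = \<Sum> S\<^sub>n z\<^sup>n\<close>, which converges for \<open>\<bar>z\<bar> < 1/R\<close>. The recursion says
  that \<open>z L'(z) = G(z) L(z)\<close>. At a zero of \<open>L\<close> in the disc, the left-hand side would vanish to
  a lower order than the right-hand side. Hence all zeros satisfy \<open>\<bar>z\<bar> \<ge> 1/R\<close>, which bounds the coefficient \<open>c\<^sub>1 = S\<^sub>1\<close>.
\<close>

lemma power_sum_bound:
  fixes c S :: "nat \<Rightarrow> complex" and R C :: real and m :: nat
  assumes c0: "c 0 = 1" and cm: "\<And>n. n \<ge> m \<Longrightarrow> c n = 0"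
    and newton: "\<And>n. of_nat n * c n = (\<Sum>k=1..n. S k * c (n - k))"
    and R: "R > 0" and S: "\<And>k. k \<ge> 1 \<Longrightarrow> cmod (S k) \<le> C * R ^ k"
  shows "cmod (S 1) \<le> m * R"
proof -
  define p where "p = (\<Sum>n<m. monom (c n) n)"
  have coeff_p: "coeff p n = c n" for n
    using cm[of n] by (auto simp: p_def coeff_sum if_distrib[of "\<lambda>x. x = _"] sum.delta)
  define S' where "S' = (\<lambda>k. if k = 0 then 0 else S k)"
  define G where "G = (\<lambda>w. \<Sum>k. S' k * w ^ k)"
  have C0: "C \<ge> 0"
    using S[of 1] R by (metis le_refl norm_ge_zero order_trans power_one_right zero_le_mult_iff not_le)
  have S': "cmod (S' k) \<le> C * R ^ k" for k using S[of k] C0 R by (auto simp: S'_def)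
  have summable_S: "summable (\<lambda>k. cmod (S' k * w ^ k))" if w: "cmod w * R < 1" for w
  proof (rule summable_comparison_test')
    show "summable (\<lambda>k. C * (R * cmod w) ^ k)"
      using w R by (intro summable_mult summable_geometric) (simp add: mult.commute abs_mult)
    show "norm (cmod (S' k * w ^ k)) \<le> C * (R * cmod w) ^ k" if "k \<ge> 0" for k
      using mult_right_mono[OF S'[of k], of "cmod w ^ k"]
      by (simp add: norm_mult norm_power power_mult_distrib mult.assoc)
  qed
  have ode: "w * poly (pderiv p) w = G w * poly p w" if w: "cmod w * R < 1" for w
  proof -
    have cs: "(\<lambda>k. c k * w ^ k) sums (\<Sum>k<m. c k * w ^ k)"
      by (rule sums_finite) (use cm in auto)
    have cn: "summable (\<lambda>k. cmod (c k * w ^ k))"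
      by (rule summable_finite[of "{..<m}"]) (use cm in auto)
    have pw: "poly p w = (\<Sum>k<m. c k * w ^ k)" by (simp add: p_def poly_sum poly_monom)
    have "(\<lambda>n. \<Sum>i\<le>n. (S' i * w ^ i) * (c (n - i) * w ^ (n - i))) sums (G w * (\<Sum>k. c k * w ^ k))"
      unfolding G_def by (rule Cauchy_product_sums[OF summable_S[OF w] cn])
    moreover have "(\<Sum>i\<le>n. (S' i * w ^ i) * (c (n - i) * w ^ (n - i))) = of_nat n * c n * w ^ n" for n
    proof -
      have "(\<Sum>i\<le>n. (S' i * w ^ i) * (c (n - i) * w ^ (n - i))) = (\<Sum>i\<le>n. S' i * c (n - i) * w ^ n)"
      proof (intro sum.cong refl)
        fix i assume "i \<in> {..n}"
        then have "w ^ n = w ^ i * w ^ (n - i)" by (simp flip: power_add)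
        then show "(S' i * w ^ i) * (c (n - i) * w ^ (n - i)) = S' i * c (n - i) * w ^ n" by simp
      qed
      also have "\<dots> = (\<Sum>i\<in>insert 0 {1..n}. S' i * c (n - i) * w ^ n)"
        by (rule arg_cong[of _ _ "sum _"]) auto
      also have "\<dots> = (\<Sum>i=1..n. S i * c (n - i) * w ^ n)"
        by (simp add: S'_def)
      also have "\<dots> = of_nat n * c n * w ^ n" by (simp add: newton sum_distrib_right)
      finally show ?thesis .
    qed
    ultimately have "(\<lambda>n. of_nat n * c n * w ^ n) sums (G w * poly p w)"
      using sums_unique[OF cs] pw by simp
    moreover have "(\<lambda>n. of_nat n * c n * w ^ n) sums (\<Sum>n<m. of_nat n * c n * w ^ n)"
      by (rule sums_finite) (use cm in auto)
    moreover have "w * poly (pderiv p) w = (\<Sum>n<m. of_nat n * c n * w ^ n)"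
    proof -
      have "w * (of_nat n * c n * w ^ (n - 1)) = of_nat n * c n * w ^ n" for n by (cases n) auto
      moreover have "pderiv p = (\<Sum>n<m. monom (of_nat n * c n) (n - 1))"
        by (simp add: p_def pderiv_sum pderiv_monom)
      ultimately show ?thesis by (simp only: poly_sum poly_monom sum_distrib_left)
    qed
    ultimately show ?thesis using sums_unique2 by metis
  qed
  have roots: "cmod z * R \<ge> 1" if z: "poly p z = 0" for z
  proof (rule ccontr)
    assume "\<not> cmod z * R \<ge> 1"
    then have zR: "cmod z < 1 / R" using R by (simp add: field_simps)
    have p0: "p \<noteq> 0" using coeff_p[of 0] c0 by auto
    have z0: "z \<noteq> 0" using z coeff_p[of 0] c0 by (auto simp: poly_0_coeff_0)
    obtain k where k: "order z p = Suc k" using z p0 by (metis order_root not0_implies_Suc)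
    obtain h where h: "p = [:-z, 1:] ^ Suc k * h" "\<not> [:-z, 1:] dvd h"
      using order_decomp[OF p0, of z] k by auto
    then have hz: "poly h z \<noteq> 0" by (simp add: poly_eq_0_iff_dvd)
    have pd: "pderiv p = [:-z, 1:] ^ k * (smult (of_nat (Suc k)) h + [:-z, 1:] * pderiv h)"
      unfolding h(1) pderiv_mult pderiv_power_Suc by (simp add: pderiv_pCons algebra_simps)
    \<comment> \<open>\<open>A\<close> and \<open>B\<close> are the two sides of the differential equation divided by \<open>(w - z)\<^sup>k\<close>; they agree near the
      zero \<open>z\<close>, hence at \<open>z\<close>, where only \<open>B\<close> vanishes.\<close>
    define A where "A = (\<lambda>w. w * (of_nat (Suc k) * poly h w + (w - z) * poly (pderiv h) w))"
    define B where "B = (\<lambda>w. G w * ((w - z) * poly h w))"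
    have AB: "A w = B w" if w: "w \<noteq> z" "cmod w * R < 1" for w
    proof -
      have e1: "poly (pderiv p) w
          = (w - z) ^ k * (of_nat (Suc k) * poly h w + (w - z) * poly (pderiv h) w)"
        unfolding pd by (simp add: poly_power left_diff_distrib)
      have e2: "poly p w = (w - z) ^ k * ((w - z) * poly h w)"
        by (subst h(1)) (simp add: poly_power algebra_simps)
      have "(w - z) ^ k * A w = (w - z) ^ k * B w"
        using ode[OF w(2), unfolded e1 e2] unfolding A_def B_def by (simp only: mult_ac)
      then show ?thesis using w by simp
    qed
    define \<rho> where "\<rho> = (cmod z + 1 / R) / 2"
    have \<rho>: "cmod z < \<rho>" "\<rho> < 1 / R" "\<rho> \<ge> 0" using zR norm_ge_zero[of z] unfolding \<rho>_def by argo+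
    have contG: "isCont G z" unfolding G_def
    proof (rule isCont_powser)
      have "cmod (of_real \<rho>) * R < 1" using \<rho> R by (simp add: field_simps)
      then show "summable (\<lambda>n. S' n * of_real \<rho> ^ n)" 
        by (rule summable_norm_cancel[OF summable_S])
      show "cmod z < cmod (of_real \<rho>)" using \<rho> by simp
    qed
    have "isCont A z" unfolding A_def by (intro continuous_intros)
    then have lA: "A \<midarrow>z\<rightarrow> A z" by (simp add: isCont_def)
    have "isCont B z" unfolding B_def by (intro continuous_intros contG)
    then have lB: "B \<midarrow>z\<rightarrow> B z" by (simp add: isCont_def)
    have "eventually (\<lambda>w. A w = B w) (at z)"
      unfolding eventually_at
    proof (intro exI[of _ "1 / R - cmod z"] conjI ballI impI)
      fix w assume "w \<noteq> z \<and> dist w z < 1 / R - cmod z"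
      then have "w \<noteq> z" "cmod w < 1 / R"
        using norm_triangle_ineq2[of w z] by (auto simp: dist_norm)
      then show "A w = B w" using R by (intro AB) (auto simp: field_simps)
    qed (use zR in auto)
    then have "B \<midarrow>z\<rightarrow> A z" using lA by (rule tendsto_cong[THEN iffD1])
    then have "A z = B z" using lB LIM_unique by blast
    then show False using z0 hz by (simp add: A_def B_def del: of_nat_Suc)
  qed
  have "S 1 = c 1" using newton[of 1] c0 by simp
  also have "\<dots> = coeff p 1" by (simp add: coeff_p)
  finally have "cmod (S 1) = cmod (coeff p 1)" by simp
  also have "\<dots> \<le> degree p * R * cmod (coeff p 0)"
    using coeff_p[of 0] c0 by (intro coeff_1_le_if_roots_large R roots) auto
  also have "\<dots> = degree p * R" using coeff_p[of 0] c0 by simp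
  also have "\<dots> \<le> m * R"
  proof -
    have "degree p \<le> m" using cm coeff_p by (intro degree_le) auto
    then show ?thesis using R by simp
  qed
  finally show ?thesis .
qed

lemma (in kummer_sum) weil_abstract: "cmod (\<Sum>\<alpha>\<in>GF 1. \<psi> (F \<alpha>)) \<le> card A * sqrt q"
proof -
  obtain C where C: "\<And>n. n \<ge> 1 \<Longrightarrow> cmod (char_sum n) \<le> C * sqrt (real q) ^ n" using char_sum_bound by blast
  have "cmod (char_sum 1) \<le> card A * sqrt q"
    using L_coeff_0 L_coeff_vanish newton C q_pos by (intro power_sum_bound[of L_coeff "card A" char_sum "sqrt q" C]) auto
  then show ?thesis by (simp add: char_sum_def norm_exp_def)
qed

text \<open>
  The bound is a predicate of \<open>p\<close> because the choice of the prime \<open>generic_prime\<close> below refers to it.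
\<close>

definition weil_bound :: "nat \<Rightarrow> bool" where
  "weil_bound p \<longleftrightarrow> (\<forall>\<chi> T e t0. dirichlet_character p \<chi> \<longrightarrow> \<chi> \<noteq> principal_character p \<longrightarrow>
     finite T \<longrightarrow> inj_on (\<lambda>t. t mod int p) T \<longrightarrow> t0 \<in> T \<longrightarrow> e t0 = (1::nat) \<longrightarrow> (\<forall>t\<in>T. e t \<ge> 1) \<longrightarrow>
     cmod (\<Sum>x=0..<int p. \<chi> (\<Prod>t\<in>T. (t - x) ^ e t)) \<le> card T * sqrt p)"

lemma dirichlet_character_1: "dirichlet_character m \<chi> \<Longrightarrow> \<chi> 1 = 1"
  unfolding dirichlet_character_def by (metis coprime_1_left mult_cancel_right1 mult_1)

lemma dirichlet_character_cong:
  assumes "dirichlet_character m \<chi>" "[a = b] (mod int m)" shows "\<chi> a = \<chi> b"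
proof -
  have per: "\<chi> (a + int k * int m) = \<chi> a" for a k
  proof (induction k)
    case (Suc k)
    have "\<chi> (a + int (Suc k) * int m) = \<chi> ((a + int k * int m) + int m)" by (simp add: algebra_simps)
    then show ?case using assms(1) Suc by (simp add: dirichlet_character_def)
  qed simp
  have per': "\<chi> (a + k * int m) = \<chi> a" for a k
    using per[of a "nat k"] per[of "a + k * int m" "nat (- k)"] by (cases "k \<ge> 0") auto
  obtain k where "b = a + int m * k" using assms(2) by (metis cong_iff_lin)
  then show ?thesis using per'[of a k] by (simp add: mult.commute)
qed

lemma nonprincipal_ex:
  assumes "dirichlet_character m \<chi>" "\<chi> \<noteq> principal_character m"
  shows "\<exists>a. coprime a (int m) \<and> \<chi> a \<noteq> 1"
proof -
  obtain a where a: "\<chi> a \<noteq> principal_character m a" using assms(2) by blast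
  have "\<not> coprime a (int m) \<Longrightarrow> \<chi> a = 0" using assms(1) by (simp add: dirichlet_character_def)
  then show ?thesis using a by (intro exI[of _ a]) (auto simp: principal_character_def split: if_splits)
qed

lemma (in prime_char_closed) weil_bound_char: "weil_bound q"
  unfolding weil_bound_def
proof (intro allI impI)
  fix \<chi> and T :: "int set" and e :: "int \<Rightarrow> nat" and t0
  assume \<chi>: "dirichlet_character q \<chi>" "\<chi> \<noteq> principal_character q"
    and T: "finite T" "inj_on (\<lambda>t. t mod int q) T" "t0 \<in> T" "e t0 = 1" "\<forall>t\<in>T. e t \<ge> 1"
  have eq_iff: "(of_int a :: 'a) = of_int b \<longleftrightarrow> [a = b] (mod int q)" for a b
    by (simp add: of_int_eq_iff_cong_CHAR CHAR_eq_q)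
  define rep :: "'a \<Rightarrow> int" where "rep x = (SOME t. of_int t = x)" for x
  have rep: "of_int (rep (of_int t)) = (of_int t :: 'a)" for t
    unfolding rep_def by (rule someI[of _ t]) simp
  define \<psi> where "\<psi> = (\<lambda>x. \<chi> (rep x))"
  have \<psi>: "\<psi> (of_int t) = \<chi> t" for t
    unfolding \<psi>_def using rep[of t] by (intro dirichlet_character_cong[OF \<chi>(1)]) (simp only: eq_iff)
  have GF_int: "(GF 1 :: 'a set) = of_int ` {0..<int q}"
  proof -
    have "{0..<int q} = int ` {..<q}" using image_int_atLeastLessThan[of 0 q] by (simp add: lessThan_atLeast0)
    then show ?thesis using GF_1_eq by (simp add: image_image)
  qed
  have of_int_GF: "(of_int t :: 'a) \<in> GF 1" for t
  proof -
    have "(of_int t :: 'a) = of_int (t mod int q)" by (simp only: eq_iff) simp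
    then show ?thesis using q_pos unfolding GF_int by (intro image_eqI[of _ _ "t mod int q"]) auto
  qed
  have FFE: "\<exists>t. x = of_int t" if "x \<in> GF 1" for x :: 'a using that GF_int by auto
  have injT: "inj_on (of_int :: int \<Rightarrow> 'a) T"
    using T(2) by (auto simp: inj_on_def eq_iff cong_def)
  define e' where "e' = (\<lambda>x::'a. e (inv_into T of_int x))"
  have e': "e' (of_int t) = e t" if "t \<in> T" for t using that injT by (simp add: e'_def)
  interpret kummer_sum K q \<psi> "of_int ` T" e' "of_int t0"
  proof unfold_locales
    show "\<psi> (x * y) = \<psi> x * \<psi> y" if xy: "x \<in> GF 1" "y \<in> GF 1" for x y
    proof -
      obtain s t where st: "x = of_int s" "y = of_int t" using FFE[OF xy(1)] FFE[OF xy(2)] by blast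
      have "\<psi> (of_int (s * t)) = \<psi> x * \<psi> y"
        using \<chi>(1) unfolding st \<psi> by (simp add: dirichlet_character_def)
      then show ?thesis by (simp add: st)
    qed
    show "\<psi> 0 = 0" using \<psi>[of 0] \<chi>(1) q_gt_1 by (simp add: dirichlet_character_def)
    show "\<psi> 1 = 1" using \<psi>[of 1] dirichlet_character_1[OF \<chi>(1)] by simp
    obtain a where a: "coprime a (int q)" "\<chi> a \<noteq> 1" using nonprincipal_ex[OF \<chi>] by blast
    have "(of_int a :: 'a) \<noteq> of_int 0"
    proof
      assume "(of_int a :: 'a) = of_int 0"
      then have "\<chi> a = \<chi> 0" by (intro dirichlet_character_cong[OF \<chi>(1)]) (simp only: eq_iff)
      moreover have "\<chi> 0 = 0" "\<chi> a \<noteq> 0"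
        using \<chi>(1) a(1) q_gt_1 by (simp_all add: dirichlet_character_def)
      ultimately show False by simp
    qed
    then show "\<exists>x\<in>GF 1. x \<noteq> 0 \<and> \<psi> x \<noteq> 1" using a \<psi> of_int_GF by (intro bexI[of _ "of_int a"]) auto
    show "1 \<le> e' a" if "a \<in> of_int ` T" for a using that e' T(5) by auto
  qed (use T e' of_int_GF in auto)
  have F_eq: "F (of_int x) = of_int (\<Prod>t\<in>T. (t - x) ^ e t)" for x
    unfolding F_def using injT by (simp add: prod.reindex e')
  have inj: "inj_on (of_int :: int \<Rightarrow> 'a) {0..<int q}"
    by (auto simp: inj_on_def eq_iff cong_def)
  have "(\<Sum>\<alpha>\<in>GF 1. \<psi> (F \<alpha>)) = (\<Sum>x=0..<int q. \<psi> (F (of_int x)))"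
    unfolding GF_int by (rule sum.reindex[OF inj, unfolded comp_def])
  also have "\<dots> = (\<Sum>x=0..<int q. \<chi> (\<Prod>t\<in>T. (t - x) ^ e t))" by (simp only: F_eq \<psi>)
  finally show "cmod (\<Sum>x=0..<int q. \<chi> (\<Prod>t\<in>T. (t - x) ^ e t)) \<le> card T * sqrt q"
    using weil_abstract injT by (simp add: card_image)
qed

text \<open>
  A type cannot depend on a variable \<open>p\<close>, but it may depend on a constant. So a single prime is fixed
  that is a counterexample to the bound if there is any. Proving the bound for this prime, whose residue
  field is a type, proves it for all primes.
\<close>

definition generic_prime :: nat where
  "generic_prime = (SOME p. prime p \<and> (weil_bound p \<longrightarrow> (\<forall>r. prime r \<longrightarrow> weil_bound r)))"

lemma generic_prime:
  "prime generic_prime" "weil_bound generic_prime \<Longrightarrow> prime r \<Longrightarrow> weil_bound r"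
proof -
  have "\<exists>p::nat. prime p \<and> (weil_bound p \<longrightarrow> (\<forall>r. prime r \<longrightarrow> weil_bound r))"
    using two_is_prime_nat by blast
  then have "prime generic_prime \<and> (weil_bound generic_prime \<longrightarrow> (\<forall>r. prime r \<longrightarrow> weil_bound r))"
    unfolding generic_prime_def by (rule someI_ex)
  then show "prime generic_prime" "weil_bound generic_prime \<Longrightarrow> prime r \<Longrightarrow> weil_bound r" by auto
qed

typedef generic_residue = "{..<generic_prime}"
  using generic_prime(1) prime_gt_0_nat by auto

lemma card_generic_residue: "CARD(generic_residue) = generic_prime"
proof -
  interpret type_definition Rep_generic_residue Abs_generic_residue "{..<generic_prime}"
    by (rule type_definition_generic_residue)
  show ?thesis using card by simp
qed

instance generic_residue :: prime_card
  by standard (simp add: card_generic_residue generic_prime(1))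

theorem weil: "prime p \<Longrightarrow> weil_bound p"
proof -
  interpret prime_char_closed "TYPE(generic_residue mod_ring alg_closure)" generic_prime
    by standard (simp_all add: card_generic_residue generic_prime(1))
  show "prime p \<Longrightarrow> weil_bound p" using weil_bound_char generic_prime(2) by blast
qed

section \<open>Divisors, and moments of short character sums\<close>

text \<open>
  A divisor of the product is a divisor \<open>p\<^sup>i\<close> of the first factor times a divisor of the second.
\<close>

lemma card_divisors_prime_power_mult:
  assumes "prime (p::nat)" "m > 0"
  shows "card {d. d dvd p ^ k * m} \<le> (k + 1) * card {d. d dvd m}"
proof -
  have fin: "finite {d. d dvd m}" using assms by simp
  have "{d. d dvd p ^ k * m} \<subseteq> (\<lambda>(i, d). p ^ i * d) ` ({..k} \<times> {d. d dvd m})"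
  proof
    fix d assume "d \<in> {d. d dvd p ^ k * m}"
    then obtain a b where ab: "d = a * b" "a dvd p ^ k" "b dvd m" using division_decomp by blast
    then obtain i where "i \<le> k" "a = p ^ i" using assms(1) divides_primepow_nat by blast
    then show "d \<in> (\<lambda>(i, d). p ^ i * d) ` ({..k} \<times> {d. d dvd m})" using ab by force
  qed
  then have "card {d. d dvd p ^ k * m} \<le> card ((\<lambda>(i, d). p ^ i * d) ` ({..k} \<times> {d. d dvd m}))"
    using fin by (intro card_mono) auto
  also have "\<dots> \<le> card ({..k} \<times> {d. d dvd m})" using fin by (intro card_image_le) auto
  finally show ?thesis by (simp add: card_cartesian_product)
qed

text \<open>
  Splitting off prime powers one by one, a prime \<open>p\<close> with \<open>p\<^sup>\<delta> \<ge> 2\<close> costs nothing, since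
  \<open>k + 1 \<le> 2\<^sup>k \<le> p\<^bsup>\<delta>k\<^esup>\<close>; each of the finitely many smaller primes costs a constant factor \<open>C0\<close>.
\<close>

lemma divisor_bound:
  fixes \<delta> :: real assumes \<delta>: "\<delta> > 0"
  shows "\<exists>C\<ge>1. \<forall>n\<ge>1. real (card {d. d dvd (n::nat)}) \<le> C * real n powr \<delta>"
proof -
  define B where "B = nat \<lceil>2 powr (1 / \<delta>)\<rceil>"
  define C0 where "C0 = max 1 (1 / (\<delta> * ln 2))"
  have C0: "C0 \<ge> 1" by (simp add: C0_def)
  have B: "real p powr \<delta> \<ge> 2" if "p \<ge> B" for p
  proof -
    have "2 powr (1 / \<delta>) \<le> real p" using that unfolding B_def by linarith
    then have "(2 powr (1 / \<delta>)) powr \<delta> \<le> real p powr \<delta>" using \<delta> by (intro powr_mono2) auto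
    then show ?thesis using \<delta> by (simp add: powr_powr)
  qed
  have small: "real (k + 1) \<le> C0 * (2 powr \<delta>) ^ k" for k
  proof -
    have "\<delta> * ln 2 * C0 \<ge> 1"
    proof -
      have "\<delta> * ln 2 * (1 / (\<delta> * ln 2)) \<le> \<delta> * ln 2 * C0"
        using \<delta> by (intro mult_left_mono) (auto simp: C0_def)
      then show ?thesis using \<delta> by simp
    qed
    then have "real k * 1 \<le> real k * (\<delta> * ln 2 * C0)" by (intro mult_left_mono) auto
    then have "real (k + 1) \<le> C0 * (1 + \<delta> * ln 2 * real k)" using C0 by (simp add: algebra_simps)
    also have "\<dots> \<le> C0 * exp (\<delta> * ln 2 * real k)"
      using C0 by (intro mult_left_mono) (auto simp: exp_ge_add_one_self)
    also have "exp (\<delta> * ln 2 * real k) = (2 powr \<delta>) ^ k"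
      by (simp add: powr_def mult.commute flip: exp_of_nat_mult)
    finally show ?thesis .
  qed
  have main: "real (card {d. d dvd n}) \<le> C0 ^ card {p. prime p \<and> p < B \<and> p dvd n} * real n powr \<delta>"
    if "n \<ge> 1" for n :: nat
    using that
  proof (induction n rule: less_induct)
    case (less n)
    show ?case
    proof (cases "n = 1")
      case True
      show ?thesis using True one_le_power[OF C0] by simp
    next
      case False
      then obtain p where p: "prime p" "p dvd n" using prime_factor_nat by blast
      define k where "k = multiplicity p n"
      have "n \<noteq> 0" "\<not> is_unit p" using less.prems p(1) by auto
      then obtain m where m: "n = p ^ k * m" "\<not> p dvd m"
        using multiplicity_decompose'[of n p] unfolding k_def by blast
      have k: "k \<ge> 1" using m p by (cases k) auto
      have m1: "m \<ge> 1" using m less.prems by (cases m) auto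
      have p1: "p > 1" using p prime_gt_1_nat by blast
      have "p ^ k > 1" using one_less_power[OF p1, of k] k by simp
      then have mn: "m < n" using m m1 by simp
      define P where "P n = {p. prime p \<and> p < B \<and> p dvd n}" for n :: nat
      have finP: "finite (P n)" for n by (rule finite_subset[of _ "{..<B}"]) (auto simp: P_def)
      have sub: "P m \<subseteq> P n" using m by (auto simp: P_def)
      have npow: "real n powr \<delta> = (real p powr \<delta>) ^ k * real m powr \<delta>"
      proof -
        have "(real p ^ k) powr \<delta> = (real p powr \<delta>) ^ k"
          using p1 by (simp add: powr_powr mult.commute flip: powr_realpow)
        then show ?thesis by (simp add: m(1) powr_mult)
      qed
      have "real (card {d. d dvd n}) \<le> real ((k + 1) * card {d. d dvd m})"
        unfolding m(1) of_nat_le_iff using p m1 by (intro card_divisors_prime_power_mult) auto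
      also have "\<dots> = real (k + 1) * real (card {d. d dvd m})" by (rule of_nat_mult)
      also have "\<dots> \<le> real (k + 1) * (C0 ^ card (P m) * real m powr \<delta>)"
        using less.IH[OF mn m1] by (intro mult_left_mono) (auto simp: P_def)
      also have "\<dots> \<le> C0 ^ card (P n) * real n powr \<delta>"
      proof (cases "p < B")
        case True
        have "insert p (P m) \<subseteq> P n" using sub p True by (auto simp: P_def)
        then have "Suc (card (P m)) \<le> card (P n)"
          using card_mono[OF finP[of n], of "insert p (P m)"] finP m(2) by (simp add: P_def)
        then have c: "C0 ^ Suc (card (P m)) \<le> C0 ^ card (P n)" using C0 by (intro power_increasing) auto
        have "real (k + 1) \<le> C0 * (real p powr \<delta>) ^ k"
        proof -
          have "(2 powr \<delta>) ^ k \<le> (real p powr \<delta>) ^ k"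
            using p1 \<delta> by (intro power_mono powr_mono2) auto
          then show ?thesis using small[of k] C0 by (meson mult_left_mono order_trans zero_le_one)
        qed
        then have "real (k + 1) * (C0 ^ card (P m) * real m powr \<delta>)
          \<le> (C0 * (real p powr \<delta>) ^ k) * (C0 ^ card (P m) * real m powr \<delta>)"
          using C0 by (intro mult_right_mono) auto
        also have "\<dots> = C0 ^ Suc (card (P m)) * real n powr \<delta>" by (simp add: npow mult_ac)
        also have "\<dots> \<le> C0 ^ card (P n) * real n powr \<delta>" using c by (intro mult_right_mono) auto
        finally show ?thesis .
      next
        case False
        have c: "C0 ^ card (P m) \<le> C0 ^ card (P n)"
          using C0 card_mono[OF finP sub] by (intro power_increasing) auto
        have "k + 1 \<le> 2 ^ k" by (induction k) auto
        then have "real (k + 1) \<le> 2 ^ k" by (metis of_nat_le_iff of_nat_numeral of_nat_power)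
        also have "\<dots> \<le> (real p powr \<delta>) ^ k" using B[of p] False by (intro power_mono) auto
        finally have "real (k + 1) * (C0 ^ card (P m) * real m powr \<delta>)
          \<le> (real p powr \<delta>) ^ k * (C0 ^ card (P m) * real m powr \<delta>)"
          using C0 by (intro mult_right_mono) auto
        also have "\<dots> = C0 ^ card (P m) * real n powr \<delta>" by (simp add: npow)
        also have "\<dots> \<le> C0 ^ card (P n) * real n powr \<delta>" using c by (intro mult_right_mono) auto
        finally show ?thesis .
      qed
      finally show ?thesis by (simp add: P_def)
    qed
  qed
  have "real (card {d. d dvd n}) \<le> C0 ^ B * real n powr \<delta>" if n: "n \<ge> 1" for n :: nat
  proof -
    have "card {p. prime p \<and> p < B \<and> p dvd n} \<le> card {..<B}" by (intro card_mono) auto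
    then have "C0 ^ card {p. prime p \<and> p < B \<and> p dvd n} \<le> C0 ^ B" using C0 by (intro power_increasing) auto
    then have "C0 ^ card {p. prime p \<and> p < B \<and> p dvd n} * real n powr \<delta> \<le> C0 ^ B * real n powr \<delta>"
      by (rule mult_right_mono) simp
    then show ?thesis using main[OF n] by linarith
  qed
  moreover have "C0 ^ B \<ge> 1" using C0 by (rule one_le_power)
  ultimately show ?thesis by blast
qed

lemma chi_mult: "dirichlet_character m \<chi> \<Longrightarrow> \<chi> (a * b) = \<chi> a * \<chi> b"
  by (simp add: dirichlet_character_def)

lemma chi_power: "dirichlet_character m \<chi> \<Longrightarrow> \<chi> (a ^ k) = \<chi> a ^ k"
  by (induction k) (auto simp: dirichlet_character_1 chi_mult)

lemma chi_prod: "dirichlet_character m \<chi> \<Longrightarrow> \<chi> (\<Prod>i\<in>I. f i) = (\<Prod>i\<in>I. \<chi> (f i))"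
  by (induction I rule: infinite_finite_induct) (auto simp: dirichlet_character_1 chi_mult)

lemma chi_fermat:
  assumes \<chi>: "dirichlet_character p \<chi>" and p: "prime p" and a: "coprime a (int p)"
  shows "\<chi> a ^ (p - 1) = 1"
proof -
  define b where "b = nat (a mod int p)"
  have b: "int b = a mod int p" using prime_gt_0_nat[OF p] by (simp add: b_def)
  have ab: "\<chi> a = \<chi> (int b)" by (rule dirichlet_character_cong[OF \<chi>]) (simp add: b cong_def)
  have "\<not> p dvd b"
  proof
    assume "p dvd b"
    then have "int p dvd a mod int p" using b by (metis int_dvd_int_iff)
    then have "int p dvd a" by (simp add: dvd_mod_iff)
    then have "is_unit (int p)" by (rule coprime_common_divisor[OF a _ dvd_refl])
    then show False using prime_gt_1_nat[OF p] by simp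
  qed
  then have "[b ^ (p - 1) = 1] (mod p)" by (rule fermat_theorem[OF p])
  then have "[int b ^ (p - 1) = 1] (mod int p)" by (metis cong_int_iff of_nat_1 of_nat_power)
  then have "\<chi> (int b ^ (p - 1)) = \<chi> 1" by (rule dirichlet_character_cong[OF \<chi>])
  then show ?thesis by (simp add: ab chi_power[OF \<chi>] dirichlet_character_1[OF \<chi>])
qed

lemma chi_norm:
  assumes "dirichlet_character p \<chi>" "prime p" "coprime a (int p)"
  shows "cmod (\<chi> a) = 1"
proof -
  have "cmod (\<chi> a) ^ (p - 1) = 1" using chi_fermat[OF assms] by (metis norm_one norm_power)
  then show ?thesis using power_eq_iff_eq_base[of "p - 1" "cmod (\<chi> a)" 1] prime_gt_1_nat[OF assms(2)] by simp
qed

lemma chi_norm_le_1: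
  assumes "dirichlet_character p \<chi>" "prime p" shows "cmod (\<chi> a) \<le> 1"
proof (cases "coprime a (int p)")
  case False
  then have "\<chi> a = 0" using assms(1) by (simp add: dirichlet_character_def)
  then show ?thesis by simp
qed (use chi_norm[OF assms, of a] in simp)

lemma cnj_chi:
  assumes \<chi>: "dirichlet_character p \<chi>" and p: "prime p" "p \<ge> 3"
  shows "cnj (\<chi> a) = \<chi> (a ^ (p - 2))"
proof (cases "coprime a (int p)")
  case True
  have "\<chi> a * \<chi> a ^ (p - 2) = 1"
  proof -
    have "p - 1 = Suc (p - 2)" using p(2) by simp
    then show ?thesis using chi_fermat[OF \<chi> p(1) True] by simp
  qed
  moreover have "\<chi> a * cnj (\<chi> a) = 1" using chi_norm[OF \<chi> p(1) True] by (simp add: complex_norm_square[symmetric])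
  ultimately have "\<chi> a * cnj (\<chi> a) = \<chi> a * \<chi> a ^ (p - 2)" by simp
  moreover have "\<chi> a \<noteq> 0" using chi_norm[OF \<chi> p(1) True] by auto
  ultimately show ?thesis by (simp add: chi_power[OF \<chi>])
next
  case False
  then have "\<chi> a = 0" using \<chi> by (simp add: dirichlet_character_def)
  then show ?thesis using p by (simp add: chi_power[OF \<chi>] power_0_left)
qed

lemma dirichlet_character_cnj:
  "dirichlet_character m \<chi> \<Longrightarrow> dirichlet_character m (\<lambda>a. cnj (\<chi> a))"
  by (simp add: dirichlet_character_def)

text \<open>
  Collecting the factors with equal \<open>g i\<close> turns the product into a product over distinct points, as
  required by the Weil bound.
\<close>

lemma weil_product:
  assumes \<chi>: "dirichlet_character p \<chi>" "\<chi> \<noteq> principal_character p" and p: "prime p"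
    and S: "finite S" and g: "\<And>i. i \<in> S \<Longrightarrow> g i \<in> {1..int V}" and V: "V \<le> p"
    and m: "\<And>i. i \<in> S \<Longrightarrow> m i \<ge> (1::nat)"
    and i0: "i0 \<in> S" "m i0 = 1" "\<And>i. i \<in> S \<Longrightarrow> i \<noteq> i0 \<Longrightarrow> g i \<noteq> g i0"
  shows "cmod (\<Sum>x=0..<int p. \<Prod>i\<in>S. \<chi> ((g i - x) ^ m i)) \<le> card S * sqrt p"
proof -
  define T where "T = g ` S"
  define e where "e t = (\<Sum>i\<in>{i\<in>S. g i = t}. m i)" for t
  have "(\<Prod>i\<in>S. \<chi> ((g i - x) ^ m i)) = \<chi> (\<Prod>t\<in>T. (t - x) ^ e t)" for x
  proof -
    have "(\<Prod>i\<in>S. (g i - x) ^ m i) = (\<Prod>t\<in>T. \<Prod>i\<in>{i\<in>S. g i = t}. (g i - x) ^ m i)"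
      unfolding T_def by (rule prod.image_gen[OF S])
    also have "\<dots> = (\<Prod>t\<in>T. (t - x) ^ e t)"
      by (intro prod.cong refl) (simp add: e_def power_sum)
    finally show ?thesis by (simp add: chi_prod[OF \<chi>(1), symmetric])
  qed
  moreover have "cmod (\<Sum>x=0..<int p. \<chi> (\<Prod>t\<in>T. (t - x) ^ e t)) \<le> card T * sqrt p"
  proof (rule weil[OF p, unfolded weil_bound_def, rule_format, OF \<chi>])
    show "finite T" using S by (simp add: T_def)
    show "inj_on (\<lambda>t. t mod int p) T"
    proof (rule inj_onI)
      fix s t assume st: "s \<in> T" "t \<in> T" "s mod int p = t mod int p"
      have T: "1 \<le> t \<and> t \<le> int p" if t: "t \<in> T" for t
      proof -
        obtain i where "i \<in> S" "t = g i" using t unfolding T_def by blast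
        then show ?thesis using g[of i] V by simp
      qed
      have "\<bar>s - t\<bar> < int p" using T[OF st(1)] T[OF st(2)] by linarith
      moreover have "int p dvd s - t" using st(3) by (simp add: mod_eq_dvd_iff)
      ultimately show "s = t" using zdvd_not_zless[of "\<bar>s - t\<bar>" "int p"] by (cases "s = t") auto
    qed
    show "g i0 \<in> T" using i0 by (simp add: T_def)
    have "{i\<in>S. g i = g i0} = {i0}" using i0 by auto
    then show "e (g i0) = 1" using i0 by (simp add: e_def)
    show "1 \<le> e t" if "t \<in> T" for t
    proof -
      obtain i where i: "i \<in> S" "g i = t" using \<open>t \<in> T\<close> by (auto simp: T_def)
      have "m i \<le> e t" unfolding e_def using S i by (intro member_le_sum) auto
      then show ?thesis using m[OF i(1)] by linarith
    qed
  qed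
  moreover have "real (card T) * sqrt p \<le> real (card S) * sqrt p"
    using card_image_le[OF S, of g] by (intro mult_right_mono) (auto simp: T_def)
  ultimately show ?thesis by simp
qed

text \<open>
  A function on \<open>2r\<close> points that takes each of its values at least twice has at most \<open>r\<close> values. So it is
  the composition of a map from \<open>2r\<close> points to \<open>r\<close> points and a map from \<open>r\<close> points to \<open>{1..V}\<close>.
\<close>

lemma card_no_unique_value:
  fixes r V :: nat
  assumes V: "V \<ge> 1" and r: "r \<ge> 1"
  shows "card {g\<in>PiE {..<2*r} (\<lambda>_. {1..int V}). \<forall>i<2*r. \<exists>j<2*r. j \<noteq> i \<and> g j = g i} \<le> r ^ (2 * r) * V ^ r"
    (is "card ?B \<le> _")
proof -
  define S where "S = {..<2*r}"
  define Z where "Z = PiE {..<r} (\<lambda>_. {1..int V}) \<times> PiE S (\<lambda>_. {..<r})"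
  have finZ: "finite Z" unfolding Z_def S_def by (intro finite_cartesian_product finite_PiE) auto
  have "?B \<subseteq> (\<lambda>(h, k). restrict (\<lambda>i. h (k i)) S) ` Z"
  proof
    fix g assume g: "g \<in> ?B"
    define T where "T = g ` S"
    have finT: "finite T" by (simp add: T_def S_def)
    have "2 * card T = (\<Sum>t\<in>T. 2)" by simp
    also have "\<dots> \<le> (\<Sum>t\<in>T. card {i\<in>S. g i = t})"
    proof (rule sum_mono)
      fix t assume "t \<in> T"
      then obtain i where i: "i \<in> S" "g i = t" by (auto simp: T_def)
      then obtain j where j: "j \<in> S" "j \<noteq> i" "g j = t" using g by (auto simp: S_def)
      have "card {i, j} \<le> card {i\<in>S. g i = t}" using i j by (intro card_mono) (auto simp: S_def)
      then show "2 \<le> card {i\<in>S. g i = t}" using j by simp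
    qed
    also have "\<dots> = card S"
      using sum.image_gen[of S "\<lambda>_. 1::nat" g] by (simp add: T_def S_def)
    finally have cT: "card T \<le> r" by (simp add: S_def)
    obtain h0 where h0: "bij_betw h0 {0..<card T} T" using ex_bij_betw_nat_finite[OF finT] by blast
    \<comment> \<open>When there are fewer than \<open>r\<close> values, the unused points are mapped to the arbitrary element 1.\<close>
    define h where "h = restrict (\<lambda>j. if j < card T then h0 j else 1) {..<r}"
    define k where "k = restrict (\<lambda>i. inv_into {0..<card T} h0 (g i)) S"
    have TV: "T \<subseteq> {1..int V}" using g by (auto simp: T_def S_def PiE_def Pi_def)
    have inv: "inv_into {0..<card T} h0 t < card T" "h0 (inv_into {0..<card T} h0 t) = t" if "t \<in> T" for t
    proof -
      have "t \<in> h0 ` {0..<card T}" using h0 that by (simp add: bij_betw_def)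
      then show "inv_into {0..<card T} h0 t < card T" "h0 (inv_into {0..<card T} h0 t) = t"
        using inv_into_into[of t h0 "{0..<card T}"] f_inv_into_f[of t h0 "{0..<card T}"] by auto
    qed
    have hT: "h0 j \<in> {1..int V}" if "j < card T" for j
      using h0 that TV unfolding bij_betw_def by force
    have "h \<in> PiE {..<r} (\<lambda>_. {1..int V})" using hT V by (auto simp: h_def)
    moreover have "k \<in> PiE S (\<lambda>_. {..<r})"
      using inv(1) cT by (auto simp: k_def T_def intro: less_le_trans)
    moreover have "g = restrict (\<lambda>i. h (k i)) S"
    proof
      fix i show "g i = restrict (\<lambda>i. h (k i)) S i"
      proof (cases "i \<in> S")
        case True
        then have "g i \<in> T" by (simp add: T_def)
        then show ?thesis using True inv[of "g i"] cT by (simp add: h_def k_def)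
      next
        case False
        then show ?thesis using g by (auto simp: S_def PiE_def extensional_def)
      qed
    qed
    ultimately show "g \<in> (\<lambda>(h, k). restrict (\<lambda>i. h (k i)) S) ` Z" unfolding Z_def by force
  qed
  then have "card ?B \<le> card ((\<lambda>(h, k). restrict (\<lambda>i. h (k i)) S) ` Z)" using finZ by (intro card_mono) auto
  also have "\<dots> \<le> card Z" using finZ by (rule card_image_le)
  also have "\<dots> = r ^ (2 * r) * V ^ r" by (simp add: Z_def S_def card_cartesian_product card_PiE)
  finally show ?thesis .
qed

text \<open>
  Expanding the power gives a sum over functions \<open>g\<close> from \<open>2r\<close> indices to \<open>{1..V}\<close>, with \<open>\<chi>\<close> at the first
  \<open>r\<close> indices and its complex conjugate, which is \<open>\<chi>\<^bsup>p-2\<^esup>\<close>, at the others. If some value of \<open>g\<close> is attained only once, it is a simple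
  root, and the Weil bound applies to \<open>\<chi>\<close> or to its conjugate. The other functions are few, and are estimated trivially.
\<close>

lemma moment_bound:
  fixes r V :: nat
  assumes \<chi>: "dirichlet_character p \<chi>" "\<chi> \<noteq> principal_character p" and p: "prime p" "p \<ge> 3"
    and V: "V \<ge> 1" "V \<le> p" and r: "r \<ge> 1"
  shows "(\<Sum>x=0..<int p. cmod (\<Sum>t=1..int V. \<chi> (t - x)) ^ (2 * r))
    \<le> real (r ^ (2 * r) * V ^ r) * p + 2 * r * real V ^ (2 * r) * sqrt p"
proof -
  define S where "S = {..<2*r}"
  define P where "P = PiE S (\<lambda>_. {1..int V})"
  define \<phi> where "\<phi> i a = (if i < r then \<chi> a else cnj (\<chi> a))" for i :: nat and a :: int
  define B where "B = {g\<in>P. \<forall>i<2*r. \<exists>j<2*r. j \<noteq> i \<and> g j = g i}"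
  define s where "s g = (\<Sum>x=0..<int p. \<Prod>i\<in>S. \<phi> i (g i - x))" for g
  have finP: "finite P" unfolding P_def S_def by (intro finite_PiE) auto
  have cardP: "card P = V ^ (2 * r)" by (simp add: P_def S_def card_PiE)
  have cardB: "card B \<le> r ^ (2 * r) * V ^ r"
    using card_no_unique_value[OF V(1) r] by (simp add: B_def P_def S_def)
  have expand: "of_real (cmod (\<Sum>t=1..int V. \<chi> (t - x)) ^ (2 * r)) = (\<Sum>g\<in>P. \<Prod>i\<in>S. \<phi> i (g i - x))" for x
  proof -
    define W where "W = (\<Sum>t=1..int V. \<chi> (t - x))"
    have "of_real (cmod W ^ (2 * r)) = (W * cnj W) ^ r"
      by (simp add: power_mult flip: complex_norm_square)
    also have "\<dots> = (\<Prod>i<r. W) * (\<Prod>i<r. cnj W)" by (simp add: power_mult_distrib)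
    also have "\<dots> = (\<Prod>i\<in>S. if i < r then W else cnj W)"
    proof -
      have S_eq: "S = {..<r} \<union> {r..<2*r}" by (auto simp: S_def)
      have "(\<Prod>i\<in>S. if i < r then W else cnj W)
        = (\<Prod>i<r. if i < r then W else cnj W) * (\<Prod>i=r..<2*r. if i < r then W else cnj W)"
        unfolding S_eq by (rule prod.union_disjoint) auto
      also have "(\<Prod>i<r. if i < r then W else cnj W) = (\<Prod>i<r. W)" by (intro prod.cong) auto
      also have "(\<Prod>i=r..<2*r. if i < r then W else cnj W) = (\<Prod>i=r..<2*r. cnj W)"
        by (intro prod.cong) auto
      finally show ?thesis by simp
    qed
    also have "\<dots> = (\<Prod>i\<in>S. \<Sum>t=1..int V. \<phi> i (t - x))"
      by (intro prod.cong refl) (simp add: \<phi>_def W_def)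
    also have "\<dots> = (\<Sum>g\<in>P. \<Prod>i\<in>S. \<phi> i (g i - x))"
      unfolding P_def by (rule prod_sum_PiE) (auto simp: S_def)
    finally show ?thesis by (simp add: W_def)
  qed
  define M where "M = (\<Sum>x=0..<int p. cmod (\<Sum>t=1..int V. \<chi> (t - x)) ^ (2 * r))"
  have M_eq: "complex_of_real M = (\<Sum>g\<in>P. s g)"
    unfolding M_def of_real_sum expand s_def by (rule sum.swap)
  have "M \<ge> 0" unfolding M_def by (intro sum_nonneg) auto
  then have "M = cmod (complex_of_real M)" by simp
  also have "\<dots> = cmod (\<Sum>g\<in>P. s g)" by (simp only: M_eq)
  also have "\<dots> \<le> (\<Sum>g\<in>P. cmod (s g))" by (rule norm_sum)
  also have "\<dots> = (\<Sum>g\<in>B. cmod (s g)) + (\<Sum>g\<in>P-B. cmod (s g))"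
    using sum.subset_diff[of B P "\<lambda>g. cmod (s g)"] finP by (simp add: B_def add.commute)
  also have "\<dots> \<le> (\<Sum>g\<in>B. real p) + (\<Sum>g\<in>P-B. 2 * r * sqrt p)"
  proof (intro add_mono sum_mono)
    fix g
    have le1: "cmod (\<Prod>i\<in>S. \<phi> i (g i - x)) \<le> 1" for x
      unfolding prod_norm[symmetric]
      by (intro prod_le_1) (auto simp: \<phi>_def chi_norm_le_1[OF \<chi>(1) p(1)])
    have "cmod (s g) \<le> (\<Sum>x=0..<int p. 1)" unfolding s_def by (intro sum_norm_le le1)
    then show "cmod (s g) \<le> real p" by simp
  next
    fix g assume g: "g \<in> P - B"
    then obtain i0 where i0: "i0 \<in> S" "\<And>i. i \<in> S \<Longrightarrow> i \<noteq> i0 \<Longrightarrow> g i \<noteq> g i0"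
      by (auto simp: B_def S_def)
    have gV: "g i \<in> {1..int V}" if "i \<in> S" for i using g that by (auto simp: P_def)
    have cardS: "card S = 2 * r" and finS: "finite S" by (auto simp: S_def)
    define \<chi>' where "\<chi>' = \<phi> i0"
    define m where "m i = (if (i < r) = (i0 < r) then 1 else p - 2)" for i :: nat
    have \<chi>': "dirichlet_character p \<chi>'"
      using \<chi>(1) dirichlet_character_cnj[OF \<chi>(1)] by (cases "i0 < r") (auto simp: \<chi>'_def \<phi>_def[abs_def])
    have "\<chi>' \<noteq> principal_character p"
    proof
      assume eq: "\<chi>' = principal_character p"
      have "\<chi> a = principal_character p a" for a
        using fun_cong[OF eq, of a] by (cases "i0 < r")
          (auto simp: \<chi>'_def \<phi>_def principal_character_def complex_eq_iff split: if_splits)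
      then show False using \<chi>(2) by blast
    qed
    have eq: "\<phi> i a = \<chi>' (a ^ m i)" for i a
    proof -
      have c: "cnj (\<chi> a) = \<chi> (a ^ (p - 2))" by (rule cnj_chi[OF \<chi>(1) p])
      have "\<chi> a = cnj (\<chi> (a ^ (p - 2)))" unfolding c[symmetric] by simp
      then show ?thesis using c by (simp add: m_def \<chi>'_def \<phi>_def)
    qed
    have "cmod (s g) \<le> real (card S) * sqrt p"
      unfolding s_def eq
      by (rule weil_product[OF \<chi>' \<open>\<chi>' \<noteq> principal_character p\<close> p(1) finS gV V(2), where ?i0.0 = i0])
         (use i0 p(2) in \<open>auto simp: m_def\<close>)
    then show "cmod (s g) \<le> 2 * r * sqrt p" by (simp add: cardS)
  qed
  also have "\<dots> = real (card B) * p + real (card (P - B)) * (2 * r * sqrt p)" by simp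
  also have "\<dots> \<le> real (r ^ (2 * r) * V ^ r) * p + real (V ^ (2 * r)) * (2 * r * sqrt p)"
  proof (intro add_mono mult_right_mono)
    show "real (card B) \<le> real (r ^ (2 * r) * V ^ r)" using cardB of_nat_le_iff by blast
    have "card (P - B) \<le> card P" using finP by (intro card_mono) auto
    then show "real (card (P - B)) \<le> real (V ^ (2 * r))" unfolding cardP of_nat_le_iff .
  qed auto
  finally show ?thesis by (simp add: M_def mult_ac)
qed

section \<open>Multiplicative energy of determinants\<close>

text \<open>
  Bernoulli's inequality, applied to the ratio of each term to the mean, and summed.
\<close>

lemma power_mean:
  fixes w :: "'b \<Rightarrow> real"
  assumes Xs: "finite Xs" and w: "\<And>x. x \<in> Xs \<Longrightarrow> w x \<ge> 0" and r: "r \<ge> 1"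
  shows "(\<Sum>x\<in>Xs. w x) ^ r \<le> real (card Xs) ^ (r - 1) * (\<Sum>x\<in>Xs. w x ^ r)"
proof (cases "(\<Sum>x\<in>Xs. w x) = 0")
  case True
  then show ?thesis using r w by (simp add: power_0_left sum_nonneg)
next
  case False
  define n where "n = real (card Xs)"
  define s where "s = (\<Sum>x\<in>Xs. w x)"
  define avg where "avg = s / n"
  have n: "n > 0" using Xs False by (auto simp: n_def card_gt_0_iff)
  have "s > 0" using False sum_nonneg[of Xs w] w by (simp add: s_def order_less_le)
  then have avg: "avg > 0" using n by (simp add: avg_def)
  have "n * avg ^ r = avg ^ r * (n + real r * (s / avg - n))" 
  proof -
    have "s / avg = n" using \<open>s > 0\<close> n by (simp add: avg_def)
    then show ?thesis by simp
  qed
  also have "\<dots> = (\<Sum>x\<in>Xs. avg ^ r * (1 + real r * (w x / avg - 1)))"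
    by (simp add: sum.distrib sum_subtractf n_def s_def flip: sum_distrib_left sum_divide_distrib)
  also have "\<dots> \<le> (\<Sum>x\<in>Xs. w x ^ r)"
  proof (rule sum_mono)
    fix x assume "x \<in> Xs"
    then have "1 + real r * (w x / avg - 1) \<le> (1 + (w x / avg - 1)) ^ r"
      using w[of x] avg by (intro Bernoulli_inequality) auto
    then have "avg ^ r * (1 + real r * (w x / avg - 1)) \<le> avg ^ r * (w x / avg) ^ r"
      using avg by (intro mult_left_mono) auto
    also have "\<dots> = w x ^ r" using avg by (simp flip: power_mult_distrib)
    finally show "avg ^ r * (1 + real r * (w x / avg - 1)) \<le> w x ^ r" .
  qed
  finally have "n ^ (r - 1) * (n * avg ^ r) \<le> n ^ (r - 1) * (\<Sum>x\<in>Xs. w x ^ r)"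
    using n by (intro mult_left_mono) auto
  moreover have "n ^ (r - 1) * (n * avg ^ r) = (n * avg) ^ r"
    using r by (cases r) (auto simp: power_mult_distrib)
  moreover have "n * avg = s" using n by (simp add: avg_def)
  ultimately show ?thesis by (simp add: s_def n_def)
qed

lemma Cauchy_Schwarz_sum:
  fixes f g :: "'b \<Rightarrow> real"
  shows "(\<Sum>i\<in>I. f i * g i) ^ 2 \<le> (\<Sum>i\<in>I. f i ^ 2) * (\<Sum>i\<in>I. g i ^ 2)"
proof (cases "finite I")
  case True
  define A where "A = (\<Sum>i\<in>I. f i ^ 2)"
  define B where "B = (\<Sum>i\<in>I. g i ^ 2)"
  define C where "C = (\<Sum>i\<in>I. f i * g i)"
  show ?thesis
  proof (cases "A = 0")
    case A0: True
    then have "\<forall>i\<in>I. f i = 0" using True by (simp add: A_def sum_nonneg_eq_0_iff)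
    then have "C = 0" by (simp add: C_def)
    then show ?thesis using A0 by (simp add: A_def C_def)
  next
    case False
    have "A \<ge> 0" by (simp add: A_def sum_nonneg)
    then have A: "A > 0" using False by simp
    have "0 \<le> (\<Sum>i\<in>I. (A * g i - C * f i) ^ 2)" by (simp add: sum_nonneg)
    also have "\<dots> = (\<Sum>i\<in>I. A ^ 2 * g i ^ 2 - 2 * A * C * (f i * g i) + C ^ 2 * f i ^ 2)"
      by (intro sum.cong refl) (simp add: power2_eq_square algebra_simps)
    also have "\<dots> = A ^ 2 * B - 2 * A * C * C + C ^ 2 * A"
      by (simp add: sum.distrib sum_subtractf A_def B_def C_def flip: sum_distrib_left)
    also have "\<dots> = A * (A * B - C ^ 2)" by (simp add: power2_eq_square algebra_simps)
    finally have "A * B - C ^ 2 \<ge> 0" using A by (simp add: zero_le_mult_iff)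
    then show ?thesis by (simp add: A_def B_def C_def)
  qed
qed simp

text \<open>
  The power mean inequality moves the exponent \<open>r\<close> inside. The remaining sum of \<open>W\<^sup>r\<close> over \<open>Xs\<close> is then
  written as a sum over the values of \<open>lam\<close>, weighted by multiplicities, and the Cauchy-Schwarz inequality
  separates the multiplicities, whose squares sum up to the number of coincidences.
\<close>

lemma holder_energy:
  fixes W :: "'c \<Rightarrow> real" and lam :: "'b \<Rightarrow> 'c"
  assumes Xs: "finite Xs" and L: "finite L" "lam ` Xs \<subseteq> L" and W: "\<And>x. W x \<ge> 0" and r: "r \<ge> 1"
  shows "(\<Sum>\<tau>\<in>Xs. W (lam \<tau>)) ^ (2 * r)
    \<le> real (card Xs) ^ (2 * r - 2) * real (card {(\<tau>, \<tau>'). \<tau> \<in> Xs \<and> \<tau>' \<in> Xs \<and> lam \<tau> = lam \<tau>'})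
       * (\<Sum>x\<in>L. W x ^ (2 * r))"
proof -
  define \<nu> where "\<nu> x = real (card {\<tau>\<in>Xs. lam \<tau> = x})" for x
  define E where "E = {(\<tau>, \<tau>'). \<tau> \<in> Xs \<and> \<tau>' \<in> Xs \<and> lam \<tau> = lam \<tau>'}"
  have "E = (SIGMA \<tau>:Xs. {\<tau>'\<in>Xs. lam \<tau>' = lam \<tau>})" by (auto simp: E_def)
  then have "card E = (\<Sum>\<tau>\<in>Xs. card {\<tau>'\<in>Xs. lam \<tau>' = lam \<tau>})" using Xs by simp
  then have "real (card E) = (\<Sum>\<tau>\<in>Xs. \<nu> (lam \<tau>))" by (simp add: \<nu>_def)
  also have "\<dots> = (\<Sum>x\<in>L. \<Sum>\<tau>\<in>{\<tau>\<in>Xs. lam \<tau> = x}. \<nu> (lam \<tau>))"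
    using Xs L by (intro sum.group[symmetric])
  also have "\<dots> = (\<Sum>x\<in>L. \<nu> x ^ 2)" by (intro sum.cong refl) (simp add: \<nu>_def power2_eq_square)
  finally have E: "real (card E) = (\<Sum>x\<in>L. \<nu> x ^ 2)" .
  have "(\<Sum>\<tau>\<in>Xs. W (lam \<tau>) ^ r) = (\<Sum>x\<in>L. \<Sum>\<tau>\<in>{\<tau>\<in>Xs. lam \<tau> = x}. W (lam \<tau>) ^ r)"
    using Xs L by (intro sum.group[symmetric])
  also have "\<dots> = (\<Sum>x\<in>L. \<nu> x * W x ^ r)" by (intro sum.cong refl) (simp add: \<nu>_def)
  finally have S: "(\<Sum>\<tau>\<in>Xs. W (lam \<tau>) ^ r) = (\<Sum>x\<in>L. \<nu> x * W x ^ r)" .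
  have CS: "(\<Sum>x\<in>L. \<nu> x * W x ^ r) ^ 2 \<le> (\<Sum>x\<in>L. \<nu> x ^ 2) * (\<Sum>x\<in>L. (W x ^ r) ^ 2)"
    by (rule Cauchy_Schwarz_sum)
  have "(\<Sum>\<tau>\<in>Xs. W (lam \<tau>)) ^ (2 * r) = ((\<Sum>\<tau>\<in>Xs. W (lam \<tau>)) ^ r) ^ 2"
    by (simp add: mult.commute flip: power_mult)
  also have "\<dots> \<le> (real (card Xs) ^ (r - 1) * (\<Sum>\<tau>\<in>Xs. W (lam \<tau>) ^ r)) ^ 2"
    using Xs W r by (intro power_mono power_mean zero_le_power sum_nonneg)
  also have "\<dots> = real (card Xs) ^ (2 * r - 2) * (\<Sum>x\<in>L. \<nu> x * W x ^ r) ^ 2"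
  proof -
    have "(r - 1) * 2 = 2 * r - 2" by simp
    then show ?thesis unfolding S power_mult_distrib power_mult[symmetric] by simp
  qed
  also have "\<dots> \<le> real (card Xs) ^ (2 * r - 2) * ((\<Sum>x\<in>L. \<nu> x ^ 2) * (\<Sum>x\<in>L. (W x ^ r) ^ 2))"
    using CS by (intro mult_left_mono) auto
  also have "\<dots> = real (card Xs) ^ (2 * r - 2) * real (card E) * (\<Sum>x\<in>L. W x ^ (2 * r))"
    unfolding E by (simp add: mult.commute[of 2] flip: power_mult)
  finally show ?thesis by (simp add: E_def)
qed

lemma card_Sigma_le:
  assumes "finite A" "\<And>x. x \<in> A \<Longrightarrow> finite (B x)" "\<And>x. x \<in> A \<Longrightarrow> real (card (B x)) \<le> M"
  shows "real (card (Sigma A B)) \<le> real (card A) * M"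
proof -
  have "real (card (Sigma A B)) = (\<Sum>x\<in>A. real (card (B x)))" using assms by simp
  also have "\<dots> \<le> (\<Sum>x\<in>A. M)" using assms by (intro sum_mono)
  finally show ?thesis by simp
qed

text \<open>
  The positive divisors of \<open>m\<close>, but none at all when \<open>m\<close> is zero or exceeds \<open>Q\<close>: in this way the divisor
  bound holds for every \<open>m\<close>.
\<close>

definition divs_upto :: "int \<Rightarrow> int \<Rightarrow> int set" where
  "divs_upto Q m = {x. 1 \<le> x \<and> x dvd m \<and> m \<noteq> 0 \<and> \<bar>m\<bar> \<le> Q}"

lemma finite_divs_upto: "finite (divs_upto Q m)"
proof (rule finite_subset)
  show "divs_upto Q m \<subseteq> {1..\<bar>m\<bar>}"
    by (auto simp: divs_upto_def dest: dvd_imp_le_int)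
qed simp

lemma card_divs_upto:
  assumes "\<And>n. 1 \<le> n \<Longrightarrow> int n \<le> Q \<Longrightarrow> real (card {d. d dvd n}) \<le> D" "D \<ge> 0"
  shows "real (card (divs_upto Q m)) \<le> D"
proof (cases "m \<noteq> 0 \<and> \<bar>m\<bar> \<le> Q")
  case True
  define n where "n = nat \<bar>m\<bar>"
  have n: "int n = \<bar>m\<bar>" "n \<ge> 1" using True by (auto simp: n_def)
  have "divs_upto Q m \<subseteq> int ` {d. d dvd n}"
  proof
    fix x assume x: "x \<in> divs_upto Q m"
    then have "int (nat x) dvd int n" using n by (simp add: divs_upto_def)
    then have "nat x dvd n" by (simp only: int_dvd_int_iff)
    then show "x \<in> int ` {d. d dvd n}" using x by (intro image_eqI[of _ _ "nat x"]) (auto simp: divs_upto_def)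
  qed
  then have "card (divs_upto Q m) \<le> card (int ` {d. d dvd n})" using n by (intro card_mono) auto
  also have "\<dots> \<le> card {d. d dvd n}" using n by (intro card_image_le) auto
  finally show ?thesis using assms(1)[of n] n True by simp
next
  case False
  then have "divs_upto Q m = {}" by (auto simp: divs_upto_def)
  then show ?thesis using assms by simp
qed

definition tuples :: "int \<Rightarrow> int \<Rightarrow> (int \<times> int \<times> int \<times> int \<times> int) set" where
  "tuples N U = {1..N} \<times> {1..N} \<times> {1..N} \<times> {1..N} \<times> {1..U}"

definition nonsingular_tuples :: "int \<Rightarrow> int \<Rightarrow> (int \<times> int \<times> int \<times> int \<times> int) set" where
  "nonsingular_tuples N U = {(a, b, c, d, u) \<in> tuples N U. a * b \<noteq> c * d}"

lemma prod_bounds: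
  fixes a b N :: int
  assumes "1 \<le> a" "a \<le> N" "1 \<le> b" "b \<le> M"
  shows "1 \<le> a * b" "a * b \<le> N * M"
  using assms mult_mono[of 1 a 1 b] mult_mono[of a N b M] by auto

lemma abs_det_le:
  fixes a b c d N :: int
  assumes "1 \<le> a" "a \<le> N" "1 \<le> b" "b \<le> N" "1 \<le> c" "c \<le> N" "1 \<le> d" "d \<le> N"
  shows "\<bar>a * b - c * d\<bar> \<le> N * N"
  using prod_bounds[OF assms(1-4)] prod_bounds[OF assms(5-8)] by linarith

text \<open>
  A pair of quintuples with the same value \<open>lam\<close> satisfies
  \<open>n c' u' = n' c u + k p\<close> with \<open>n = ab - cd\<close>, \<open>n' = a'b' - c'd'\<close> and an integer \<open>k\<close> of size at most
  \<open>2N\<^sup>3U/p\<close>. The numbers \<open>n', c, u, k\<close> determine the left-hand side, which is not zero, so that its divisors \<open>c'\<close> and \<open>u'\<close>, and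
  then \<open>n\<close>, can be chosen in at most \<open>D\<^sup>2\<close> ways. Given \<open>n\<close>, \<open>c\<close> and \<open>d\<close>, the number \<open>a\<close> is a divisor of
  \<open>n + cd = ab\<close>, and likewise for \<open>a'\<close>. The map \<open>f\<close> in the proof records these data.
\<close>

lemma energy_bound:
  fixes N U :: int and p :: nat and D :: real
  assumes p: "p > 0" and N: "1 \<le> N" "N < int p" and U: "1 \<le> U" "U \<le> N"
    and D: "\<And>n. 1 \<le> n \<Longrightarrow> int n \<le> int p ^ 4 \<Longrightarrow> real (card {d. d dvd n}) \<le> D" "D \<ge> 0"
    and lam: "\<And>a b c d u. (a, b, c, d, u) \<in> nonsingular_tuples N U \<Longrightarrow>
      [lam (a, b, c, d, u) * (c * u) = a * b - c * d] (mod int p)"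
  shows "real (card {(\<tau>, \<tau>'). \<tau> \<in> nonsingular_tuples N U \<and> \<tau>' \<in> nonsingular_tuples N U \<and> lam \<tau> = (lam \<tau>' :: int)})
    \<le> 3 * real_of_int N ^ 5 * real_of_int U * D ^ 4 * (1 + 4 * real_of_int N ^ 3 * real_of_int U / p)"
proof -
  define Xs where "Xs = nonsingular_tuples N U"
  define E where "E = {(\<tau>, \<tau>'). \<tau> \<in> Xs \<and> \<tau>' \<in> Xs \<and> lam \<tau> = lam \<tau>'}"
  define Q where "Q = int p ^ 4"
  define Kk where "Kk = (2 * (N * N * (N * U))) div int p"
  define P where "P = {-(N*N)..N*N} \<times> {1..N} \<times> {1..U} \<times> {-Kk..Kk}"
  define Dv where "Dv = divs_upto Q"
  define mm where "mm = (\<lambda>(n', c, u, k). n' * (c * u) + k * int p)"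
  define Z where "Z = Sigma P (\<lambda>(n', c, u, k). Sigma (Dv (mm (n', c, u, k)) \<times> Dv (mm (n', c, u, k)))
     (\<lambda>(c', u'). (Sigma {1..N} (\<lambda>d. Dv (mm (n', c, u, k) div (c' * u') + c * d))) \<times>
                (Sigma {1..N} (\<lambda>d'. Dv (n' + c' * d')))))"
  define f where "f = (\<lambda>((a, b, c, d, u), (a', b', c', d', u')).
    let n = a * b - c * d; n' = a' * b' - c' * d' in
    ((n', c, u, (n * (c' * u') - n' * (c * u)) div int p), (c', u'), (d, a), (d', a' :: int)))"
  have Dv_fin: "finite (Dv m)" for m by (simp add: Dv_def finite_divs_upto)
  have Dv_card: "real (card (Dv m)) \<le> D" for m
    unfolding Dv_def Q_def by (rule card_divs_upto[OF D])
  have pE: "int p dvd (a * b - c * d) * (c' * u') - (a' * b' - c' * d') * (c * u)"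
    if "((a, b, c, d, u), (a', b', c', d', u')) \<in> E" for a b c d u a' b' c' d' u'
  proof -
    have l: "(a, b, c, d, u) \<in> nonsingular_tuples N U" "(a', b', c', d', u') \<in> nonsingular_tuples N U"
      "lam (a, b, c, d, u) = lam (a', b', c', d', u')" using that by (auto simp: E_def Xs_def)
    define x where "x = lam (a, b, c, d, u)"
    have "[(a * b - c * d) * (c' * u') = x * (c * u) * (c' * u')] (mod int p)"
      unfolding x_def by (rule cong_mult[OF cong_sym[OF lam[OF l(1)]] cong_refl])
    also have "x * (c * u) * (c' * u') = x * (c' * u') * (c * u)" by simp
    also have "[\<dots> = (a' * b' - c' * d') * (c * u)] (mod int p)"
      unfolding x_def l(3) by (rule cong_mult[OF lam[OF l(2)] cong_refl])
    finally show ?thesis by (simp add: cong_iff_dvd_diff)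
  qed
  have EX: "1 \<le> a" "a \<le> N" "1 \<le> b" "b \<le> N" "1 \<le> c" "c \<le> N" "1 \<le> d" "d \<le> N" "1 \<le> u" "u \<le> U"
    "a * b \<noteq> c * d"
    "1 \<le> a'" "a' \<le> N" "1 \<le> b'" "b' \<le> N" "1 \<le> c'" "c' \<le> N" "1 \<le> d'" "d' \<le> N" "1 \<le> u'" "u' \<le> U"
    "a' * b' \<noteq> c' * d'"
    if "((a, b, c, d, u), (a', b', c', d', u')) \<in> E" for a b c d u a' b' c' d' u'
    using that by (auto simp: E_def Xs_def nonsingular_tuples_def tuples_def)
  have finP: "finite P" by (simp add: P_def)
  have finZ: "finite Z" unfolding Z_def using finP Dv_fin by (auto intro!: finite_SigmaI)
  have "inj_on f E"
  proof (rule inj_onI)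
    fix x y assume x: "x \<in> E" and y: "y \<in> E" and eq: "f x = f y"
    obtain a b c d u a' b' c' d' u' where xe: "x = ((a, b, c, d, u), (a', b', c', d', u'))" by (metis surj_pair)
    obtain a1 b1 c1 d1 u1 a1' b1' c1' d1' u1' where ye: "y = ((a1, b1, c1, d1, u1), (a1', b1', c1', d1', u1'))"
      by (metis surj_pair)
    note ex = EX[OF x[unfolded xe]]
    have same: "c1 = c" "u1 = u" "c1' = c'" "u1' = u'" "d1 = d" "a1 = a" "d1' = d'" "a1' = a'"
      and n': "a' * b' - c' * d' = a1' * b1' - c1' * d1'"
      and k: "((a * b - c * d) * (c' * u') - (a' * b' - c' * d') * (c * u)) div int p
        = ((a1 * b1 - c1 * d1) * (c1' * u1') - (a1' * b1' - c1' * d1') * (c1 * u1)) div int p"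
      using eq by (auto simp: f_def xe ye Let_def)
    have b': "b1' = b'" using n' same ex by auto
    have "(a * b - c * d) * (c' * u') - (a' * b' - c' * d') * (c * u)
      = (a1 * b1 - c1 * d1) * (c1' * u1') - (a1' * b1' - c1' * d1') * (c1 * u1)"
      using k pE[OF x[unfolded xe]] pE[OF y[unfolded ye]] by (metis dvd_div_mult_self)
    then have "(a * b - c * d) * (c' * u') = (a * b1 - c * d) * (c' * u')" by (simp add: same b')
    moreover have "c' * u' \<noteq> 0" using ex by auto
    ultimately have "a * b = a * b1" by simp
    then have "b1 = b" using ex by auto
    then show "x = y" by (simp add: xe ye same b')
  qed
  moreover have "f ` E \<subseteq> Z"
  proof (rule image_subsetI)
    fix x assume x: "x \<in> E"
    obtain a b c d u a' b' c' d' u' where xe: "x = ((a, b, c, d, u), (a', b', c', d', u'))" by (metis surj_pair)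
    note ex = EX[OF x[unfolded xe]]
    define n where "n = a * b - c * d"
    define n' where "n' = a' * b' - c' * d'"
    define k where "k = (n * (c' * u') - n' * (c * u)) div int p"
    have kp: "k * int p = n * (c' * u') - n' * (c * u)"
      using pE[OF x[unfolded xe]] by (simp add: k_def n_def n'_def)
    have m: "mm (n', c, u, k) = n * (c' * u')" by (simp add: mm_def kp)
    have nN: "\<bar>n\<bar> \<le> N * N" "\<bar>n'\<bar> \<le> N * N" using ex by (auto simp: n_def n'_def intro!: abs_det_le)
    have cu: "1 \<le> c * u" "c * u \<le> N * U" "1 \<le> c' * u'" "c' * u' \<le> N * U"
      using ex prod_bounds[of c N u U] prod_bounds[of c' N u' U] by auto
    have n0: "n \<noteq> 0" "n' \<noteq> 0" using ex by (auto simp: n_def n'_def)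
    have b1: "\<bar>n * (c' * u')\<bar> \<le> N * N * (N * U)" 
      unfolding abs_mult[of n] by (rule mult_mono) (use nN cu in auto)
    have b2: "\<bar>n' * (c * u)\<bar> \<le> N * N * (N * U)"
      unfolding abs_mult[of n'] by (rule mult_mono) (use nN cu in auto)
    have "\<bar>k * int p\<bar> \<le> 2 * (N * N * (N * U))" using b1 b2 unfolding kp by linarith
    then have "\<bar>k\<bar> * int p \<le> 2 * (N * N * (N * U))" by (simp add: abs_mult)
    then have "(\<bar>k\<bar> * int p) div int p \<le> Kk" unfolding Kk_def using p by (intro zdiv_mono1) auto
    then have kK: "\<bar>k\<bar> \<le> Kk" using p by simp
    have NQ: "N * N * (N * U) \<le> Q"
    proof -
      have "N * N * (N * U) \<le> N * N * (N * N)" using U N by (intro mult_left_mono) auto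
      also have "\<dots> = N ^ 4" by (simp add: power4_eq_xxxx)
      also have "\<dots> \<le> Q" unfolding Q_def using N by (intro power_mono) auto
      finally show ?thesis .
    qed
    have NNQ: "N * N \<le> Q"
    proof -
      have "N * N * 1 \<le> N * N * (N * U)" using N U prod_bounds[of N N U U] by (intro mult_left_mono) auto
      then show ?thesis using NQ by linarith
    qed
    have inP: "(n', c, u, k) \<in> P" using nN kK ex by (auto simp: P_def)
    have mQ: "mm (n', c, u, k) \<noteq> 0" "\<bar>mm (n', c, u, k)\<bar> \<le> Q"
      using n0 cu b1 NQ unfolding m by auto
    have D1: "c' \<in> Dv (mm (n', c, u, k))" "u' \<in> Dv (mm (n', c, u, k))"
      using mQ ex by (simp_all add: Dv_def divs_upto_def) (simp_all add: m)
    have "mm (n', c, u, k) div (c' * u') = n"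
      using ex nonzero_mult_div_cancel_right[of "c' * u'" n] unfolding m by auto
    then have "mm (n', c, u, k) div (c' * u') + c * d = a * b" by (simp add: n_def)
    moreover have "a \<in> Dv (a * b)" using prod_bounds[of a N b N] ex NNQ by (simp add: Dv_def divs_upto_def)
    ultimately have D2: "a \<in> Dv (mm (n', c, u, k) div (c' * u') + c * d)" by simp
    have "a' \<in> Dv (a' * b')" using prod_bounds[of a' N b' N] ex NNQ by (simp add: Dv_def divs_upto_def)
    then have D3: "a' \<in> Dv (n' + c' * d')" by (simp add: n'_def)
    have "f x = ((n', c, u, k), (c', u'), (d, a), (d', a'))"
      by (simp add: f_def xe Let_def n_def n'_def k_def)
    then show "f x \<in> Z" using inP D1 D2 D3 ex by (simp add: Z_def)
  qed
  ultimately have "card E \<le> card Z" using finZ by (intro card_inj_on_le)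
  also have "real (card Z) \<le> real (card P) * ((D * D) * ((real_of_int N * D) * (real_of_int N * D)))"
    unfolding Z_def
  proof (intro card_Sigma_le finP, goal_cases)
    case (1 x)
    obtain n' c u k where xe: "x = (n', c, u, k)" by (metis surj_pair)
    show ?case unfolding xe using Dv_fin by (auto intro!: finite_SigmaI)
  next
    case (2 x)
    obtain n' c u k where xe: "x = (n', c, u, k)" by (metis surj_pair)
    have sig: "real (card (Sigma {1..N} (\<lambda>d. Dv (h d)))) \<le> real_of_int N * D" for h
      using card_Sigma_le[of "{1..N}" "\<lambda>d. Dv (h d)" D] Dv_fin Dv_card N by simp
    define m where "m = mm (n', c, u, k)"
    have "real (card (Sigma (Dv m \<times> Dv m)
     (\<lambda>(c', u'). (Sigma {1..N} (\<lambda>d. Dv (m div (c' * u') + c * d))) \<times>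
                (Sigma {1..N} (\<lambda>d'. Dv (n' + c' * d'))))))
      \<le> real (card (Dv m \<times> Dv m)) * ((real_of_int N * D) * (real_of_int N * D))"
    proof (intro card_Sigma_le, goal_cases)
      case 1 then show ?case using Dv_fin by simp
    next
      case (2 y)
      obtain c' u' where ye: "y = (c', u')" by (metis surj_pair)
      show ?case unfolding ye using Dv_fin by (auto intro!: finite_SigmaI)
    next
      case (3 y)
      obtain c' u' where ye: "y = (c', u')" by (metis surj_pair)
      show ?case unfolding ye prod.case card_cartesian_product of_nat_mult
        using D N by (intro mult_mono sig) auto
    qed
    also have "\<dots> \<le> (D * D) * ((real_of_int N * D) * (real_of_int N * D))"
      unfolding card_cartesian_product of_nat_mult
      using D N Dv_card by (intro mult_mono) auto
    finally show ?case by (simp add: xe m_def)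
  qed
  finally have E1: "real (card E) \<le> real (card P) * ((D * D) * ((real_of_int N * D) * (real_of_int N * D)))"
    by simp
  have Kk0: "Kk \<ge> 0" using N U p by (simp add: Kk_def pos_imp_zdiv_nonneg_iff)
  have Kk1: "real_of_int Kk \<le> 2 * real_of_int N ^ 3 * real_of_int U / p"
  proof -
    have "real_of_int Kk \<le> real_of_int (2 * (N * N * (N * U))) / real_of_int (int p)"
      unfolding Kk_def by (rule real_of_int_div4)
    then show ?thesis by (simp add: power3_eq_cube mult_ac)
  qed
  have "real (card P) = (2 * (real_of_int N * real_of_int N) + 1) * (real_of_int N * (real_of_int U * (2 * real_of_int Kk + 1)))"
    using N U Kk0 by (simp add: P_def card_cartesian_product)
  also have "\<dots> \<le> (3 * (real_of_int N * real_of_int N)) * (real_of_int N * (real_of_int U * (1 + 4 * real_of_int N ^ 3 * real_of_int U / p)))"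
  proof (intro mult_mono)
    have "1 * 1 \<le> real_of_int N * real_of_int N" using N by (intro mult_mono) auto
    then show "2 * (real_of_int N * real_of_int N) + 1 \<le> 3 * (real_of_int N * real_of_int N)" by simp
    show "2 * real_of_int Kk + 1 \<le> 1 + 4 * real_of_int N ^ 3 * real_of_int U / p" using Kk1 by simp
  qed (use N U Kk0 in auto)
  finally have "real (card E) \<le> (3 * (real_of_int N * real_of_int N)) * (real_of_int N * (real_of_int U * (1 + 4 * real_of_int N ^ 3 * real_of_int U / p)))
    * ((D * D) * ((real_of_int N * D) * (real_of_int N * D)))"
    using E1 D N by (meson mult_right_mono order_trans mult_nonneg_nonneg of_int_0_le_iff zero_le_square)
  also have "\<dots> = 3 * real_of_int N ^ 5 * real_of_int U * D ^ 4 * (1 + 4 * real_of_int N ^ 3 * real_of_int U / p)"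
  proof -
    have "(3 * (n * n)) * (n * (w * F)) * ((D * D) * ((n * D) * (n * D))) = 3 * n ^ 5 * w * D ^ 4 * F"
      for n w F :: real by (simp add: eval_nat_numeral)
    then show ?thesis .
  qed
  finally show ?thesis by (simp add: E_def Xs_def)
qed

section \<open>Averaging over shifts\<close>

text \<open>
  Shifting the summation interval by one exchanges one boundary term for another.
\<close>

lemma shift_sum_le:
  fixes f :: "int \<Rightarrow> complex"
  assumes f: "\<And>d. cmod (f d) \<le> 1"
  shows "cmod ((\<Sum>d=1..int n. f d) - (\<Sum>d=1..int n. f (d + int h))) \<le> 2 * real h"
proof (induction h)
  case (Suc h)
  have tele: "(\<Sum>d=1..int n. g d) - (\<Sum>d=1..int n. g (d + 1)) = g 1 - g (int n + 1)" for g :: "int \<Rightarrow> complex"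
  proof (induction n)
    case (Suc n)
    have "{1..int (Suc n)} = insert (int n + 1) {1..int n}" by auto
    then show ?case using Suc by (simp add: algebra_simps)
  qed simp
  have "(\<Sum>d=1..int n. f d) - (\<Sum>d=1..int n. f (d + int (Suc h)))
    = ((\<Sum>d=1..int n. f d) - (\<Sum>d=1..int n. f (d + int h)))
      + (f (1 + int h) - f (int n + 1 + int h))"
    using tele[of "\<lambda>d. f (d + int h)"] by (simp add: algebra_simps)
  also have "cmod \<dots> \<le> 2 * real h + (1 + 1)"
  proof (rule norm_triangle_le)
    have "cmod (f (1 + int h) - f (int n + 1 + int h)) \<le> 1 + 1"
      by (rule order_trans[OF norm_triangle_ineq4 add_mono[OF f f]])
    then show "cmod ((\<Sum>d=1..int n. f d) - (\<Sum>d=1..int n. f (d + int h)))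
      + cmod (f (1 + int h) - f (int n + 1 + int h)) \<le> 2 * real h + (1 + 1)"
      using Suc by linarith
  qed
  finally show ?case by simp
qed simp

text \<open>
  Shifting the sum by \<open>ut\<close> changes it by at most \<open>2ut \<le> 2UV\<close>; the inequality is the sum of these estimates
  over all \<open>u\<close> and \<open>t\<close>.
\<close>

lemma average_shift:
  fixes f :: "int \<Rightarrow> complex" and U :: int and V :: nat
  assumes f: "\<And>d. cmod (f d) \<le> 1" and N: "0 \<le> N" and U: "1 \<le> U"
  shows "real_of_int U * real V * cmod (\<Sum>d=1..N. f d)
    \<le> (\<Sum>d=1..N. \<Sum>u=1..U. cmod (\<Sum>t=1..int V. f (d + u * t))) + 2 * (real_of_int U * real V) ^ 2"
proof -
  define S where "S = (\<Sum>d=1..N. f d)"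
  define R where "R u t = (\<Sum>d=1..N. f (d + u * t))" for u t
  have err: "cmod (S - R u t) \<le> 2 * (real_of_int U * real V)" if "u \<in> {1..U}" "t \<in> {1..int V}" for u t
  proof -
    have ut: "0 \<le> u * t" "u * t \<le> U * int V" using that U by (auto intro!: mult_mono)
    have "cmod (S - R u t) \<le> 2 * real (nat (u * t))"
      using shift_sum_le[of f "nat N" "nat (u * t)", OF f] N ut by (simp add: S_def R_def)
    also have "real (nat (u * t)) = of_int (u * t)" using ut by simp
    also have "\<dots> \<le> of_int (U * int V)" using ut of_int_le_iff by blast
    finally show ?thesis by simp
  qed
  have tot: "(\<Sum>u=1..U. \<Sum>t=1..int V. x) = of_int U * of_nat V * x" for x :: complex using U by simp
  have "of_int U * of_nat V * S = (\<Sum>u=1..U. \<Sum>t=1..int V. R u t) + (\<Sum>u=1..U. \<Sum>t=1..int V. S - R u t)"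
    by (simp only: tot[symmetric] sum_subtractf) simp
  then have le: "cmod (of_int U * of_nat V * S)
    \<le> cmod (\<Sum>u=1..U. \<Sum>t=1..int V. R u t) + cmod (\<Sum>u=1..U. \<Sum>t=1..int V. S - R u t)"
    by (simp only: norm_triangle_ineq)
  have "(\<Sum>u=1..U. \<Sum>t=1..int V. R u t) = (\<Sum>u=1..U. \<Sum>d=1..N. \<Sum>t=1..int V. f (d + u * t))"
    unfolding R_def by (intro sum.cong refl sum.swap)
  also have "\<dots> = (\<Sum>d=1..N. \<Sum>u=1..U. \<Sum>t=1..int V. f (d + u * t))" by (rule sum.swap)
  finally have main: "cmod (\<Sum>u=1..U. \<Sum>t=1..int V. R u t)
      \<le> (\<Sum>d=1..N. \<Sum>u=1..U. cmod (\<Sum>t=1..int V. f (d + u * t)))"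
    by (simp only:) (intro sum_norm_le norm_sum)
  have "cmod (\<Sum>u=1..U. \<Sum>t=1..int V. S - R u t)
      \<le> (\<Sum>u=1..U. \<Sum>t=1..int V. 2 * (real_of_int U * real V))"
    by (intro sum_norm_le) (use err in auto)
  also have "\<dots> = 2 * (real_of_int U * real V) ^ 2" using U by (simp add: power2_eq_square mult_ac)
  finally show ?thesis using le main U by (simp add: norm_mult S_def)
qed

lemma sum_tuples:
  "(\<Sum>\<tau>\<in>tuples N U. G \<tau>) = (\<Sum>a=1..N. \<Sum>b=1..N. \<Sum>c=1..N. \<Sum>d=1..N. \<Sum>u=1..U. G (a, b, c, d, u))"
proof -
  have prod: "sum g (A \<times> B) = (\<Sum>x\<in>A. \<Sum>y\<in>B. g (x, y))" for g :: "'x \<times> 'y \<Rightarrow> 'z::comm_monoid_add" and A B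
    by (simp add: sum.cartesian_product)
  show ?thesis unfolding tuples_def prod ..
qed

text \<open>
  When \<open>ab = cd\<close>, the number \<open>c\<close> is a divisor of \<open>ab\<close>, and \<open>d\<close> is determined by \<open>a\<close>, \<open>b\<close> and \<open>c\<close>.
\<close>

lemma card_singular_tuples:
  fixes N U :: int and p :: nat and D :: real
  assumes N: "1 \<le> N" "N < int p" and U: "1 \<le> U"
    and D: "\<And>n. 1 \<le> n \<Longrightarrow> int n \<le> int p ^ 4 \<Longrightarrow> real (card {d. d dvd n}) \<le> D" "D \<ge> 0"
  shows "real (card (tuples N U - nonsingular_tuples N U)) \<le> real_of_int N ^ 2 * D * real_of_int U"
proof -
  define Q where "Q = int p ^ 4"
  define Z where "Z = Sigma ({1..N} \<times> {1..N}) (\<lambda>(a, b). divs_upto Q (a * b)) \<times> {1..U}"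
  define f where "f = (\<lambda>(a, b, c, d :: int, u). (((a, b), c), u) :: ((int \<times> int) \<times> int) \<times> int)"
  have "inj_on f (tuples N U - nonsingular_tuples N U)"
    by (rule inj_onI) (auto simp: f_def tuples_def nonsingular_tuples_def)
  moreover have "f ` (tuples N U - nonsingular_tuples N U) \<subseteq> Z"
  proof (rule image_subsetI)
    fix x assume x: "x \<in> tuples N U - nonsingular_tuples N U"
    obtain a b c d u where xe: "x = (a, b, c, d, u)" by (metis surj_pair)
    have ex: "1 \<le> a" "a \<le> N" "1 \<le> b" "b \<le> N" "1 \<le> c" "c \<le> N" "1 \<le> u" "u \<le> U" "a * b = c * d"
      using x by (auto simp: xe tuples_def nonsingular_tuples_def)
    have "N * N \<le> Q"
    proof -
      have "N * N * 1 \<le> N * N * (N * N)" using N prod_bounds[of N N N N] by (intro mult_left_mono) auto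
      also have "\<dots> = N ^ 4" by (simp add: power4_eq_xxxx)
      also have "\<dots> \<le> Q" unfolding Q_def using N by (intro power_mono) auto
      finally show ?thesis by simp
    qed
    then have "a * b \<noteq> 0" "\<bar>a * b\<bar> \<le> Q" using prod_bounds[OF ex(1-4)] by linarith+
    moreover have "c dvd a * b" unfolding ex(9) by simp
    ultimately have "c \<in> divs_upto Q (a * b)" using ex(5) unfolding divs_upto_def by blast
    then show "f x \<in> Z" using ex by (simp add: f_def Z_def xe)
  qed
  moreover have "finite Z" unfolding Z_def using finite_divs_upto by (auto intro!: finite_SigmaI)
  ultimately have "card (tuples N U - nonsingular_tuples N U) \<le> card Z" by (rule card_inj_on_le)
  also have "real (card Z) = real (card (Sigma ({1..N} \<times> {1..N}) (\<lambda>(a, b). divs_upto Q (a * b)))) * real_of_int U"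
    using U by (simp add: Z_def card_cartesian_product)
  also have "\<dots> \<le> (real (card ({1..N} \<times> {1..N})) * D) * real_of_int U"
  proof (intro mult_right_mono card_Sigma_le)
    fix x assume "x \<in> {1..N} \<times> {1..N}"
    show "finite (case x of (a, b) \<Rightarrow> divs_upto Q (a * b))" by (cases x) (simp add: finite_divs_upto)
    show "real (card (case x of (a, b) \<Rightarrow> divs_upto Q (a * b))) \<le> D"
      using card_divs_upto[of Q D, OF D[folded Q_def]] by (cases x) simp
  qed (use U in auto)
  also have "\<dots> = real_of_int N ^ 2 * D * real_of_int U"
    using N by (simp add: card_cartesian_product power2_eq_square)
  finally show ?thesis by simp
qed

text \<open>
  Put \<open>H = \<Sum> W(\<lambda>)\<close>, the sum over the quintuples with \<open>ab \<noteq> cd\<close>. The quintuples with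
  \<open>ab = cd\<close> are so few that the trivial bound \<open>V\<close> for the inner sum suffices.
\<close>

lemma T_sum_inequality:
  fixes N U :: int and V p r :: nat and D :: real
  assumes \<chi>: "dirichlet_character p \<chi>" "\<chi> \<noteq> principal_character p" and p: "prime p"
    and N: "1 \<le> N" "N < int p" and U: "1 \<le> U" "U \<le> N" and r: "r \<ge> 1"
    and D: "\<And>n. 1 \<le> n \<Longrightarrow> int n \<le> int p ^ 4 \<Longrightarrow> real (card {d. d dvd n}) \<le> D" "D \<ge> 0"
  shows "\<exists>H\<ge>0. real_of_int U * real V * T_sum \<chi> N
       \<le> H + real_of_int N ^ 2 * D * real_of_int U * real V + 2 * real_of_int N ^ 3 * (real_of_int U * real V) ^ 2 \<and>
     H ^ (2 * r) \<le> (real_of_int N ^ 4 * real_of_int U) ^ (2 * r - 2)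
       * (3 * real_of_int N ^ 5 * real_of_int U * D ^ 4 * (1 + 4 * real_of_int N ^ 3 * real_of_int U / p))
       * (\<Sum>x=0..<int p. cmod (\<Sum>t=1..int V. \<chi> (t - x)) ^ (2 * r))"
proof -
  define W where "W x = cmod (\<Sum>t=1..int V. \<chi> (t - x))" for x
  define G where "G = (\<lambda>(a, b, c, d, u). cmod (\<Sum>t=1..int V. \<chi> (a * b - c * (d + u * t))))"
  define iv where "iv m = (SOME y. [m * y = 1] (mod int p))" for m
  define lam where "lam = (\<lambda>(a, b, c, d, u). ((a * b - c * d) * iv (c * u)) mod int p)"
  define H where "H = (\<Sum>\<tau>\<in>nonsingular_tuples N U. W (lam \<tau>))"
  define M where "M = (\<Sum>x=0..<int p. W x ^ (2 * r))"
  have p0: "p > 0" using p prime_gt_0_nat by blast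
  have norm1: "cmod (\<chi> a) \<le> 1" for a by (rule chi_norm_le_1[OF \<chi>(1) p])
  have lam: "[lam (a, b, c, d, u) * (c * u) = a * b - c * d] (mod int p)"
    if "(a, b, c, d, u) \<in> nonsingular_tuples N U" for a b c d u
  proof -
    have cu: "1 \<le> c" "c < int p" "1 \<le> u" "u < int p"
      using that N U by (auto simp: nonsingular_tuples_def tuples_def)
    have "coprime x (int p)" if "1 \<le> x" "x < int p" for x
    proof -
      have "\<not> int p dvd x" using that zdvd_not_zless by auto
      then show ?thesis using p prime_imp_coprime[of "int p" x] by (simp add: coprime_commute)
    qed
    then have "coprime (c * u) (int p)" using cu by simp
    then have "\<exists>y. [c * u * y = 1] (mod int p)" by (rule cong_solve_coprime_int)
    then have iv: "[c * u * iv (c * u) = 1] (mod int p)" unfolding iv_def by (rule someI_ex)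
    have "[lam (a, b, c, d, u) * (c * u) = ((a * b - c * d) * iv (c * u)) * (c * u)] (mod int p)"
      unfolding lam_def prod.case by (intro cong_mult cong_refl) (simp add: cong_def)
    also have "((a * b - c * d) * iv (c * u)) * (c * u) = (a * b - c * d) * (c * u * iv (c * u))" by simp
    also have "[\<dots> = (a * b - c * d) * 1] (mod int p)" by (rule cong_mult[OF cong_refl iv])
    finally show ?thesis by simp
  qed
  have lam_range: "lam ` nonsingular_tuples N U \<subseteq> {0..<int p}" using p0 by (auto simp: lam_def)
  have fin: "finite (tuples N U)" by (simp add: tuples_def)
  have sub: "nonsingular_tuples N U \<subseteq> tuples N U" by (auto simp: nonsingular_tuples_def)
  then have fin_ns: "finite (nonsingular_tuples N U)" using fin finite_subset by blast
  have card_tuples: "real (card (tuples N U)) = real_of_int N ^ 4 * real_of_int U"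
    using N U by (simp add: tuples_def card_cartesian_product power4_eq_xxxx)
  have G_ns: "G \<tau> \<le> W (lam \<tau>)" if \<tau>: "\<tau> \<in> nonsingular_tuples N U" for \<tau>
  proof -
    obtain a b c d u where te: "\<tau> = (a, b, c, d, u)" by (metis surj_pair)
    define l where "l = lam \<tau>"
    have "\<chi> (a * b - c * (d + u * t)) = \<chi> (- (c * u)) * \<chi> (t - l)" for t
    proof -
      have "[a * b - c * d - c * u * t = l * (c * u) - c * u * t] (mod int p)"
        unfolding l_def te by (rule cong_diff[OF cong_sym[OF lam[OF \<tau>[unfolded te]]] cong_refl])
      then have "[a * b - c * (d + u * t) = - (c * u) * (t - l)] (mod int p)"
        by (simp add: algebra_simps)
      then show ?thesis using dirichlet_character_cong[OF \<chi>(1)] chi_mult[OF \<chi>(1)] by metis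
    qed
    then have "G \<tau> = cmod (\<chi> (- (c * u))) * W l"
      by (simp add: G_def te W_def norm_mult flip: sum_distrib_left)
    also have "\<dots> \<le> 1 * W l" using norm1 by (intro mult_right_mono) (auto simp: W_def)
    finally show ?thesis by (simp add: l_def)
  qed
  have G_le: "G \<tau> \<le> V" for \<tau>
  proof -
    obtain a b c d u where te: "\<tau> = (a, b, c, d, u)" by (metis surj_pair)
    have "G \<tau> \<le> (\<Sum>t=1..int V. 1)" unfolding G_def te prod.case by (intro sum_norm_le norm1)
    then show ?thesis by simp
  qed
  have H0: "H \<ge> 0" unfolding H_def W_def by (intro sum_nonneg) auto
  have "real_of_int U * real V * T_sum \<chi> N
    = (\<Sum>a=1..N. \<Sum>b=1..N. \<Sum>c=1..N. real_of_int U * real V * cmod (\<Sum>d=1..N. \<chi> (a * b - c * d)))"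
    by (simp add: T_sum_def sum_distrib_left)
  also have "\<dots> \<le> (\<Sum>a=1..N. \<Sum>b=1..N. \<Sum>c=1..N.
      (\<Sum>d=1..N. \<Sum>u=1..U. G (a, b, c, d, u)) + 2 * (real_of_int U * real V) ^ 2)"
    unfolding G_def prod.case using N U norm1
    by (intro sum_mono average_shift[where f = "\<lambda>d. \<chi> (a * b - c * d)" for a b c]) auto
  also have "\<dots> = (\<Sum>\<tau>\<in>tuples N U. G \<tau>) + 2 * real_of_int N ^ 3 * (real_of_int U * real V) ^ 2"
    using N by (simp add: sum.distrib sum_tuples power3_eq_cube)
  finally have le: "real_of_int U * real V * T_sum \<chi> N
    \<le> (\<Sum>\<tau>\<in>tuples N U. G \<tau>) + 2 * real_of_int N ^ 3 * (real_of_int U * real V) ^ 2" .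
  have "(\<Sum>\<tau>\<in>tuples N U - nonsingular_tuples N U. G \<tau>) \<le> (\<Sum>\<tau>\<in>tuples N U - nonsingular_tuples N U. real V)"
    by (intro sum_mono G_le)
  also have "\<dots> = real (card (tuples N U - nonsingular_tuples N U)) * V" by simp
  also have "\<dots> \<le> real_of_int N ^ 2 * D * real_of_int U * real V"
    by (intro mult_right_mono card_singular_tuples[OF N U(1) D]) auto
  finally have "(\<Sum>\<tau>\<in>tuples N U - nonsingular_tuples N U. G \<tau>) \<le> real_of_int N ^ 2 * D * real_of_int U * real V" .
  moreover have "(\<Sum>\<tau>\<in>nonsingular_tuples N U. G \<tau>) \<le> H" unfolding H_def by (intro sum_mono G_ns)
  ultimately have "(\<Sum>\<tau>\<in>tuples N U. G \<tau>) \<le> real_of_int N ^ 2 * D * real_of_int U * real V + H"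
    using sum.subset_diff[OF sub fin, of G] by linarith
  then have first: "real_of_int U * real V * T_sum \<chi> N
    \<le> H + real_of_int N ^ 2 * D * real_of_int U * real V + 2 * real_of_int N ^ 3 * (real_of_int U * real V) ^ 2" using le by linarith
  have M0: "M \<ge> 0" unfolding M_def W_def by (intro sum_nonneg) auto
  have "H ^ (2 * r) \<le> real (card (nonsingular_tuples N U)) ^ (2 * r - 2)
    * real (card {(\<tau>, \<tau>'). \<tau> \<in> nonsingular_tuples N U \<and> \<tau>' \<in> nonsingular_tuples N U \<and> lam \<tau> = lam \<tau>'}) * M"
    unfolding H_def M_def by (rule holder_energy[OF fin_ns _ lam_range _ r]) (auto simp: W_def)
  also have "\<dots> \<le> (real_of_int N ^ 4 * real_of_int U) ^ (2 * r - 2)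
       * (3 * real_of_int N ^ 5 * real_of_int U * D ^ 4 * (1 + 4 * real_of_int N ^ 3 * real_of_int U / p)) * M"
  proof (intro mult_right_mono mult_mono power_mono M0)
    show "real (card (nonsingular_tuples N U)) \<le> real_of_int N ^ 4 * real_of_int U"
      using card_mono[OF fin sub] card_tuples by linarith
    show "real (card {(\<tau>, \<tau>'). \<tau> \<in> nonsingular_tuples N U \<and> \<tau>' \<in> nonsingular_tuples N U \<and> lam \<tau> = lam \<tau>'})
      \<le> 3 * real_of_int N ^ 5 * real_of_int U * D ^ 4 * (1 + 4 * real_of_int N ^ 3 * real_of_int U / p)"
      by (rule energy_bound[OF p0 N U D lam])
  qed (use N U in auto)
  finally show ?thesis using first H0 by (auto simp: M_def W_def intro!: exI[of _ H])
qed

section \<open>Choice of parameters\<close>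

text \<open>
  Modulo 2 there is only one residue class coprime to the modulus.
\<close>

lemma nonprincipal_imp_ge_3:
  assumes "prime p" "dirichlet_character p \<chi>" "\<chi> \<noteq> principal_character p"
  shows "p \<ge> 3"
proof (rule ccontr)
  assume "\<not> p \<ge> 3"
  then have p2: "p = 2" using prime_ge_2_nat[OF assms(1)] by simp
  obtain a where a: "coprime a (int p)" "\<chi> a \<noteq> 1" using nonprincipal_ex[OF assms(2,3)] by blast
  then have "odd a" by (simp add: p2)
  then have "[a = 1] (mod int p)" by (simp add: p2 cong_def odd_iff_mod_2_eq_one)
  then have "\<chi> a = \<chi> 1" by (rule dirichlet_character_cong[OF assms(2)])
  then show False using a dirichlet_character_1[OF assms(2)] by simp
qed

text \<open>
  The parameters are \<open>V \<approx> p\<^bsup>1/(2r)\<^esup>\<close>, so that the two terms of \<open>moment_bound\<close> balance, and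
  \<open>UV \<approx> N p\<^bsup>-\<epsilon>/4\<^esup>\<close>, so that the shifts cost only a factor \<open>p\<^bsup>-\<epsilon>/4\<^esup>\<close>. For large \<open>r\<close> the energy bound,
  divided by the square of the number \<open>N\<^sup>4U\<close> of quintuples and multiplied by \<open>\<surd>p\<close>, is at most
  \<open>p\<^bsup>-\<epsilon>/2\<^esup>\<close> up to a constant; the final saving is the \<open>2r\<close>-th root of this.
\<close>

lemma power_saving:
  fixes \<epsilon> :: real
  assumes \<epsilon>: "0 < \<epsilon>" "\<epsilon> \<le> 1 / 4"
  shows "\<exists>C \<delta>. C > 0 \<and> \<delta> > 0 \<and>
    (\<forall>(p::nat) (\<chi>::int \<Rightarrow> complex) (N::int).
       prime p \<longrightarrow> dirichlet_character p \<chi> \<longrightarrow> \<chi> \<noteq> principal_character p \<longrightarrow>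
       N < int p \<longrightarrow> real p powr (1 / 8 + \<epsilon>) \<le> real_of_int N \<longrightarrow>
       T_sum \<chi> N \<le> C * real_of_int N ^ 4 * real p powr (- \<delta>))"
proof -
  define r where "r = nat \<lceil>2 / \<epsilon>\<rceil>"
  have r2: "2 / \<epsilon> \<le> real r" unfolding r_def by linarith
  moreover have "2 / \<epsilon> > 0" using \<epsilon> by simp
  ultimately have r0: "real r > 0" by linarith
  then have r1: "r \<ge> 1" by simp
  have rinv: "1 / (2 * real r) \<le> \<epsilon> / 4" using r2 r0 \<epsilon> by (simp add: field_simps)
  define \<delta> where "\<delta> = \<epsilon> / (4 * real r)"
  have \<delta>: "\<delta> > 0" "\<delta> \<le> \<epsilon> / 4" using r1 \<epsilon> by (simp_all add: \<delta>_def field_simps)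
  \<comment> \<open>The divisor bound is used for integers up to \<open>p\<^sup>4\<close>, and its fourth power enters the energy; the exponent
    \<open>\<epsilon>/32\<close> makes this a factor \<open>p\<^bsup>\<epsilon>/2\<^esup>\<close>.\<close>
  obtain Cd where Cd: "Cd \<ge> 1" "\<And>n. n \<ge> 1 \<Longrightarrow> real (card {d. d dvd (n::nat)}) \<le> Cd * real n powr (\<epsilon> / 32)"
    using divisor_bound[of "\<epsilon> / 32"] \<epsilon> by auto
  define C1 where "C1 = real (r ^ (2 * r)) * 2 ^ r + 2 * real r"
  have C1: "C1 \<ge> 1"
  proof -
    have "1 * 1 \<le> real (r ^ (2 * r)) * 2 ^ r" using r1 by (intro mult_mono) auto
    then show ?thesis using r0 unfolding C1_def by linarith
  qed
  define C2 where "C2 = 18 * C1 * Cd ^ 4"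
  have C2: "C2 \<ge> 1"
  proof -
    have "1 * 1 \<le> C1 * Cd ^ 4" using C1 Cd by (intro mult_mono one_le_power) auto
    then show ?thesis unfolding C2_def by linarith
  qed
  have "T_sum \<chi> N \<le> (C2 + Cd + 2) * real_of_int N ^ 4 * real p powr (- \<delta>)"
    if p: "prime p" and \<chi>: "dirichlet_character p \<chi>" "\<chi> \<noteq> principal_character p"
      and N: "N < int p" "real p powr (1 / 8 + \<epsilon>) \<le> real_of_int N" for p \<chi> N
  proof -
    define P where "P = real p"
    define n where "n = real_of_int N"
    have p3: "p \<ge> 3" by (rule nonprincipal_imp_ge_3[OF p \<chi>])
    then have P: "P \<ge> 3" by (simp add: P_def)
    have mono: "P powr a \<le> P powr b" if "a \<le> b" for a b using P that by (intro powr_mono) auto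
    have Pge1: "P powr a \<ge> 1" if "a \<ge> 0" for a using mono[OF that] P by simp
    have nP: "P powr (1 / 8 + \<epsilon>) \<le> n" using N by (simp add: P_def n_def)
    have n1: "n \<ge> 1" using nP Pge1[of "1 / 8 + \<epsilon>"] \<epsilon> by linarith
    then have N1: "1 \<le> N" by (simp add: n_def)
    define x where "x = P powr (1 / (2 * real r))"
    have x1: "x \<ge> 1" unfolding x_def using r0 by (intro Pge1) auto
    have xP: "x \<le> P powr (\<epsilon> / 4)" unfolding x_def by (rule mono[OF rinv])
    define V where "V = nat \<lfloor>x\<rfloor>"
    have V: "V \<ge> 1" "real V \<le> x" "x \<le> 2 * real V"
    proof -
      have "\<lfloor>x\<rfloor> \<ge> 1" using x1 by simp
      then show "V \<ge> 1" "real V \<le> x" "x \<le> 2 * real V" unfolding V_def by linarith+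
    qed
    have Vp: "V \<le> p"
    proof -
      have "x \<le> P powr 1" unfolding x_def using r1 by (intro mono) auto
      then have "real V \<le> real p" using V P by (simp add: P_def)
      then show ?thesis by simp
    qed
    define y where "y = n * P powr (- (\<epsilon> / 4)) / real V"
    have y1: "y \<ge> 1"
    proof -
      have "real V \<le> P powr (\<epsilon> / 4)" using V xP by linarith
      also have "\<dots> \<le> P powr (1 / 8 + \<epsilon> + - (\<epsilon> / 4))" using \<epsilon> by (intro mono) auto
      also have "\<dots> = P powr (1 / 8 + \<epsilon>) * P powr (- (\<epsilon> / 4))" by (rule powr_add)
      also have "\<dots> \<le> n * P powr (- (\<epsilon> / 4))" using nP by (intro mult_right_mono) auto
      finally show ?thesis using V by (simp add: y_def)
    qed
    define U where "U = \<lfloor>y\<rfloor>"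
    have U: "1 \<le> U" "real_of_int U \<le> y" "y \<le> 2 * real_of_int U"
    proof -
      have "\<lfloor>y\<rfloor> \<ge> 1" using y1 by simp
      then show "1 \<le> U" "real_of_int U \<le> y" "y \<le> 2 * real_of_int U" unfolding U_def by linarith+
    qed
    have yn: "y * real V = n * P powr (- (\<epsilon> / 4))" using V by (simp add: y_def)
    have UN: "U \<le> N"
    proof -
      have "y * 1 \<le> y * real V" using y1 V by (intro mult_left_mono) auto
      also have "\<dots> \<le> n * 1" unfolding yn using n1 mono[of "- (\<epsilon> / 4)" 0] \<epsilon> P by (intro mult_left_mono) auto
      finally have "real_of_int U \<le> real_of_int N" using U by (simp add: n_def)
      then show ?thesis by simp
    qed
    define w where "w = real_of_int U * real V"
    have w0: "w > 0" using U V by (simp add: w_def)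
    have w: "w \<le> n * P powr (- (\<epsilon> / 4))"
      unfolding w_def yn[symmetric] using U V by (intro mult_right_mono) auto
    define D where "D = Cd * P powr (\<epsilon> / 8)"
    have D0: "D \<ge> 0" using Cd by (simp add: D_def)
    have D: "real (card {d. d dvd m}) \<le> D" if m: "1 \<le> m" "int m \<le> int p ^ 4" for m
    proof -
      have "real m \<le> P ^ 4" using m(2) unfolding P_def by (metis of_int_le_iff of_int_of_nat_eq of_int_power)
      then have "real m powr (\<epsilon> / 32) \<le> (P ^ 4) powr (\<epsilon> / 32)" using \<epsilon> by (intro powr_mono2) auto
      also have "\<dots> = P powr (\<epsilon> / 8)" using P by (simp add: powr_powr flip: powr_numeral)
      finally have "Cd * real m powr (\<epsilon> / 32) \<le> D" unfolding D_def using Cd by (intro mult_left_mono) auto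
      then show ?thesis using Cd(2)[OF m(1)] by linarith
    qed
    define M where "M = (\<Sum>x=0..<int p. cmod (\<Sum>t=1..int V. \<chi> (t - x)) ^ (2 * r))"
    obtain H where H: "H \<ge> 0"
      "w * T_sum \<chi> N \<le> H + n ^ 2 * D * w + 2 * n ^ 3 * w ^ 2"
      "H ^ (2 * r) \<le> (n ^ 4 * real_of_int U) ^ (2 * r - 2)
         * (3 * n ^ 5 * real_of_int U * D ^ 4 * (1 + 4 * n ^ 3 * real_of_int U / P)) * M"
      using T_sum_inequality[OF \<chi> p N1 N(1) U(1) UN r1 D D0, of V]
      unfolding M_def w_def n_def P_def by (auto simp: mult.assoc)
    have sqrtP: "sqrt P = x ^ r"
    proof -
      have "x ^ r = P powr (1 / (2 * real r) * real r)" using P by (simp add: x_def powr_powr flip: powr_realpow)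
      also have "1 / (2 * real r) * real r = 1 / 2" using r0 by simp
      finally show ?thesis using P by (simp add: powr_half_sqrt)
    qed
    have M: "M \<le> C1 * real V ^ (2 * r) * sqrt P"
    proof -
      have "sqrt P \<le> 2 ^ r * real V ^ r"
        unfolding sqrtP power_mult_distrib[symmetric] using V x1 by (intro power_mono) auto
      then have "real V ^ r * (sqrt P * sqrt P) \<le> real V ^ r * ((2 ^ r * real V ^ r) * sqrt P)"
        using P by (intro mult_left_mono mult_right_mono) auto
      then have "real V ^ r * P \<le> 2 ^ r * real V ^ (2 * r) * sqrt P"
        using P unfolding mult_2[of r] power_add by (simp add: mult_ac)
      then have "real (r ^ (2 * r)) * (real V ^ r * P) \<le> real (r ^ (2 * r)) * (2 ^ r * real V ^ (2 * r) * sqrt P)"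
        by (intro mult_left_mono) auto
      moreover have "M \<le> real (r ^ (2 * r)) * (real V ^ r * P) + 2 * real r * real V ^ (2 * r) * sqrt P"
        using moment_bound[OF \<chi> p p3 V(1) Vp r1] by (simp add: M_def P_def mult.assoc)
      ultimately show ?thesis by (simp add: C1_def algebra_simps)
    qed
    define u where "u = real_of_int U"
    have u0: "u > 0" using U by (simp add: u_def)
    \<comment> \<open>This is where \<open>N \<ge> p\<^bsup>1/8 + \<epsilon>\<^esup>\<close> is used: \<open>n\<^sup>3u\<close> is nearly \<open>n\<^sup>4 \<ge> p\<^bsup>1/2 + 4\<epsilon>\<^esup>\<close>.\<close>
    have nu: "1 / (n ^ 3 * u) \<le> 2 * P powr (- (1 / 2) - 3 * \<epsilon>)"
    proof -
      have "P powr (1 / 2 + 3 * \<epsilon>) * P powr (\<epsilon> / 2) = P powr (1 / 2 + 7 / 2 * \<epsilon>)"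
        by (simp add: algebra_simps flip: powr_add)
      also have "\<dots> \<le> P powr ((1 / 8 + \<epsilon>) * 4)" using \<epsilon> by (intro mono) auto
      also have "\<dots> = (P powr (1 / 8 + \<epsilon>)) ^ 4" using P by (simp add: powr_powr flip: powr_numeral)
      also have "\<dots> \<le> n ^ 4" using nP by (intro power_mono) auto
      also have "\<dots> = n ^ 3 * (y * real V) * P powr (\<epsilon> / 4)"
      proof -
        have "P powr (- (\<epsilon> / 4)) * P powr (\<epsilon> / 4) = 1" using P by (simp flip: powr_add)
        then have "n ^ 3 * (n * P powr (- (\<epsilon> / 4))) * P powr (\<epsilon> / 4) = n ^ 3 * n"
          by (simp only: mult.assoc mult_1_right)
        then show ?thesis unfolding yn by (simp add: eval_nat_numeral mult_ac)
      qed
      also have "\<dots> \<le> n ^ 3 * ((2 * u) * P powr (\<epsilon> / 4)) * P powr (\<epsilon> / 4)"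
        using n1 U V xP y1 by (intro mult_right_mono mult_left_mono mult_mono) (auto simp: u_def)
      also have "\<dots> = 2 * (n ^ 3 * u) * P powr (\<epsilon> / 2)"
      proof -
        have "P powr (\<epsilon> / 4) * P powr (\<epsilon> / 4) = P powr (\<epsilon> / 2)" by (simp flip: powr_add)
        then show ?thesis by (simp add: mult_ac)
      qed
      finally have "P powr (1 / 2 + 3 * \<epsilon>) \<le> 2 * (n ^ 3 * u)" using P by simp
      then have "1 / (n ^ 3 * u) \<le> 2 / P powr (1 / 2 + 3 * \<epsilon>)"
        using n1 u0 P by (simp add: field_simps)
      also have "\<dots> = 2 * P powr (- (1 / 2 + 3 * \<epsilon>))" by (simp only: powr_minus_divide times_divide_eq_right mult_1_right)
      also have "- (1 / 2 + 3 * \<epsilon>) = - (1 / 2) - 3 * \<epsilon>" by simp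
      finally show ?thesis .
    qed
    have small: "sqrt P * (1 / (n ^ 3 * u) + 4 / P) \<le> 6 * P powr (- \<epsilon>)"
    proof -
      have "sqrt P = P powr (1 / 2)" using P by (simp add: powr_half_sqrt)
      moreover have "1 / (n ^ 3 * u) + 4 / P \<le> 6 * P powr (- (1 / 2) - \<epsilon>)"
      proof -
        have "P powr (- (1 / 2) - 3 * \<epsilon>) \<le> P powr (- (1 / 2) - \<epsilon>)" using \<epsilon> by (intro mono) auto
        moreover have "1 / P \<le> P powr (- (1 / 2) - \<epsilon>)"
        proof -
          have "1 / P = P powr (- 1)" using P by (simp add: powr_minus_divide)
          also have "\<dots> \<le> P powr (- (1 / 2) - \<epsilon>)" using \<epsilon> by (intro mono) auto
          finally show ?thesis .
        qed
        ultimately show ?thesis using nu by linarith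
      qed
      ultimately have "sqrt P * (1 / (n ^ 3 * u) + 4 / P) \<le> P powr (1 / 2) * (6 * P powr (- (1 / 2) - \<epsilon>))"
        by (simp only:) (intro mult_left_mono, auto)
      also have "\<dots> = 6 * P powr (- \<epsilon>)"
      proof -
        have "P powr (1 / 2) * P powr (- (1 / 2) - \<epsilon>) = P powr (- \<epsilon>)" by (simp flip: powr_add)
        then show ?thesis by simp
      qed
      finally show ?thesis .
    qed
    have D4: "D ^ 4 = Cd ^ 4 * P powr (\<epsilon> / 2)"
    proof -
      have "(P powr (\<epsilon> / 8)) ^ 4 = P powr (\<epsilon> / 2)" using P by (simp add: powr_powr flip: powr_numeral)
      then show ?thesis by (simp add: D_def power_mult_distrib)
    qed
    have pow\<delta>: "(P powr (- \<delta>)) ^ (2 * r) = P powr (- (\<epsilon> / 2))"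
    proof -
      have "(P powr (- \<delta>)) ^ (2 * r) = P powr (- \<delta> * real (2 * r))"
        using P by (simp only: powr_powr[symmetric] powr_realpow powr_gt_zero)
      also have "- \<delta> * real (2 * r) = - (\<epsilon> / 2)" using r0 by (simp add: \<delta>_def)
      finally show ?thesis .
    qed
    have "H ^ (2 * r) \<le> (n ^ 4 * u) ^ (2 * r - 2) * (3 * n ^ 5 * u * D ^ 4 * (1 + 4 * n ^ 3 * u / P))
        * (C1 * real V ^ (2 * r) * sqrt P)"
      using H(3) mult_left_mono[OF M, of "(n ^ 4 * u) ^ (2 * r - 2) * (3 * n ^ 5 * u * D ^ 4 * (1 + 4 * n ^ 3 * u / P))"]
        n1 u0 P D0 unfolding u_def[symmetric] by (force intro: order_trans)
    also have "\<dots> = (n ^ 4 * w) ^ (2 * r) * (3 * C1 * D ^ 4 * (sqrt P * (1 / (n ^ 3 * u) + 4 / P)))"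
    proof -
      have e1: "(n ^ 4 * u) ^ (2 * r) = (n ^ 4 * u) ^ (2 * r - 2) * (n ^ 4 * u) ^ 2"
      proof -
        have "2 * r - 2 + 2 = 2 * r" using r1 by simp
        then show ?thesis using power_add[of "n ^ 4 * u" "2 * r - 2" 2] by (simp only:)
      qed
      have e2: "n ^ 5 * u * (1 + 4 * n ^ 3 * u / P) = (n ^ 4 * u) ^ 2 * (1 / (n ^ 3 * u) + 4 / P)"
      proof -
        have sq: "(n ^ 4 * u) ^ 2 = (n ^ 5 * u) * (n ^ 3 * u)"
          by (simp add: eval_nat_numeral mult_ac)
        have "(A * B) * (1 / B + 4 / Q) = A * (1 + 4 * B / Q)" if "B \<noteq> 0" for A B Q :: real
          using that by (simp add: distrib_left)
        from this[of "n ^ 3 * u" "n ^ 5 * u" P] show ?thesis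
          using n1 u0 unfolding sq by (simp add: mult.assoc)
      qed
      have "(n ^ 4 * w) ^ (2 * r) = (n ^ 4 * u) ^ (2 * r) * real V ^ (2 * r)"
        by (simp add: w_def u_def power_mult_distrib mult_ac)
      then have "(n ^ 4 * w) ^ (2 * r) * (3 * C1 * D ^ 4 * (sqrt P * (1 / (n ^ 3 * u) + 4 / P)))
        = (n ^ 4 * u) ^ (2 * r - 2) * real V ^ (2 * r) * 3 * C1 * D ^ 4 * sqrt P
          * ((n ^ 4 * u) ^ 2 * (1 / (n ^ 3 * u) + 4 / P))"
        unfolding e1 by (simp only: mult_ac)
      also have "\<dots> = (n ^ 4 * u) ^ (2 * r - 2) * real V ^ (2 * r) * 3 * C1 * D ^ 4 * sqrt P
          * (n ^ 5 * u * (1 + 4 * n ^ 3 * u / P))" by (simp only: e2)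
      finally show ?thesis by (simp only: mult_ac)
    qed
    also have "\<dots> \<le> (n ^ 4 * w) ^ (2 * r) * (3 * C1 * D ^ 4 * (6 * P powr (- \<epsilon>)))"
      using small C1 D0 n1 w0 by (intro mult_left_mono) auto
    also have "3 * C1 * D ^ 4 * (6 * P powr (- \<epsilon>)) = C2 * P powr (- (\<epsilon> / 2))"
    proof -
      have "P powr (\<epsilon> / 2) * P powr (- \<epsilon>) = P powr (- (\<epsilon> / 2))" by (simp flip: powr_add)
      then show ?thesis by (simp add: D4 C2_def)
    qed
    also have "(n ^ 4 * w) ^ (2 * r) * (C2 * P powr (- (\<epsilon> / 2)))
      \<le> (n ^ 4 * w) ^ (2 * r) * (C2 ^ (2 * r) * P powr (- (\<epsilon> / 2)))"
    proof (intro mult_left_mono mult_right_mono)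
      have "C2 ^ 1 \<le> C2 ^ (2 * r)" using C2 r1 by (intro power_increasing) auto
      then show "C2 \<le> C2 ^ (2 * r)" by simp
    qed (use n1 w0 in auto)
    also have "\<dots> = (n ^ 4 * w * C2 * P powr (- \<delta>)) ^ (2 * r)"
      by (simp only: power_mult_distrib pow\<delta> mult.assoc)
    finally have "H ^ (2 * r) \<le> (n ^ 4 * w * C2 * P powr (- \<delta>)) ^ (2 * r)" .
    then have "H \<le> n ^ 4 * w * C2 * P powr (- \<delta>)"
      by (subst (asm) power_mono_iff) (use H(1) r1 n1 w0 C2 in auto)
    moreover have "n ^ 2 * D \<le> Cd * n ^ 4 * P powr (- \<delta>)"
    proof -
      have "P powr (\<epsilon> / 8) \<le> P powr ((1 / 8 + \<epsilon>) * 2 + - \<delta>)" using \<epsilon> \<delta> by (intro mono) auto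
      also have "\<dots> = (P powr (1 / 8 + \<epsilon>)) ^ 2 * P powr (- \<delta>)"
      proof -
        have sq: "(P powr (1 / 8 + \<epsilon>)) ^ 2 = P powr ((1 / 8 + \<epsilon>) * 2)"
          using P by (simp add: powr_powr flip: powr_numeral)
        show ?thesis unfolding sq by (rule powr_add)
      qed
      also have "\<dots> \<le> n ^ 2 * P powr (- \<delta>)" using nP by (intro mult_right_mono power_mono) auto
      finally have "(Cd * n ^ 2) * P powr (\<epsilon> / 8) \<le> (Cd * n ^ 2) * (n ^ 2 * P powr (- \<delta>))"
        using Cd by (intro mult_left_mono) auto
      then show ?thesis by (simp add: D_def eval_nat_numeral mult_ac)
    qed
    then have "n ^ 2 * D * w \<le> Cd * n ^ 4 * P powr (- \<delta>) * w" using w0 by (intro mult_right_mono) auto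
    moreover have "n ^ 3 * w \<le> n ^ 4 * P powr (- \<delta>)"
    proof -
      have "w \<le> n * P powr (- \<delta>)"
      proof (rule order_trans[OF w mult_left_mono])
        show "P powr (- (\<epsilon> / 4)) \<le> P powr (- \<delta>)" using \<delta> by (intro mono) auto
      qed (use n1 in simp)
      then have "n ^ 3 * w \<le> n ^ 3 * (n * P powr (- \<delta>))" using n1 by (intro mult_left_mono) auto
      then show ?thesis by (simp add: eval_nat_numeral mult_ac)
    qed
    then have "n ^ 3 * w * w \<le> n ^ 4 * P powr (- \<delta>) * w" using w0 by (intro mult_right_mono) auto
    ultimately have "w * T_sum \<chi> N \<le> w * ((C2 + Cd + 2) * n ^ 4 * P powr (- \<delta>))"
      using H(2) by (simp add: power2_eq_square algebra_simps)
    then show ?thesis using w0 by (simp add: n_def P_def)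
  qed
  then show ?thesis using C2 Cd \<delta> by (intro exI[of _ "C2 + Cd + 2"] exI[of _ \<delta>]) auto
qed

theorem theorem1p7:
  fixes \<epsilon> :: real
  assumes "\<epsilon> > 0"
  shows "\<exists>K::real. K > 0 \<and>
    (\<forall>(p::nat) (\<chi>::int \<Rightarrow> complex) (N::int).
       prime p \<longrightarrow> dirichlet_character p \<chi> \<longrightarrow> \<chi> \<noteq> principal_character p \<longrightarrow>
       N < int p \<longrightarrow> real p powr (1 / 8 + \<epsilon>) \<le> real_of_int N \<longrightarrow>
       T_sum \<chi> N \<le> K * real_of_int N ^ 4 * (ln (ln (real p)) / ln (real p)))"
proof -
  define \<epsilon>' where "\<epsilon>' = min \<epsilon> (1 / 4)"
  have \<epsilon>': "0 < \<epsilon>'" "\<epsilon>' \<le> 1 / 4" "\<epsilon>' \<le> \<epsilon>" using assms by (auto simp: \<epsilon>'_def)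
  obtain C \<delta> where C: "C > 0" and \<delta>: "\<delta> > 0" and
    T: "\<And>p \<chi> N. prime p \<Longrightarrow> dirichlet_character p \<chi> \<Longrightarrow> \<chi> \<noteq> principal_character p \<Longrightarrow>
       N < int p \<Longrightarrow> real p powr (1 / 8 + \<epsilon>') \<le> real_of_int N \<Longrightarrow>
       T_sum \<chi> N \<le> C * real_of_int N ^ 4 * real p powr (- \<delta>)"
    using power_saving[OF \<epsilon>'(1,2)] by auto
  define \<kappa> where "\<kappa> = ln (ln (3::real))"
  have ln3: "ln (3::real) > 1"
  proof -
    have "exp (1::real) = exp (1 / 4) ^ 4" by (simp flip: exp_of_nat_mult)
    also have "\<dots> \<le> (1 + 1 / 4 + (1 / 4)\<^sup>2) ^ 4" by (intro power_mono exp_bound) auto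
    also have "\<dots> < (3::real)" by (simp add: power_divide eval_nat_numeral)
    finally have "ln (exp 1) < ln (3::real)" by (subst ln_less_cancel_iff) auto
    then show ?thesis by simp
  qed
  then have \<kappa>: "\<kappa> > 0" by (simp add: \<kappa>_def)
  \<comment> \<open>As \<open>p \<ge> 3\<close>, the number \<open>ln (ln p)\<close> is bounded below by the positive constant \<open>\<kappa>\<close>, so that the saving of a
    power of \<open>p\<close> is more than enough.\<close>
  have key: "real p powr (- \<delta>) \<le> 1 / (\<delta> * \<kappa>) * (ln (ln (real p)) / ln (real p))" if p: "p \<ge> 3" for p :: nat
  proof -
    have lnp: "ln (real p) \<ge> ln 3" using p by simp
    then have lnp0: "ln (real p) > 0" using ln3 by linarith
    have "ln (real p) \<le> real p powr \<delta> / \<delta>" using p \<delta> by (intro ln_powr_bound) auto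
    then have "\<delta> * ln (real p) \<le> real p powr \<delta>" using \<delta> by (simp add: field_simps)
    then have "1 / real p powr \<delta> \<le> 1 / (\<delta> * ln (real p))"
      using \<delta> lnp0 by (intro divide_left_mono) (use p in \<open>auto intro!: mult_pos_pos\<close>)
    then have "real p powr (- \<delta>) \<le> 1 / (\<delta> * ln (real p))" by (simp only: powr_minus_divide)
    also have "\<dots> = 1 / (\<delta> * \<kappa>) * (\<kappa> / ln (real p))" using \<kappa> \<delta> by simp
    also have "\<dots> \<le> 1 / (\<delta> * \<kappa>) * (ln (ln (real p)) / ln (real p))"
    proof (intro mult_left_mono divide_right_mono)
      show "\<kappa> \<le> ln (ln (real p))" unfolding \<kappa>_def using lnp ln3 by (subst ln_le_cancel_iff) linarith+
    qed (use \<kappa> \<delta> lnp0 in auto)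
    finally show ?thesis .
  qed
  show ?thesis
  proof (intro exI[of _ "C / (\<delta> * \<kappa>)"] conjI allI impI)
    show "C / (\<delta> * \<kappa>) > 0" using C \<delta> \<kappa> by simp
    fix p \<chi> N
    assume p: "prime p" and \<chi>: "dirichlet_character p \<chi>" "\<chi> \<noteq> principal_character p"
      and N: "N < int p" "real p powr (1 / 8 + \<epsilon>) \<le> real_of_int N"
    have p3: "p \<ge> 3" by (rule nonprincipal_imp_ge_3[OF p \<chi>])
    have "real p powr (1 / 8 + \<epsilon>') \<le> real p powr (1 / 8 + \<epsilon>)" using p3 \<epsilon>' by (intro powr_mono) auto
    then have "T_sum \<chi> N \<le> (C * real_of_int N ^ 4) * real p powr (- \<delta>)"
      using N by (intro T[OF p \<chi>]) auto
    also have "\<dots> \<le> (C * real_of_int N ^ 4) * (1 / (\<delta> * \<kappa>) * (ln (ln (real p)) / ln (real p)))"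
      using C by (intro mult_left_mono key[OF p3]) auto
    finally show "T_sum \<chi> N \<le> C / (\<delta> * \<kappa>) * real_of_int N ^ 4 * (ln (ln (real p)) / ln (real p))"
      by (simp add: field_simps)
  qed
qed

end
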